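(* Let $h_1,h_2,h_3>0$, $\Omega=(-\frac{h_1}2,\frac{h_1}2)\times(-\frac{h_2}2,\frac{h_2}2)\times(-\frac{h_3}2,\frac{h_3}2)\subset\mathbb{R}^3$ and $\Gamma=\partial\Omega$. To be definite, assume that $\max\{h_1;h_2;h_3\}=h_3$. Then the exact constant $C_2(\Omega,\Gamma)$ is equal to $$\Big(\frac{2z_1}{h_1}\tanh(z_1)\Big)^{-\frac12},$$ where $(z_1,z_2)$, $z_1>0$, $z_2>0$, is the unique solution of the system $$\frac{z_1}{h_1}\tanh(z_1)=\frac{z_2}{h_2}\tanh(z_2)=\frac{z_1}{h_1}\sqrt{1+\frac{\tanh^2(z_1)}{\tanh^2(z_2)}}\cdot\cot\bigg(\frac{z_1h_3}{h_1}\sqrt{1+\frac{\tanh^2(z_1)}{\tanh^2(z_2)}}\bigg)$$ such that $0<\frac{z_1h_3}{h_1}\sqrt{1+\frac{\tanh^2(z_1)}{\tanh^2(z_2)}}<\frac\pi2$.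
   Context: For a bounded connected Lipschitz domain $\Omega\subset\mathbb{R}^d$ and a measurable part $\Gamma\subset\partial\Omega$ of positive $(d-1)$-dimensional measure, let $\widetilde H^1(\Omega,\Gamma)=\{w\in H^1(\Omega): \text{the mean value of (the trace of) } w \text{ on } \Gamma \text{ is zero}\}$. The norm in $L^2(\omega)$ is denoted $\|\cdot\|_{2,\omega}$. The exact (sharp) constant $C_2(\Omega,\Gamma)$ is the smallest constant $C$ such that $\|w\|_{2,\Gamma}\le C\|\nabla w\|_{2,\Omega}$ for all $w\in\widetilde H^1(\Omega,\Gamma)$. *)

theory Defs
  imports "HOL-Analysis.Analysis"
begin

section \<open>Smooth functions and test functions\<close>

text \<open>\<open>C\<^sup>\<infinity>\<close> on the whole space: differentiable, with all directional derivatives again smooth.\<close>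

coinductive smooth :: "('a::euclidean_space \<Rightarrow> real) \<Rightarrow> bool" where
  "(\<And>x. f differentiable (at x)) \<Longrightarrow>
   (\<And>v. smooth (\<lambda>x. frechet_derivative f (at x) v)) \<Longrightarrow> smooth f"

definition grad :: "('a::euclidean_space \<Rightarrow> real) \<Rightarrow> 'a \<Rightarrow> 'a" where
  "grad f x = (\<Sum>b\<in>Basis. frechet_derivative f (at x) b *\<^sub>R b)"

definition test_function :: "'a::euclidean_space set \<Rightarrow> ('a \<Rightarrow> real) \<Rightarrow> bool" where
  "test_function \<Omega> \<phi> \<longleftrightarrow>
     smooth \<phi> \<and> compact (closure {x. \<phi> x \<noteq> 0}) \<and> closure {x. \<phi> x \<noteq> 0} \<subseteq> \<Omega>"


section \<open>Square integrable functions\<close>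

definition in_L2 :: "'a measure \<Rightarrow> ('a \<Rightarrow> 'b::euclidean_space) \<Rightarrow> bool" where
  "in_L2 M f \<longleftrightarrow> f \<in> borel_measurable M \<and> integrable M (\<lambda>x. (norm (f x))\<^sup>2)"

definition L2_norm :: "'a measure \<Rightarrow> ('a \<Rightarrow> 'b::euclidean_space) \<Rightarrow> real" where
  "L2_norm M f = sqrt (LINT x|M. (norm (f x))\<^sup>2)"

text \<open>Convergence is stated with the nonnegative integral, so that a difference which is not
  square integrable counts as having infinite norm (the Bochner integral would give \<open>0\<close>).\<close>

definition tendsto_L2 ::
    "'a measure \<Rightarrow> (nat \<Rightarrow> 'a \<Rightarrow> 'b::euclidean_space) \<Rightarrow> ('a \<Rightarrow> 'b) \<Rightarrow> bool" where
  "tendsto_L2 M f g \<longleftrightarrow>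
     (\<lambda>n. \<integral>\<^sup>+x. ennreal ((norm (f n x - g x))\<^sup>2) \<partial>M) \<longlonglongrightarrow> 0"

definition mean_value :: "'a measure \<Rightarrow> ('a \<Rightarrow> real) \<Rightarrow> real" where
  "mean_value M g = (LINT x|M. g x) / measure M (space M)"


section \<open>The Sobolev space \<open>H\<^sup>1\<close> and traces\<close>

text \<open>The weak gradient is unique only up to null sets; \<open>H1 \<Omega> w G\<close> says that \<open>w \<in> H\<^sup>1(\<Omega>)\<close> and that
  \<open>G\<close> is a representative of \<open>\<nabla>w\<close>.\<close>

definition weak_gradient ::
    "'a::euclidean_space set \<Rightarrow> ('a \<Rightarrow> real) \<Rightarrow> ('a \<Rightarrow> 'a) \<Rightarrow> bool" where
  "weak_gradient \<Omega> w G \<longleftrightarrow>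
     (\<forall>\<phi>. test_function \<Omega> \<phi> \<longrightarrow>
       (LINT x|lebesgue_on \<Omega>. w x *\<^sub>R grad \<phi> x) = - (LINT x|lebesgue_on \<Omega>. \<phi> x *\<^sub>R G x))"

definition H1 :: "'a::euclidean_space set \<Rightarrow> ('a \<Rightarrow> real) \<Rightarrow> ('a \<Rightarrow> 'a) \<Rightarrow> bool" where
  "H1 \<Omega> w G \<longleftrightarrow>
     in_L2 (lebesgue_on \<Omega>) w \<and> in_L2 (lebesgue_on \<Omega>) G \<and> weak_gradient \<Omega> w G"

text \<open>In the following, \<open>S\<close> is the surface measure on the part \<open>\<Gamma>\<close> of the boundary of \<open>\<Omega>\<close>.
  The trace operator \<open>H\<^sup>1(\<Omega>) \<rightarrow> L\<^sup>2(\<Gamma>)\<close> is the continuous extension of the restriction of smooth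
  functions: \<open>g\<close> is the trace of \<open>w\<close> (with weak gradient \<open>G\<close>) if smooth functions converge to \<open>w\<close>
  in \<open>H\<^sup>1(\<Omega>)\<close> while their restrictions to \<open>\<Gamma>\<close> converge to \<open>g\<close> in \<open>L\<^sup>2(\<Gamma>)\<close>. For a bounded
  Lipschitz domain every function in \<open>H\<^sup>1(\<Omega>)\<close> has a trace, unique up to null sets.\<close>

definition has_trace ::
    "'a::euclidean_space set \<Rightarrow> 'a measure \<Rightarrow> ('a \<Rightarrow> real) \<Rightarrow> ('a \<Rightarrow> 'a) \<Rightarrow> ('a \<Rightarrow> real) \<Rightarrow> bool" where
  "has_trace \<Omega> S w G g \<longleftrightarrow> in_L2 S g \<and>
     (\<exists>\<phi>::nat \<Rightarrow> 'a \<Rightarrow> real. (\<forall>n. smooth (\<phi> n)) \<and>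
        tendsto_L2 (lebesgue_on \<Omega>) \<phi> w \<and>
        tendsto_L2 (lebesgue_on \<Omega>) (\<lambda>n. grad (\<phi> n)) G \<and>
        tendsto_L2 S \<phi> g)"

text \<open>\<open>w\<close>, with weak gradient \<open>G\<close> and trace \<open>g\<close>, has mean value zero on \<open>\<Gamma>\<close>.\<close>

definition H1_mean_zero ::
    "'a::euclidean_space set \<Rightarrow> 'a measure \<Rightarrow> ('a \<Rightarrow> real) \<Rightarrow> ('a \<Rightarrow> 'a) \<Rightarrow> ('a \<Rightarrow> real) \<Rightarrow> bool" where
  "H1_mean_zero \<Omega> S w G g \<longleftrightarrow> H1 \<Omega> w G \<and> has_trace \<Omega> S w G g \<and> mean_value S g = 0"


section \<open>The sharp constant\<close>

definition trace_inequality :: "'a::euclidean_space set \<Rightarrow> 'a measure \<Rightarrow> real \<Rightarrow> bool" where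
  "trace_inequality \<Omega> S C \<longleftrightarrow>
     (\<forall>w G g. H1_mean_zero \<Omega> S w G g \<longrightarrow> L2_norm S g \<le> C * L2_norm (lebesgue_on \<Omega>) G)"

definition is_sharp_constant :: "'a::euclidean_space set \<Rightarrow> 'a measure \<Rightarrow> real \<Rightarrow> bool" where
  "is_sharp_constant \<Omega> S C \<longleftrightarrow>
     trace_inequality \<Omega> S C \<and> (\<forall>C'. trace_inequality \<Omega> S C' \<longrightarrow> C \<le> C')"


section \<open>Surface measure of a cuboid\<close>

text \<open>The two-dimensional Lebesgue measure on each of the six faces. The edges, which belong to two
  faces, are null sets. The sums over the two positions of the faces orthogonal to an axis require
  \<open>a $ i \<noteq> b $ i\<close>, that is, a nondegenerate box.\<close>

definition face_area :: "(real^3) set \<Rightarrow> (real \<times> real \<Rightarrow> real^3) \<Rightarrow> (real^3) set \<Rightarrow> ennreal" where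
  "face_area K p A = emeasure (lborel :: (real \<times> real) measure) {y. p y \<in> A \<inter> K}"

definition cuboid_area :: "real^3 \<Rightarrow> real^3 \<Rightarrow> (real^3) set \<Rightarrow> ennreal" where
  "cuboid_area a b A =
     (\<Sum>c\<in>{a$1, b$1}. face_area (cbox a b) (\<lambda>(s, t). vector [c, s, t]) A) +
     (\<Sum>c\<in>{a$2, b$2}. face_area (cbox a b) (\<lambda>(s, t). vector [s, c, t]) A) +
     (\<Sum>c\<in>{a$3, b$3}. face_area (cbox a b) (\<lambda>(s, t). vector [s, t, c]) A)"

definition cuboid_surface :: "real^3 \<Rightarrow> real^3 \<Rightarrow> (real^3) measure" where
  "cuboid_surface a b = measure_of UNIV (sets borel) (cuboid_area a b)"

lemma sets_cuboid_surface [simp, measurable_cong]: "sets (cuboid_surface a b) = sets borel"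
  by (metis cuboid_surface_def sets.sets_measure_of_eq sets_measure_of space_borel)

lemma space_cuboid_surface [simp]: "space (cuboid_surface a b) = UNIV"
  using sets_eq_imp_space_eq[OF sets_cuboid_surface] by simp

lemma vector_3_euclidean: "vector [x, y, z] = x *\<^sub>R axis 1 1 + y *\<^sub>R axis 2 1 + z *\<^sub>R (axis 3 1 :: real^3)"
  by (simp add: vec_eq_iff forall_3 axis_def)

lemma measurable_face_param:
  "(\<lambda>(s, t). vector [c, s, t] :: real^3) \<in> borel_measurable borel"
  "(\<lambda>(s, t). vector [s, c, t] :: real^3) \<in> borel_measurable borel"
  "(\<lambda>(s, t). vector [s, t, c] :: real^3) \<in> borel_measurable borel"
  unfolding vector_3_euclidean case_prod_beta
  by (intro borel_measurable_continuous_onI continuous_intros)+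

lemma countably_additive_face_area:
  assumes "p \<in> borel_measurable borel" "K \<in> sets borel"
  shows "countably_additive (sets borel) (face_area K p)"
proof (unfold countably_additive_def, intro allI impI)
  fix A :: "nat \<Rightarrow> (real^3) set"
  assume A: "range A \<subseteq> sets borel" "disjoint_family A"
  have "{y. p y \<in> A i \<inter> K} \<in> sets lborel" for i
    using measurable_sets[OF assms(1), of "A i \<inter> K"] A assms(2)
    by (auto simp: vimage_def)
  moreover have "disjoint_family (\<lambda>i. {y. p y \<in> A i \<inter> K})"
    using A(2) by (auto simp: disjoint_family_on_def)
  moreover have "(\<Union>i. {y. p y \<in> A i \<inter> K}) = {y. p y \<in> (\<Union>i. A i) \<inter> K}"
    by auto
  ultimately show "(\<Sum>i. face_area K p (A i)) = face_area K p (\<Union>i. A i)"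
    unfolding face_area_def
    using suminf_emeasure[of "\<lambda>i. {y. p y \<in> A i \<inter> K}" lborel] by (auto simp: image_subset_iff)
qed

lemma countably_additive_add:
  fixes f g :: "'a set \<Rightarrow> ennreal"
  assumes "countably_additive M f" "countably_additive M g"
  shows "countably_additive M (\<lambda>A. f A + g A)"
  using assms unfolding countably_additive_def by (auto simp: suminf_add[symmetric])

lemma countably_additive_sum:
  fixes f :: "'i \<Rightarrow> 'a set \<Rightarrow> ennreal"
  assumes "finite I" "\<And>i. i \<in> I \<Longrightarrow> countably_additive M (f i)"
  shows "countably_additive M (\<lambda>A. \<Sum>i\<in>I. f i A)"
  using assms
proof (induction I rule: finite_induct)
  case empty
  then show ?case by (simp add: countably_additive_def)
next
  case (insert i I)
  then show ?case by (simp add: countably_additive_add)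
qed

lemma emeasure_cuboid_surface:
  assumes "A \<in> sets borel"
  shows "emeasure (cuboid_surface a b) A = cuboid_area a b A"
proof (rule emeasure_measure_of[OF cuboid_surface_def])
  show "countably_additive (sets (cuboid_surface a b)) (cuboid_area a b)"
    unfolding cuboid_area_def[abs_def] sets_cuboid_surface
    by (intro countably_additive_add countably_additive_sum countably_additive_face_area
          measurable_face_param) auto
  show "positive (sets (cuboid_surface a b)) (cuboid_area a b)"
    by (simp add: positive_def cuboid_area_def face_area_def)
qed (use assms in auto)

end

theory Submission
  imports Defs
begin

text \<open>
  Completing a square in the derivative of \<open>F f\<^sup>2\<close> shows that a function \<open>F\<close> on an interval with
  \<open>F' + F\<^sup>2 / \<theta> \<le> B\<close> controls boundary values: the boundary term of \<open>F f\<^sup>2\<close> is at most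
  \<open>\<theta> \<integral> f'\<^sup>2 + B \<integral> f\<^sup>2\<close>. On \<open>[-a, a]\<close> and with \<open>\<theta> = 1\<close> the logarithmic derivatives
  \<open>\<alpha> tanh (\<alpha> x)\<close> of \<open>cosh (\<alpha> x)\<close> and \<open>\<gamma> cot (\<gamma> x)\<close> of \<open>sin (\<gamma> x)\<close> give such inequalities with
  \<open>B = \<alpha>\<^sup>2\<close> and \<open>B = - \<gamma>\<^sup>2\<close>, the second one for \<open>f\<close> vanishing at the pole \<open>0\<close>
  (\<open>tanh_boundary_bound\<close>, \<open>cot_boundary_bound\<close>).

  Let \<open>r\<^sub>i = h\<^sub>i / 2\<close>, \<open>\<alpha> = z\<^sub>1 / r\<^sub>1\<close>, \<open>\<beta> = z\<^sub>2 / r\<^sub>2\<close> and \<open>\<gamma>\<^sup>2 = \<alpha>\<^sup>2 + \<beta>\<^sup>2\<close>. The system says that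
  \<open>\<alpha> tanh (\<alpha> r\<^sub>1)\<close>, \<open>\<beta> tanh (\<beta> r\<^sub>2)\<close> and \<open>\<gamma> cot (\<gamma> r\<^sub>3)\<close> have a common value \<open>\<mu>\<close>. Applying one
  inequality to every line parallel to each axis, integrating over the cross sections and adding up
  gives \<open>\<mu> \<integral>\<^sub>\<Gamma> w\<^sup>2 \<le> \<integral>\<^sub>\<Omega> |\<nabla>w|\<^sup>2 + (\<alpha>\<^sup>2 + \<beta>\<^sup>2 - \<gamma>\<^sup>2) \<integral>\<^sub>\<Omega> w\<^sup>2\<close>, where the last term vanishes, for
  every \<open>w\<close> that vanishes on the plane \<open>x\<^sub>3 = 0\<close>. The function
  \<open>cosh (\<alpha> x\<^sub>1) cosh (\<beta> x\<^sub>2) sin (\<gamma> x\<^sub>3)\<close> turns all inequalities into equalities; it is harmonic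
  with normal derivative \<open>\<mu>\<close> times itself on the boundary, has mean value zero on \<open>\<Gamma>\<close>, and so shows
  that \<open>\<mu> powr (- 1 / 2)\<close> cannot be improved (\<open>eigenfunction_energy\<close>,
  \<open>is_sharp_constant_steklov\<close>).

  For the inequality itself a general \<open>w\<close> is split by parity under the reflections \<open>x\<^sub>i \<mapsto> - x\<^sub>i\<close>. The
  parts are orthogonal both in \<open>L\<^sup>2(\<Gamma>)\<close> and for the Dirichlet integral (\<open>surf_parity\<close>,
  \<open>energy_parity\<close>), so each part can be treated separately (\<open>parity_step\<close>).
  A part that is odd in some coordinate admits the cotangent in that coordinate; as the third side is
  longest, the constants for the other assignments of the coordinates are at least \<open>\<mu>\<close>
  (\<open>odd_boundary_bound\<close>). For the part that is even in all three coordinates there is room to spare: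
  with \<open>\<theta> = 1/2\<close> only half of the Dirichlet integral is spent, at the price of a multiple \<open>B\<close> of
  \<open>\<integral>\<^sub>\<Omega> w\<^sup>2\<close>. After subtraction of the mean value of \<open>w\<close> over \<open>\<Omega>\<close>, the other half pays for that term by
  the Poincare inequality; an even function on \<open>[-r\<^sub>i, r\<^sub>i]\<close> is a function on \<open>[0, r\<^sub>i]\<close>, so the
  constant is \<open>(r\<^sub>3 / \<pi>)\<^sup>2\<close>, and \<open>B (r\<^sub>3 / \<pi>)\<^sup>2 \<le> 1/2\<close> follows from \<open>\<gamma> r\<^sub>3 < \<pi>/2\<close> and
  \<open>\<mu> r\<^sub>3 \<le> 3/5\<close> (\<open>\<mu>_bound\<close>, \<open>even_boundary_bound_zero\<close>). Subtracting the mean value over \<open>\<Omega>\<close>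
  instead of the one over \<open>\<Gamma>\<close> is harmless, since the latter minimises the norm in \<open>L\<^sup>2(\<Gamma>)\<close>.

  The inequality is stated with \<open>\<integral>\<^sub>\<Gamma> w\<^sup>2 - (\<integral>\<^sub>\<Gamma> w)\<^sup>2 / |\<Gamma>|\<close> on its left-hand side
  (\<open>boundary_bound\<close>). In this form it holds for every smooth \<open>w\<close> and passes to the limit from smooth
  functions to functions in \<open>H\<^sup>1\<close> and their traces (\<open>trace_bound\<close>).

  The system has exactly one solution because \<open>z tanh z\<close> increases strictly from \<open>0\<close> to \<open>\<infinity>\<close>: the
  common value of its first two members determines \<open>z\<^sub>1\<close> and \<open>z\<^sub>2\<close> as increasing functions, and what
  remains equates a strictly decreasing function of that value with an increasing one
  (\<open>exists_unique_frequency\<close>).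
\<close>

section \<open>Boundary values and Dirichlet integrals on an interval\<close>

text \<open>The integral of \<open>(\<theta> f' - F f)\<^sup>2 / \<theta>\<close> is nonnegative. Up to sign, its cross term together with
  \<open>F' f\<^sup>2\<close> is the derivative of \<open>F f\<^sup>2\<close>.\<close>

lemma riccati_boundary_bound:
  fixes f f' F F' :: "real \<Rightarrow> real"
  assumes "l \<le> r" "\<theta> > 0"
    and f: "\<And>x. x \<in> {l..r} \<Longrightarrow> (f has_real_derivative f' x) (at x within {l..r})"
    and f': "continuous_on {l..r} f'"
    and F: "\<And>x. x \<in> {l..r} \<Longrightarrow> (F has_real_derivative F' x) (at x within {l..r})"
    and B: "\<And>x. x \<in> {l..r} \<Longrightarrow> F' x + (F x)\<^sup>2 / \<theta> \<le> B"
  shows "F r * (f r)\<^sup>2 - F l * (f l)\<^sup>2 \<le>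
    \<theta> * integral {l..r} (\<lambda>x. (f' x)\<^sup>2) + B * integral {l..r} (\<lambda>x. (f x)\<^sup>2)"
proof -
  let ?P' = "\<lambda>x. F' x * (f x)\<^sup>2 + F x * (2 * f x * f' x)"
  have cf: "continuous_on {l..r} f"
    using f by (meson DERIV_continuous continuous_on_eq_continuous_within)
  have "(?P' has_integral (F r * (f r)\<^sup>2 - F l * (f l)\<^sup>2)) {l..r}"
  proof (rule fundamental_theorem_of_calculus[OF \<open>l \<le> r\<close>])
    fix x assume x: "x \<in> {l..r}"
    have "((\<lambda>x. F x * (f x)\<^sup>2) has_real_derivative ?P' x) (at x within {l..r})"
      by (auto intro!: derivative_eq_intros F[OF x] f[OF x])
    then show "((\<lambda>x. F x * (f x)\<^sup>2) has_vector_derivative ?P' x) (at x within {l..r})"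
      by (simp add: has_real_derivative_iff_has_vector_derivative)
  qed
  moreover have "((\<lambda>x. \<theta> * (f' x)\<^sup>2 + B * (f x)\<^sup>2) has_integral
      (\<theta> * integral {l..r} (\<lambda>x. (f' x)\<^sup>2) + B * integral {l..r} (\<lambda>x. (f x)\<^sup>2))) {l..r}"
    by (intro has_integral_add has_integral_mult_right integrable_integral
        integrable_continuous_interval continuous_intros f' cf)
  ultimately show ?thesis
  proof (rule has_integral_le)
    fix x assume x: "x \<in> {l..r}"
    have "0 \<le> (\<theta> * f' x - F x * f x)\<^sup>2 / \<theta>"
      using \<open>\<theta> > 0\<close> by simp
    also have "\<dots> = \<theta> * (f' x)\<^sup>2 - 2 * F x * f x * f' x + ((F x)\<^sup>2 / \<theta>) * (f x)\<^sup>2"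
      using \<open>\<theta> > 0\<close> by (simp add: power2_eq_square field_simps)
    finally have "F x * (2 * f x * f' x) \<le> \<theta> * (f' x)\<^sup>2 + ((F x)\<^sup>2 / \<theta>) * (f x)\<^sup>2"
      by simp
    moreover have "(F' x + (F x)\<^sup>2 / \<theta>) * (f x)\<^sup>2 \<le> B * (f x)\<^sup>2"
      by (intro mult_right_mono B[OF x]) simp
    ultimately show "?P' x \<le> \<theta> * (f' x)\<^sup>2 + B * (f x)\<^sup>2"
      by (simp add: algebra_simps)
  qed
qed

text \<open>The function \<open>F x = \<alpha> tanh (\<alpha> x)\<close> satisfies \<open>F' + F\<^sup>2 = \<alpha>\<^sup>2\<close>, so that
  \<open>F' + F\<^sup>2 / \<theta>\<close> exceeds \<open>\<alpha>\<^sup>2\<close> by at most \<open>(1 / \<theta> - 1) (F a)\<^sup>2\<close>. For \<open>\<theta> = 1\<close> the inequality is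
  sharp; a smaller \<open>\<theta>\<close> uses less of the Dirichlet integral.\<close>

lemma tanh_boundary_bound:
  fixes f f' :: "real \<Rightarrow> real"
  assumes "a > 0" "0 < \<theta>" "\<theta> \<le> 1" 
    and f: "\<And>x. (f has_real_derivative f' x) (at x)"
    and f': "continuous_on UNIV f'"
  shows "\<alpha> * tanh (\<alpha> * a) * ((f a)\<^sup>2 + (f (- a))\<^sup>2) \<le>
    \<theta> * integral {-a..a} (\<lambda>x. (f' x)\<^sup>2) +
    (\<alpha>\<^sup>2 + (1 / \<theta> - 1) * (\<alpha> * tanh (\<alpha> * a))\<^sup>2) * integral {-a..a} (\<lambda>x. (f x)\<^sup>2)"
proof -
  let ?F = "\<lambda>x. \<alpha> * tanh (\<alpha> * x)"
  have "?F a * (f a)\<^sup>2 - ?F (- a) * (f (- a))\<^sup>2 \<le> \<theta> * integral {-a..a} (\<lambda>x. (f' x)\<^sup>2) +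
    (\<alpha>\<^sup>2 + (1 / \<theta> - 1) * (\<alpha> * tanh (\<alpha> * a))\<^sup>2) * integral {-a..a} (\<lambda>x. (f x)\<^sup>2)"
  proof (rule riccati_boundary_bound)
    fix x assume x: "x \<in> {-a..a}"
    show "(f has_real_derivative f' x) (at x within {-a..a})"
      using f by (rule has_field_derivative_at_within)
    show "(?F has_real_derivative \<alpha>\<^sup>2 * (1 - (tanh (\<alpha> * x))\<^sup>2)) (at x within {-a..a})"
      by (auto intro!: derivative_eq_intros simp: cosh_real_nonzero power2_eq_square)
    have "\<bar>\<alpha> * x\<bar> \<le> \<bar>\<alpha> * a\<bar>"
      using x by (simp add: abs_mult mult_left_mono abs_le_iff)
    then have "\<bar>tanh (\<alpha> * x)\<bar> \<le> \<bar>tanh (\<alpha> * a)\<bar>"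
      by (metis tanh_real_le_iff tanh_real_abs)
    then have "(?F x)\<^sup>2 \<le> (?F a)\<^sup>2"
      by (auto simp: power_mult_distrib abs_le_square_iff intro!: mult_left_mono)
    then have "(1 / \<theta> - 1) * (?F x)\<^sup>2 \<le> (1 / \<theta> - 1) * (?F a)\<^sup>2"
      by (rule mult_left_mono) (use assms in simp)
    then show "\<alpha>\<^sup>2 * (1 - (tanh (\<alpha> * x))\<^sup>2) + (?F x)\<^sup>2 / \<theta> \<le> \<alpha>\<^sup>2 + (1 / \<theta> - 1) * (?F a)\<^sup>2"
      by (simp add: algebra_simps power2_eq_square)
  qed (use assms in \<open>auto intro: continuous_on_subset\<close>)
  then show ?thesis
    by (simp add: algebra_simps)
qed

text \<open>Here \<open>F x = \<mu> x / a\<close>. For small \<open>\<mu> a\<close> this is close to the hyperbolic tangent with the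
  same boundary value \<open>\<mu>\<close>, and its constant is explicit in \<open>\<mu>\<close>.\<close>

lemma linear_boundary_bound:
  fixes f f' :: "real \<Rightarrow> real"
  assumes "a > 0" "\<theta> > 0" 
    and f: "\<And>x. (f has_real_derivative f' x) (at x)"
    and f': "continuous_on UNIV f'"
  shows "\<mu> * ((f a)\<^sup>2 + (f (- a))\<^sup>2) \<le>
    \<theta> * integral {-a..a} (\<lambda>x. (f' x)\<^sup>2) + (\<mu> / a + \<mu>\<^sup>2 / \<theta>) * integral {-a..a} (\<lambda>x. (f x)\<^sup>2)"
proof -
  let ?F = "\<lambda>x. \<mu> * x / a"
  have "?F a * (f a)\<^sup>2 - ?F (- a) * (f (- a))\<^sup>2 \<le>
    \<theta> * integral {-a..a} (\<lambda>x. (f' x)\<^sup>2) + (\<mu> / a + \<mu>\<^sup>2 / \<theta>) * integral {-a..a} (\<lambda>x. (f x)\<^sup>2)"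
  proof (rule riccati_boundary_bound)
    fix x assume x: "x \<in> {-a..a}"
    show "(f has_real_derivative f' x) (at x within {-a..a})"
      using f by (rule has_field_derivative_at_within)
    show "(?F has_real_derivative \<mu> / a) (at x within {-a..a})"
      using \<open>a > 0\<close> by (auto intro!: derivative_eq_intros)
    have "x\<^sup>2 \<le> a\<^sup>2"
      using x \<open>a > 0\<close> by (intro abs_le_square_iff[THEN iffD1]) auto
    then have "(?F x)\<^sup>2 \<le> \<mu>\<^sup>2"
      using \<open>a > 0\<close> by (simp add: power_mult_distrib power_divide divide_le_eq mult_left_mono)
    then show "\<mu> / a + (?F x)\<^sup>2 / \<theta> \<le> \<mu> / a + \<mu>\<^sup>2 / \<theta>"
      using \<open>\<theta> > 0\<close> by (simp add: divide_right_mono)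
  qed (use assms in \<open>auto intro: continuous_on_subset\<close>)
  then show ?thesis
    using \<open>a > 0\<close> by (simp add: algebra_simps)
qed

text \<open>The function \<open>F x = \<gamma> cot (\<gamma> x)\<close> satisfies \<open>F' + F\<^sup>2 = - \<gamma>\<^sup>2\<close>. Its pole at \<open>0\<close> is
  compensated by the double zero of \<open>f\<^sup>2\<close>: the product \<open>F f\<^sup>2\<close> extends continuously by \<open>0\<close>.\<close>

lemma cot_boundary_bound_half:
  fixes f f' :: "real \<Rightarrow> real"
  assumes "d > 0" "\<gamma> > 0" "\<gamma> * d < pi"
    and f: "\<And>x. x \<in> {0..d} \<Longrightarrow> (f has_real_derivative f' x) (at x within {0..d})"
    and f': "continuous_on {0..d} f'"
    and f0: "f 0 = 0"
  shows "\<gamma> * cot (\<gamma> * d) * (f d)\<^sup>2 \<le>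
    integral {0..d} (\<lambda>x. (f' x)\<^sup>2) - \<gamma>\<^sup>2 * integral {0..d} (\<lambda>x. (f x)\<^sup>2)"
proof -
  let ?P = "\<lambda>x. \<gamma> * cot (\<gamma> * x) * (f x)\<^sup>2"
  let ?P' = "\<lambda>x. - \<gamma>\<^sup>2 * (1 + (cot (\<gamma> * x))\<^sup>2) * (f x)\<^sup>2 + \<gamma> * cot (\<gamma> * x) * (2 * f x * f' x)"
  have cf: "continuous_on {0..d} f"
    using f by (meson DERIV_continuous continuous_on_eq_continuous_within)
  have sin: "sin (\<gamma> * x) > 0" if "0 < x" "x \<le> d" for x
  proof (rule sin_gt_zero)
    show "0 < \<gamma> * x" using that assms by simp
    have "\<gamma> * x \<le> \<gamma> * d" using that assms by simp
    then show "\<gamma> * x < pi" using assms by linarith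
  qed
  have cot: "((\<lambda>x. cot (\<gamma> * x)) has_real_derivative - \<gamma> * (1 + (cot (\<gamma> * x))\<^sup>2)) (at x)"
    if "0 < x" "x \<le> d" for x
  proof -
    have "(cot has_real_derivative - inverse ((sin (\<gamma> * x))\<^sup>2)) (at (\<gamma> * x))"
      by (rule DERIV_cot) (use sin[OF that] in simp)
    then have "((\<lambda>x. cot (\<gamma> * x)) has_real_derivative (- inverse ((sin (\<gamma> * x))\<^sup>2)) * \<gamma>) (at x)"
      by (rule DERIV_chain2) (auto intro!: derivative_eq_intros)
    moreover have "inverse ((sin (\<gamma> * x))\<^sup>2) = 1 + (cot (\<gamma> * x))\<^sup>2"
      using sin[OF that] by (simp add: cot_def power_divide field_simps)
    ultimately show ?thesis
      by (simp add: algebra_simps)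
  qed
  have "(?P has_real_derivative ?P' x) (at x)" if "0 < x" "x < d" for x
  proof -
    have "(f has_real_derivative f' x) (at x)"
      using f[of x] that by (simp add: at_within_Icc_at)
    from DERIV_mult[OF DERIV_cmult[OF cot[of x], of \<gamma>] DERIV_power[OF this, of 2]] that
    show ?thesis
      by (auto elim!: DERIV_cong simp: algebra_simps power2_eq_square)
  qed
  moreover have "continuous_on {0..d} ?P"
  proof (unfold continuous_on_eq_continuous_within, intro ballI)
    fix x assume x: "x \<in> {0..d}"
    show "continuous (at x within {0..d}) ?P"
    proof (cases "x = 0")
      case False
      with x have "continuous (at x within {0..d}) (\<lambda>x. cot (\<gamma> * x))"
        using DERIV_continuous[OF has_field_derivative_at_within[OF cot[of x]]] by auto
      moreover have "continuous (at x within {0..d}) f"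
        using x cf by (simp add: continuous_on_eq_continuous_within)
      ultimately show ?thesis
        by (intro continuous_mult continuous_const continuous_power)
    next
      case True
      \<comment> \<open>away from \<open>0\<close> the value is the product of \<open>cos (\<gamma> x)\<close>, \<open>\<gamma> x / sin (\<gamma> x)\<close>, \<open>f x / x\<close> and \<open>f x\<close>;
        all factors converge, the last one to \<open>0\<close>\<close>
      have "((\<lambda>x. (f x - f 0) / (x - 0)) \<longlongrightarrow> f' 0) (at 0 within {0..d})"
        using f[of 0] \<open>d > 0\<close> by (simp add: has_field_derivative_iff)
      then have 1: "((\<lambda>x. f x / x) \<longlongrightarrow> f' 0) (at 0 within {0..d})"
        by (simp add: f0)
      have 2: "(f \<longlongrightarrow> 0) (at 0 within {0..d})"
        using cf \<open>d > 0\<close> f0 by (auto simp: continuous_on_def dest: bspec[of _ _ 0])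
      have "((\<lambda>x. sin (\<gamma> * x)) has_real_derivative \<gamma>) (at 0 within {0..d})"
        by (auto intro!: derivative_eq_intros)
      then have 3: "((\<lambda>x. sin (\<gamma> * x) / x) \<longlongrightarrow> \<gamma>) (at 0 within {0..d})"
        by (simp add: has_field_derivative_iff)
      have 4: "((\<lambda>x. cos (\<gamma> * x)) \<longlongrightarrow> cos (\<gamma> * 0)) (at 0 within {0..d})"
        by (intro tendsto_intros)
      have "((\<lambda>x. \<gamma> * (cos (\<gamma> * x) / (sin (\<gamma> * x) / x) * (f x / x) * f x))
          \<longlongrightarrow> \<gamma> * (cos (\<gamma> * 0) / \<gamma> * f' 0 * 0)) (at 0 within {0..d})"
        by (intro tendsto_intros 1 2 3 4) (use \<open>\<gamma> > 0\<close> in simp)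
      moreover have "(\<lambda>x. \<gamma> * (cos (\<gamma> * x) / (sin (\<gamma> * x) / x) * (f x / x) * f x)) = ?P"
      proof
        show "\<gamma> * (cos (\<gamma> * x) / (sin (\<gamma> * x) / x) * (f x / x) * f x) = ?P x" for x
          by (cases "x = 0") (auto simp: cot_def power2_eq_square)
      qed
      ultimately have "(?P \<longlongrightarrow> \<gamma> * (cos (\<gamma> * 0) / \<gamma> * f' 0 * 0)) (at 0 within {0..d})"
        by (simp only:)
      then show ?thesis
        using True by (simp add: continuous_within f0)
    qed
  qed
  ultimately have "(?P' has_integral (?P d - ?P 0)) {0..d}"
    using \<open>d > 0\<close>
    by (intro fundamental_theorem_of_calculus_interior)
      (auto simp: has_real_derivative_iff_has_vector_derivative)
  moreover have "((\<lambda>x. (f' x)\<^sup>2 - \<gamma>\<^sup>2 * (f x)\<^sup>2) has_integral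
      (integral {0..d} (\<lambda>x. (f' x)\<^sup>2) - \<gamma>\<^sup>2 * integral {0..d} (\<lambda>x. (f x)\<^sup>2))) {0..d}"
    by (intro has_integral_diff has_integral_mult_right integrable_integral
        integrable_continuous_interval continuous_intros f' cf)
  ultimately have "?P d - ?P 0 \<le>
      integral {0..d} (\<lambda>x. (f' x)\<^sup>2) - \<gamma>\<^sup>2 * integral {0..d} (\<lambda>x. (f x)\<^sup>2)"
  proof (rule has_integral_le)
    fix x
    have "0 \<le> (f' x - \<gamma> * cot (\<gamma> * x) * f x)\<^sup>2" by simp
    then show "?P' x \<le> (f' x)\<^sup>2 - \<gamma>\<^sup>2 * (f x)\<^sup>2"
      by (simp add: power2_eq_square algebra_simps)
  qed
  then show ?thesis
    by (simp add: f0)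
qed

lemma integral_fold:
  fixes g :: "real \<Rightarrow> real"
  assumes "a > 0" "continuous_on {-a..a} g"
  shows "integral {-a..a} g = integral {0..a} g + integral {0..a} (\<lambda>x. g (- x))"
proof -
  have "integral {-a..0} g + integral {0..a} g = integral {-a..a} g"
    using assms by (intro Henstock_Kurzweil_Integration.integral_combine integrable_continuous_interval) auto
  moreover have "integral {-a..0} g = integral {0..a} (\<lambda>x. g (- x))"
    using Henstock_Kurzweil_Integration.integral_reflect_real[of 0 "-a" g] by simp
  ultimately show ?thesis by simp
qed

lemma cot_boundary_bound:
  fixes f f' :: "real \<Rightarrow> real"
  assumes "a > 0" "\<gamma> > 0" "\<gamma> * a < pi"
    and f: "\<And>x. (f has_real_derivative f' x) (at x)"
    and f': "continuous_on UNIV f'"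
    and f0: "f 0 = 0"
  shows "\<gamma> * cot (\<gamma> * a) * ((f a)\<^sup>2 + (f (- a))\<^sup>2) \<le>
    integral {-a..a} (\<lambda>x. (f' x)\<^sup>2) - \<gamma>\<^sup>2 * integral {-a..a} (\<lambda>x. (f x)\<^sup>2)"
proof -
  have cf: "continuous_on S f" for S
    using f by (meson DERIV_continuous continuous_at_imp_continuous_on)
  have cf': "continuous_on S f'" for S
    using f' continuous_on_subset by blast
  have "\<gamma> * cot (\<gamma> * a) * (f a)\<^sup>2 \<le>
    integral {0..a} (\<lambda>x. (f' x)\<^sup>2) - \<gamma>\<^sup>2 * integral {0..a} (\<lambda>x. (f x)\<^sup>2)"
    using assms by (intro cot_boundary_bound_half has_field_derivative_at_within[OF f] cf')
  moreover have "\<gamma> * cot (\<gamma> * a) * (f (- a))\<^sup>2 \<le>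
    integral {0..a} (\<lambda>x. (- f' (- x))\<^sup>2) - \<gamma>\<^sup>2 * integral {0..a} (\<lambda>x. (f (- x))\<^sup>2)"
  proof (rule cot_boundary_bound_half)
    fix x
    have "((\<lambda>x. f (- x)) has_real_derivative f' (- x) * - 1) (at x within {0..a})"
      by (rule DERIV_chain2[OF f]) (auto intro!: derivative_eq_intros)
    then show "((\<lambda>x. f (- x)) has_real_derivative - f' (- x)) (at x within {0..a})" by simp
    show "continuous_on {0..a} (\<lambda>x. - f' (- x))"
      by (intro continuous_intros continuous_on_compose2[OF f']) auto
  qed (use assms in auto)
  ultimately show ?thesis
    using integral_fold[OF \<open>a > 0\<close>, of "\<lambda>x. (f x)\<^sup>2"] integral_fold[OF \<open>a > 0\<close>, of "\<lambda>x. (f' x)\<^sup>2"]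
    by (simp add: algebra_simps continuous_on_power cf cf')
qed

text \<open>With \<open>\<gamma> = \<pi> / a\<close> the cotangent vanishes at the midpoint, so the two halves of the
  interval, each seen from its endpoint, contribute no boundary term there.\<close>

lemma wirtinger_dirichlet:
  fixes g g' :: "real \<Rightarrow> real"
  assumes "a > 0"
    and g: "\<And>x. x \<in> {0..a} \<Longrightarrow> (g has_real_derivative g' x) (at x within {0..a})"
    and g': "continuous_on {0..a} g'"
    and "g 0 = 0" "g a = 0"
  shows "integral {0..a} (\<lambda>x. (g x)\<^sup>2) \<le> (a / pi)\<^sup>2 * integral {0..a} (\<lambda>x. (g' x)\<^sup>2)"
proof -
  let ?c = "pi / a"
  have cg: "continuous_on {0..a} g"
    using g by (meson DERIV_continuous continuous_on_eq_continuous_within)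
  have eq: "?c * (a / 2) = pi / 2"
    using \<open>a > 0\<close> by simp
  have "?c * cot (?c * (a / 2)) * (g (a / 2))\<^sup>2 \<le>
    integral {0..a/2} (\<lambda>x. (g' x)\<^sup>2) - ?c\<^sup>2 * integral {0..a/2} (\<lambda>x. (g x)\<^sup>2)"
  proof (rule cot_boundary_bound_half)
    fix x assume "x \<in> {0..a/2}"
    then show "(g has_real_derivative g' x) (at x within {0..a/2})"
      using \<open>a > 0\<close> by (intro has_field_derivative_subset[OF g]) auto
  next
    show "continuous_on {0..a/2} g'"
      using \<open>a > 0\<close> by (intro continuous_on_subset[OF g']) auto
  qed (use assms in \<open>auto simp: eq\<close>)
  then have 1: "?c\<^sup>2 * integral {0..a/2} (\<lambda>x. (g x)\<^sup>2) \<le> integral {0..a/2} (\<lambda>x. (g' x)\<^sup>2)"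
    unfolding eq by (simp add: cot_def)
  have "?c * cot (?c * (a / 2)) * (g (a - a / 2))\<^sup>2 \<le>
    integral {0..a/2} (\<lambda>x. (- g' (a - x))\<^sup>2) - ?c\<^sup>2 * integral {0..a/2} (\<lambda>x. (g (a - x))\<^sup>2)"
  proof (rule cot_boundary_bound_half[where f="\<lambda>x. g (a - x)" and f'="\<lambda>x. - g' (a - x)"])
    fix x assume x: "x \<in> {0..a/2}"
    have "((\<lambda>x. g (a - x)) has_real_derivative g' (a - x) * - 1) (at x within {0..a/2})"
    proof (rule DERIV_image_chain[where f=g and g="\<lambda>x. a - x", unfolded o_def])
      show "(g has_real_derivative g' (a - x)) (at (a - x) within (\<lambda>x. a - x) ` {0..a/2})"
        using \<open>a > 0\<close> x by (intro has_field_derivative_subset[OF g]) auto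
    qed (auto intro!: derivative_eq_intros)
    then show "((\<lambda>x. g (a - x)) has_real_derivative - g' (a - x)) (at x within {0..a/2})"
      by simp
  next
    show "continuous_on {0..a/2} (\<lambda>x. - g' (a - x))"
      using \<open>a > 0\<close> by (intro continuous_intros continuous_on_compose2[OF g']) auto
  qed (use assms in \<open>auto simp: eq\<close>)
  then have 2: "?c\<^sup>2 * integral {0..a/2} (\<lambda>x. (g (a - x))\<^sup>2) \<le> integral {0..a/2} (\<lambda>x. (g' (a - x))\<^sup>2)"
    unfolding eq by (simp add: cot_def)
  have split: "integral {0..a} f = integral {0..a/2} f + integral {0..a/2} (\<lambda>x. f (a - x))"
    if "continuous_on {0..a} f" for f :: "real \<Rightarrow> real"
  proof -
    have "integral {0..a/2} f + integral {a/2..a} f = integral {0..a} f"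
      using \<open>a > 0\<close> that
      by (intro Henstock_Kurzweil_Integration.integral_combine integrable_continuous_interval) auto
    moreover have "integral {0..a/2} (\<lambda>x. f (a - x)) = integral {-(a/2)..0} (\<lambda>x. f (a + x))"
      using Henstock_Kurzweil_Integration.integral_reflect_real[of 0 "-(a/2)" "\<lambda>x. f (a + x)"] by simp
    moreover have "\<dots> = integral {a/2..a} f"
      using integral_shift_Icc_real[of "-(a/2)" 0 f a] by (simp add: comp_def)
    ultimately show ?thesis by simp
  qed
  have "?c\<^sup>2 * integral {0..a} (\<lambda>x. (g x)\<^sup>2) \<le> integral {0..a} (\<lambda>x. (g' x)\<^sup>2)"
    using 1 2 split[of "\<lambda>x. (g x)\<^sup>2"] split[of "\<lambda>x. (g' x)\<^sup>2"] cg g'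
    by (simp add: continuous_on_power distrib_left)
  then show ?thesis
    using \<open>a > 0\<close> by (simp add: field_simps power_divide)
qed

text \<open>The antiderivative \<open>g\<close> of \<open>f\<close> vanishes at both endpoints, and integration by parts gives
  \<open>\<integral> f\<^sup>2 = - \<integral> g f'\<close>. The inequality for \<open>g\<close> bounds the right-hand side.\<close>

lemma wirtinger_neumann:
  fixes f f' :: "real \<Rightarrow> real"
  assumes "a > 0"
    and f: "\<And>x. (f has_real_derivative f' x) (at x)"
    and f': "continuous_on UNIV f'"
    and mean: "integral {0..a} f = 0"
  shows "integral {0..a} (\<lambda>x. (f x)\<^sup>2) \<le> (a / pi)\<^sup>2 * integral {0..a} (\<lambda>x. (f' x)\<^sup>2)"
proof -
  have cf: "continuous_on S f" for S
    using f by (meson DERIV_continuous continuous_at_imp_continuous_on)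
  have cf': "continuous_on S f'" for S
    using f' continuous_on_subset by blast
  define g where "g x = integral {0..x} f" for x
  have g: "(g has_real_derivative f x) (at x within {0..a})" if "x \<in> {0..a}" for x
    using integral_has_vector_derivative[OF cf that] 
    by (simp add: g_def[abs_def] has_real_derivative_iff_has_vector_derivative)
  have cg: "continuous_on {0..a} g"
    using g by (meson DERIV_continuous continuous_on_eq_continuous_within)
  have g0: "g 0 = 0" "g a = 0"
    using mean by (auto simp: g_def)
  define N where "N = integral {0..a} (\<lambda>x. (f x)\<^sup>2)"
  define N' where "N' = integral {0..a} (\<lambda>x. (f' x)\<^sup>2)"
  have W: "integral {0..a} (\<lambda>x. (g x)\<^sup>2) \<le> (a / pi)\<^sup>2 * N"
    unfolding N_def by (rule wirtinger_dirichlet[OF \<open>a > 0\<close> g cf g0])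
  have "((\<lambda>x. f x * f x + g x * f' x) has_integral (g a * f a - g 0 * f 0)) {0..a}"
  proof (rule fundamental_theorem_of_calculus)
    fix x assume "x \<in> {0..a}"
    then have "((\<lambda>x. g x * f x) has_real_derivative (f x * f x + g x * f' x)) (at x within {0..a})"
      by (auto intro!: derivative_eq_intros g has_field_derivative_at_within[OF f])
    then show "((\<lambda>x. g x * f x) has_vector_derivative (f x * f x + g x * f' x)) (at x within {0..a})"
      by (simp add: has_real_derivative_iff_has_vector_derivative)
  qed (use \<open>a > 0\<close> in simp)
  then have parts: "((\<lambda>x. (f x)\<^sup>2 + g x * f' x) has_integral 0) {0..a}"
    by (simp add: g0 power2_eq_square)
  \<comment> \<open>\<open>0 \<le> ((\<pi>/a) g + (a/\<pi>) f')\<^sup>2\<close> integrated, with the cross term evaluated by parts\<close>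
  have "((\<lambda>x. (pi / a)\<^sup>2 * (g x)\<^sup>2 + (a / pi)\<^sup>2 * (f' x)\<^sup>2 - 2 * (f x)\<^sup>2 + 2 * ((f x)\<^sup>2 + g x * f' x)) has_integral
      ((pi / a)\<^sup>2 * integral {0..a} (\<lambda>x. (g x)\<^sup>2) + (a / pi)\<^sup>2 * N' - 2 * N + 2 * 0)) {0..a}"
    unfolding N_def N'_def
    by (intro has_integral_add has_integral_diff has_integral_mult_right integrable_integral parts
        integrable_continuous_interval continuous_intros cf cf' cg)
  then have "0 \<le> (pi / a)\<^sup>2 * integral {0..a} (\<lambda>x. (g x)\<^sup>2) + (a / pi)\<^sup>2 * N' - 2 * N + 2 * 0"
  proof (rule has_integral_nonneg)
    fix x
    have "0 \<le> ((pi / a) * g x + (a / pi) * f' x)\<^sup>2" by simp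
    also have "\<dots> = (pi / a)\<^sup>2 * (g x)\<^sup>2 + (a / pi)\<^sup>2 * (f' x)\<^sup>2 + 2 * (g x * f' x)"
      using \<open>a > 0\<close> by (simp add: power2_eq_square field_simps)
    finally show "0 \<le> (pi / a)\<^sup>2 * (g x)\<^sup>2 + (a / pi)\<^sup>2 * (f' x)\<^sup>2 - 2 * (f x)\<^sup>2 +
        2 * ((f x)\<^sup>2 + g x * f' x)"
      by simp
  qed
  moreover have "(pi / a)\<^sup>2 * integral {0..a} (\<lambda>x. (g x)\<^sup>2) \<le> N"
    using W \<open>a > 0\<close> by (simp add: field_simps power_divide)
  ultimately show ?thesis
    unfolding N_def N'_def by simp
qed

text \<open>Evenness halves the interval: for general \<open>f\<close> of mean value zero on \<open>[-a, a]\<close> the constant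
  would be \<open>(2 a / \<pi>)\<^sup>2\<close>.\<close>

lemma wirtinger_even:
  fixes f f' :: "real \<Rightarrow> real"
  assumes "a > 0"
    and f: "\<And>x. (f has_real_derivative f' x) (at x)"
    and f': "continuous_on UNIV f'"
    and even: "\<And>x. f (- x) = f x"
    and mean: "integral {-a..a} f = 0"
  shows "integral {-a..a} (\<lambda>x. (f x)\<^sup>2) \<le> (a / pi)\<^sup>2 * integral {-a..a} (\<lambda>x. (f' x)\<^sup>2)"
proof -
  have cf: "continuous_on S f" for S
    using f by (meson DERIV_continuous continuous_at_imp_continuous_on)
  have cf': "continuous_on S f'" for S
    using f' continuous_on_subset by blast
  have odd: "f' (- x) = - f' x" for x
  proof -
    have "((\<lambda>x. f (- x)) has_real_derivative f' (- x) * - 1) (at x)"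
      by (rule DERIV_chain2[OF f]) (auto intro!: derivative_eq_intros)
    then show ?thesis
      using DERIV_unique[OF f[of x]] by (simp add: even)
  qed
  have half: "integral {-a..a} h = 2 * integral {0..a} h"
    if "continuous_on UNIV h" "\<And>x. h (- x) = h x" for h :: "real \<Rightarrow> real"
    using integral_fold[OF \<open>a > 0\<close>, of h] that by (auto intro: continuous_on_subset)
  have "integral {0..a} f = 0"
    using half[of f] mean even cf by simp
  then show ?thesis
    using wirtinger_neumann[OF \<open>a > 0\<close> f f'] half[of "\<lambda>x. (f x)\<^sup>2"] half[of "\<lambda>x. (f' x)\<^sup>2"]
    by (simp add: even odd cf cf' continuous_on_power)
qed

section \<open>Bounds for the cotangent and the hyperbolic tangent\<close>

lemma mult_cos_less_sin:
  fixes x :: real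
  assumes "0 < x" "x < pi"
  shows "x * cos x < sin x"
proof -
  have "(\<lambda>x. sin x - x * cos x) 0 < (\<lambda>x. sin x - x * cos x) x"
  proof (rule DERIV_pos_imp_increasing_open[OF \<open>0 < x\<close>])
    fix t assume "0 < t" "t < x"
    then have "0 < t * sin t"
      using assms by (auto intro!: mult_pos_pos sin_gt_zero)
    moreover have "((\<lambda>x. sin x - x * cos x) has_real_derivative t * sin t) (at t)"
      by (auto intro!: derivative_eq_intros)
    ultimately show "\<exists>y. ((\<lambda>x. sin x - x * cos x) has_real_derivative y) (at t) \<and> 0 < y"
      by blast
  qed (intro continuous_intros)
  then show ?thesis by simp
qed

text \<open>The function \<open>sin x (1 - x\<^sup>2 / 3) - x cos x\<close> vanishes at \<open>0\<close> and has the positive derivative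
  \<open>(x / 3) (sin x - x cos x)\<close>.\<close>

lemma mult_cot_le:
  fixes x :: real
  assumes "0 < x" "x < pi"
  shows "x * cot x \<le> 1 - x\<^sup>2 / 3"
proof -
  let ?h = "\<lambda>x::real. sin x * (1 - x\<^sup>2 / 3) - x * cos x"
  have "?h 0 < ?h x"
  proof (rule DERIV_pos_imp_increasing_open[OF \<open>0 < x\<close>])
    fix t assume t: "0 < t" "t < x"
    then have "0 < t / 3 * (sin t - t * cos t)"
      using mult_cos_less_sin[of t] assms by (intro mult_pos_pos) auto
    moreover have "(?h has_real_derivative t / 3 * (sin t - t * cos t)) (at t)"
      by (auto intro!: derivative_eq_intros simp: field_simps power2_eq_square)
    ultimately show "\<exists>y. (?h has_real_derivative y) (at t) \<and> 0 < y"
      by blast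
  qed (intro continuous_intros, simp)
  then show ?thesis
    using sin_gt_zero[OF assms] by (simp add: cot_def field_simps)
qed

lemma mult_cot_strict_decreasing:
  fixes x y :: real
  assumes "0 < x" "x < y" "y < pi"
  shows "y * cot y < x * cot x"
proof (rule DERIV_neg_imp_decreasing_open[OF \<open>x < y\<close>])
  have sin: "0 < sin t" if "x \<le> t" "t \<le> y" for t
    using that assms by (intro sin_gt_zero) auto
  show "continuous_on {x..y} (\<lambda>t. t * cot t)"
    unfolding cot_def by (intro continuous_intros) (use sin in force)
  fix t assume t: "x < t" "t < y"
  have "cos t < 1"
    using cos_monotone_0_pi[of 0 t] t assms by simp
  then have "sin t * cos t < sin t"
    using sin[of t] t by simp
  also have "\<dots> \<le> t"
    using t assms by (intro sin_x_le_x) simp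
  finally have "sin t * cos t < t" .
  then have "cot t - t / (sin t)\<^sup>2 < 0"
    using sin[of t] t by (simp add: cot_def field_simps power2_eq_square)
  moreover have "((\<lambda>t. t * cot t) has_real_derivative cot t - t / (sin t)\<^sup>2) (at t)"
    using DERIV_mult[OF DERIV_ident DERIV_cot, of t] sin[of t] t
    by (auto elim!: DERIV_cong simp: field_simps)
  ultimately show "\<exists>d. ((\<lambda>t. t * cot t) has_real_derivative d) (at t) \<and> d < 0"
    by blast
qed

lemma tanh_le_self:
  fixes x :: real
  assumes "0 \<le> x"
  shows "tanh x \<le> x"
proof -
  have "(\<lambda>x. x - tanh x) 0 \<le> (\<lambda>x. x - tanh x) x"
  proof (rule DERIV_nonneg_imp_nondecreasing[OF assms])
    fix t :: real
    have "((\<lambda>x. x - tanh x) has_real_derivative (tanh t)\<^sup>2) (at t)"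
      by (auto intro!: derivative_eq_intros simp: cosh_real_nonzero)
    then show "\<exists>y. ((\<lambda>x. x - tanh x) has_real_derivative y) (at t) \<and> 0 \<le> y"
      by (intro exI[of _ "(tanh t)\<^sup>2"]) auto
  qed
  then show ?thesis by simp
qed

section \<open>Integration over a cuboid along coordinate lines\<close>

text \<open>The point with \<open>i\<close>-th coordinate \<open>c\<close> and remaining coordinates \<open>(s, t)\<close> in increasing order of
  their indices; for fixed \<open>c\<close> this parametrises a plane orthogonal to the \<open>i\<close>-th axis.\<close>

definition slot :: "3 \<Rightarrow> real \<times> real \<times> real \<Rightarrow> real^3" where
  "slot i = (\<lambda>(c, s, t). if i = 1 then vector [c, s, t] else if i = 2 then vector [s, c, t] else vector [s, t, c])"

text \<open>As \<open>c\<close> varies, \<open>upd i c x\<close> runs through the line through \<open>x\<close> parallel to the \<open>i\<close>-th axis. All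
  integrals over the cuboid and its faces are reduced to integrals along such lines.\<close>

definition upd :: "'n::finite \<Rightarrow> real \<Rightarrow> real^'n \<Rightarrow> real^'n" where
  "upd i c x = x + (c - x $ i) *\<^sub>R axis i 1"

definition mirror :: "'n::finite \<Rightarrow> real^'n \<Rightarrow> real^'n" where
  "mirror i x = upd i (- x $ i) x"

lemma index_cases:
  fixes i :: 3
  obtains "i = 1" | "i = 2" | "i = 3"
  using exhaust_3[of i] by blast

lemma slot_simps:
  "slot 1 (c, y) = vector [c, fst y, snd y]"
  "slot 2 (c, y) = vector [fst y, c, snd y]"
  "slot 3 (c, y) = vector [fst y, snd y, c]"
  by (simp_all add: slot_def case_prod_beta)

lemma upd_nth [simp]: "upd i c x $ j = (if j = i then c else x $ j)"
  by (simp add: upd_def axis_def)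

lemma upd_upd [simp]: "upd i c (upd i d x) = upd i c x"
  by (simp add: vec_eq_iff)

lemma upd_commute: "i \<noteq> j \<Longrightarrow> upd i c (upd j d x) = upd j d (upd i c x)"
  by (auto simp: vec_eq_iff)

lemma mirror_nth [simp]: "mirror i x $ j = (if j = i then - x $ j else x $ j)"
  by (simp add: mirror_def)

lemma mirror_upd_same: "mirror i (upd i c x) = upd i (- c) x"
  by (simp add: vec_eq_iff)

lemma mirror_upd: "i \<noteq> j \<Longrightarrow> mirror i (upd j c x) = upd j c (mirror i x)"
  by (auto simp: vec_eq_iff)

lemma mirror_mirror [simp]: "mirror i (mirror i x) = x"
  by (simp add: vec_eq_iff)

lemma mirror_commute: "mirror i (mirror j x) = mirror j (mirror i x)"
  by (auto simp: vec_eq_iff)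

lemma continuous_on_upd [continuous_intros]:
  assumes "continuous_on S f" "continuous_on S g"
  shows "continuous_on S (\<lambda>x. upd i (f x) (g x))"
  unfolding upd_def by (intro continuous_intros assms)

lemma continuous_on_mirror [continuous_intros]:
  assumes "continuous_on S g"
  shows "continuous_on S (\<lambda>x. mirror i (g x))"
  unfolding mirror_def by (intro continuous_intros assms)

lemma continuous_on_UNIV_compose:
  "continuous_on UNIV F \<Longrightarrow> continuous_on S g \<Longrightarrow> continuous_on S (\<lambda>x. F (g x))"
  by (rule continuous_on_compose2) auto

lemma continuous_on_slot [continuous_intros]:
  assumes "continuous_on S f"
  shows "continuous_on S (\<lambda>x. slot i (f x))"
proof -
  have "continuous_on UNIV (slot i)"
    unfolding slot_def vector_3_euclidean case_prod_beta
    by (cases "i = 1"; cases "i = 2"; simp; intro continuous_intros)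
  then show ?thesis
    using assms by (rule continuous_on_UNIV_compose)
qed

lemma upd_slot [simp]: "upd i c (slot i (d, y)) = slot i (c, y)"
  by (cases i rule: index_cases) (simp_all add: slot_simps vec_eq_iff forall_3)

lemma emeasure_lborel_Times:
  fixes A :: "'a::euclidean_space set" and B :: "'b::euclidean_space set"
  assumes "A \<in> sets borel" "B \<in> sets borel"
  shows "emeasure lborel (A \<times> B) = emeasure lborel A * emeasure lborel B"
  using lborel.emeasure_pair_measure_Times[of A lborel B] assms by (simp add: lborel_prod)

text \<open>Permuting coordinates preserves the volume of boxes, hence Lebesgue measure. This carries
  Fubini's theorem for pairs over to \<open>real^3\<close>, with any coordinate singled out.\<close>

lemma lborel_slot: "distr lborel borel (slot i) = (lborel :: (real^3) measure)"
proof (rule lborel_eqI[symmetric])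
  have [measurable]: "slot i \<in> borel_measurable borel"
    by (intro borel_measurable_continuous_onI continuous_intros)
  fix l u :: "real^3"
  assume "\<And>b. b \<in> Basis \<Longrightarrow> l \<bullet> b \<le> u \<bullet> b"
  then have "l \<bullet> axis n 1 \<le> u \<bullet> axis n 1" for n
    by (simp add: axis_in_Basis_iff)
  then have le: "l $ n \<le> u $ n" for n
    by (simp add: inner_axis)
  obtain j k where jk: "UNIV = {i, j, k}" "i \<noteq> j" "i \<noteq> k" "j \<noteq> k"
    "slot i -` box l u = {l $ i <..< u $ i} \<times> ({l $ j <..< u $ j} \<times> {l $ k <..< u $ k})"
  proof -
    show ?thesis
    proof (cases i rule: index_cases)
      case 1
      have "slot 1 -` box l u = {l $ 1 <..< u $ 1} \<times> ({l $ 2 <..< u $ 2} \<times> {l $ 3 <..< u $ 3})"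
        by (rule set_eqI) (auto simp: slot_def case_prod_beta mem_box_cart forall_3)
      then show ?thesis
        using UNIV_3 by (intro that[of 2 3]) (simp_all only: 1, auto)
    next
      case 2
      have "slot 2 -` box l u = {l $ 2 <..< u $ 2} \<times> ({l $ 1 <..< u $ 1} \<times> {l $ 3 <..< u $ 3})"
        by (rule set_eqI) (auto simp: slot_def case_prod_beta mem_box_cart forall_3)
      then show ?thesis
        using UNIV_3 by (intro that[of 1 3]) (simp_all only: 2, auto)
    next
      case 3
      have "slot 3 -` box l u = {l $ 3 <..< u $ 3} \<times> ({l $ 1 <..< u $ 1} \<times> {l $ 2 <..< u $ 2})"
        by (rule set_eqI) (auto simp: slot_def case_prod_beta mem_box_cart forall_3)
      then show ?thesis
        using UNIV_3 by (intro that[of 1 2]) (simp_all only: 3, auto)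
    qed
  qed
  have "emeasure (distr lborel borel (slot i)) (box l u) = emeasure lborel (slot i -` box l u)"
    by (subst emeasure_distr) auto
  also have "\<dots> = ennreal (u $ i - l $ i) * (ennreal (u $ j - l $ j) * ennreal (u $ k - l $ k))"
    unfolding jk(5) using le
    by (simp add: emeasure_lborel_Times borel_Times)
  also have "\<dots> = ennreal (\<Prod>n\<in>UNIV. (u - l) $ n)"
    using jk(2-4) le by (simp add: jk(1) ennreal_mult)
  also have "(\<Prod>n\<in>UNIV. (u - l) $ n) = (\<Prod>b\<in>Basis. (u - l) \<bullet> b)"
  proof -
    have inj: "inj (\<lambda>n::3. axis n (1::real))"
      by (auto simp: inj_on_def axis_eq_axis)
    have Basis: "(Basis :: (real^3) set) = (\<lambda>n. axis n 1) ` UNIV"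
      by (auto simp: Basis_vec_def)
    show ?thesis
      unfolding Basis by (subst prod.reindex[OF inj]) (simp add: inner_axis)
  qed
  finally show "emeasure (distr lborel borel (slot i)) (box l u) = (\<Prod>b\<in>Basis. (u - l) \<bullet> b)" .
qed simp

lemma integral_cbox_lborel:
  fixes F :: "'a::euclidean_space \<Rightarrow> real"
  assumes "continuous_on UNIV F"
  shows "integral (cbox l u) F = (LINT x|lborel. indicator (cbox l u) x * F x)"
  using set_borel_integral_eq_integral(2)[of "cbox l u" F]
    borel_integrable_compact[OF compact_cbox continuous_on_subset[OF assms], of l u]
  by (simp add: set_integrable_def set_lebesgue_integral_def)

locale cuboid =
  fixes r :: "real^3"
  assumes r_pos: "\<And>i. r $ i > 0"
begin

lemma r_nonzero [simp]: "r $ i \<noteq> 0"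
  using r_pos[of i] by simp

lemma r_positive [simp]: "0 < r $ i" "0 \<le> r $ i"
  using r_pos[of i] by simp_all

definition side :: "3 \<Rightarrow> (real \<times> real) set" where
  "side i = (let q = (if i = 1 then (r$2, r$3) else if i = 2 then (r$1, r$3) else (r$1, r$2)) in cbox (- q) q)"

definition vol :: "(real^3 \<Rightarrow> real) \<Rightarrow> real" where
  "vol F = integral (cbox (- r) r) F"

lemma slot_mem_cbox: "slot i (c, y) \<in> cbox (- r) r \<longleftrightarrow> c \<in> {- r $ i .. r $ i} \<and> y \<in> side i"
  by (cases i rule: index_cases; cases y; simp add: slot_simps side_def Let_def mem_box_cart forall_3 cbox_Pair_eq conj_ac)

lemma vol_slot:
  assumes F: "continuous_on UNIV F"
  shows "vol F = integral {- r $ i .. r $ i} (\<lambda>c. integral (side i) (\<lambda>y. F (slot i (c, y))))"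
proof -
  obtain q where q: "side i = cbox (- q) q"
    by (simp add: side_def Let_def)
  have [measurable]: "slot i \<in> borel_measurable borel" "F \<in> borel_measurable borel"
    by (intro borel_measurable_continuous_onI continuous_intros F)+
  have "vol F = (LINT x|distr lborel borel (slot i). indicator (cbox (- r) r) x * F x)"
    unfolding lborel_slot vol_def by (rule integral_cbox_lborel[OF F])
  also have "\<dots> = (LINT z|lborel. indicator (cbox (- r) r) (slot i z) * F (slot i z))"
    by (subst integral_distr) auto
  also have "\<dots> = (LINT z|lborel. indicator (cbox (- r $ i, - q) (r $ i, q)) z * F (slot i z))"
    using slot_mem_cbox[of i] by (intro Bochner_Integration.integral_cong)
      (auto simp: indicator_def cbox_Pair_eq q)
  also have "\<dots> = integral (cbox (- r $ i, - q) (r $ i, q)) (\<lambda>z. F (slot i z))"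
    by (rule integral_cbox_lborel[symmetric]) (intro continuous_on_UNIV_compose[OF F] continuous_intros)
  also have "\<dots> = integral (cbox (- r $ i) (r $ i)) (\<lambda>c. integral (cbox (- q) q) (\<lambda>y. F (slot i (c, y))))"
    by (rule integral_prod_continuous) (intro continuous_on_UNIV_compose[OF F] continuous_intros)
  finally show ?thesis
    by (simp add: q)
qed

definition avg :: "3 \<Rightarrow> (real^3 \<Rightarrow> real) \<Rightarrow> real^3 \<Rightarrow> real" where
  "avg i F x = integral {- r $ i .. r $ i} (\<lambda>c. F (upd i c x)) / (2 * r $ i)"

lemma continuous_line:
  assumes F: "continuous_on UNIV F"
  shows "continuous_on S (\<lambda>c. F (upd i c x))"
  by (intro continuous_on_UNIV_compose[OF F] continuous_intros)

lemma continuous_on_avg: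
  assumes F: "continuous_on UNIV F"
  shows "continuous_on UNIV (avg i F)"
proof -
  have "continuous_on UNIV (\<lambda>x. integral (cbox (- r $ i) (r $ i)) (\<lambda>c. F (upd i c x)))"
    by (rule integral_continuous_on_param)
      (auto simp: case_prod_beta intro!: continuous_on_UNIV_compose[OF F] continuous_intros)
  then have c: "continuous_on UNIV (\<lambda>x. integral {- r $ i .. r $ i} (\<lambda>c. F (upd i c x)))"
    by simp
  show ?thesis
    unfolding avg_def[abs_def]
    by (rule continuous_on_divide[OF c continuous_on_const]) simp
qed

lemma vol_const_line:
  assumes F: "continuous_on UNIV F" and const: "\<And>c x. F (upd i c x) = F x"
  shows "vol F = 2 * r $ i * integral (side i) (\<lambda>y. F (slot i (0, y)))"
proof -
  have "F (slot i (c, y)) = F (slot i (0, y))" for c y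
    using const[of c "slot i (0, y)"] by simp
  then have "(\<lambda>c. integral (side i) (\<lambda>y. F (slot i (c, y)))) =
      (\<lambda>c. integral (side i) (\<lambda>y. F (slot i (0, y))))"
    by (intro ext integral_cong)
  then show ?thesis
    using r_pos[of i] by (simp add: vol_slot[OF F, of i])
qed

lemma avg_upd [simp]: "avg i F (upd i c x) = avg i F x"
  by (simp add: avg_def)

text \<open>Fubini's theorem without product spaces: replacing a function by its averages along the lines
  in one direction does not change its integral.\<close>

lemma vol_avg:
  assumes F: "continuous_on UNIV F"
  shows "vol (avg i F) = vol F"
proof -
  obtain q where q: "side i = cbox (- q) q"
    by (simp add: side_def Let_def)
  have "vol F = integral (cbox (- r $ i) (r $ i)) (\<lambda>c. integral (side i) (\<lambda>y. F (slot i (c, y))))"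
    by (simp add: vol_slot[OF F, of i])
  also have "\<dots> = integral (side i) (\<lambda>y. integral (cbox (- r $ i) (r $ i)) (\<lambda>c. F (slot i (c, y))))"
    unfolding q by (rule integral_swap_continuous)
      (auto simp: case_prod_beta intro!: continuous_on_UNIV_compose[OF F] continuous_intros)
  also have "\<dots> = integral (side i) (\<lambda>y. 2 * r $ i * avg i F (slot i (0, y)))"
    using r_pos[of i] by (simp add: avg_def)
  also have "\<dots> = vol (avg i F)"
    by (subst vol_const_line[where i=i]) (auto simp: continuous_on_avg F)
  finally show ?thesis ..
qed

lemma avg_commute:
  assumes F: "continuous_on UNIV F"
  shows "avg i (avg j F) = avg j (avg i F)"
proof (cases "i = j")
  case False
  have "integral (cbox (- r $ i) (r $ i)) (\<lambda>c. integral (cbox (- r $ j) (r $ j)) (\<lambda>d. F (upd j d (upd i c x)))) =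
    integral (cbox (- r $ j) (r $ j)) (\<lambda>d. integral (cbox (- r $ i) (r $ i)) (\<lambda>c. F (upd j d (upd i c x))))" for x
    by (rule integral_swap_continuous)
      (auto simp: case_prod_beta intro!: continuous_on_UNIV_compose[OF F] continuous_intros)
  then show ?thesis
    by (auto simp: fun_eq_iff avg_def upd_commute[OF False])
qed simp

lemma continuous_integrable:
  fixes F :: "real^3 \<Rightarrow> real"
  assumes "continuous_on UNIV F"
  shows "F integrable_on cbox (- r) r"
  by (rule integrable_continuous) (rule continuous_on_subset[OF assms], simp)

lemma vol_add:
  "continuous_on UNIV F \<Longrightarrow> continuous_on UNIV G \<Longrightarrow> vol (\<lambda>x. F x + G x) = vol F + vol G"
  unfolding vol_def by (intro Henstock_Kurzweil_Integration.integral_add continuous_integrable)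

lemma vol_diff:
  "continuous_on UNIV F \<Longrightarrow> continuous_on UNIV G \<Longrightarrow> vol (\<lambda>x. F x - G x) = vol F - vol G"
  unfolding vol_def by (intro Henstock_Kurzweil_Integration.integral_diff continuous_integrable)

lemma vol_cmult: "vol (\<lambda>x. k * F x) = k * vol F"
  unfolding vol_def by simp

lemma vol_mono:
  "continuous_on UNIV F \<Longrightarrow> continuous_on UNIV G \<Longrightarrow> (\<And>x. F x \<le> G x) \<Longrightarrow> vol F \<le> vol G"
  unfolding vol_def by (intro integral_le continuous_integrable)

lemma vol_nonneg: "(\<And>x. 0 \<le> F x) \<Longrightarrow> 0 \<le> vol F"
  unfolding vol_def by (cases "F integrable_on cbox (- r) r") 
    (auto intro!: Henstock_Kurzweil_Integration.integral_nonneg simp: not_integrable_integral)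

lemma vol_1_pos: "0 < vol (\<lambda>x. 1)"
proof -
  have "0 < measure lborel (cbox (- r) r)"
    by (rule content_pos_lt) (auto simp: Basis_vec_def inner_axis)
  then show ?thesis
    unfolding vol_def by simp
qed

lemma vol_mirror:
  assumes F: "continuous_on UNIV F"
  shows "vol (\<lambda>x. F (mirror i x)) = vol F"
proof -
  have "integral {- r $ i .. r $ i} (\<lambda>c. F (upd i (- c) x)) = integral {- r $ i .. r $ i} (\<lambda>c. F (upd i c x))" for x
    using Henstock_Kurzweil_Integration.integral_reflect_real[of "r $ i" "- r $ i" "\<lambda>c. F (upd i c x)"]
    by simp
  then have "avg i (\<lambda>x. F (mirror i x)) = avg i F"
    by (simp add: avg_def[abs_def] mirror_upd_same)
  moreover have "continuous_on UNIV (\<lambda>x. F (mirror i x))"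
    by (intro continuous_on_UNIV_compose[OF F] continuous_intros)
  ultimately show ?thesis
    using vol_avg[of "\<lambda>x. F (mirror i x)" i] vol_avg[OF F, of i] by simp
qed

lemma vol_le_of_lines:
  assumes "continuous_on UNIV F" "continuous_on UNIV G"
    and "\<And>x. integral {- r $ i .. r $ i} (\<lambda>c. F (upd i c x)) \<le> integral {- r $ i .. r $ i} (\<lambda>c. G (upd i c x))"
  shows "vol F \<le> vol G"
proof -
  have "vol (avg i F) \<le> vol (avg i G)"
    using assms by (intro vol_mono continuous_on_avg) (auto simp: avg_def divide_right_mono)
  then show ?thesis
    using assms by (simp add: vol_avg)
qed

text \<open>The integral of \<open>F\<close> over the two faces orthogonal to the \<open>i\<close>-th axis. The integrand on the
  right is constant along that axis, so its integral over the cuboid is \<open>2 r\<^sub>i\<close> times the integral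
  over a cross section.\<close>

definition srf :: "3 \<Rightarrow> (real^3 \<Rightarrow> real) \<Rightarrow> real" where
  "srf i F = vol (\<lambda>x. F (upd i (r $ i) x) + F (upd i (- r $ i) x)) / (2 * r $ i)"

definition surf :: "(real^3 \<Rightarrow> real) \<Rightarrow> real" where
  "surf F = (\<Sum>i\<in>UNIV. srf i F)"

lemma continuous_on_faces:
  fixes F :: "real^3 \<Rightarrow> real"
  assumes F: "continuous_on UNIV F"
  shows "continuous_on UNIV (\<lambda>x. F (upd i (r $ i) x) + F (upd i (- r $ i) x))"
  by (intro continuous_on_add continuous_on_UNIV_compose[OF F] continuous_intros)

lemma srf_le_of_lines:
  assumes F: "continuous_on UNIV F" and G: "continuous_on UNIV G"
    and le: "\<And>x. F (upd i (r $ i) x) + F (upd i (- r $ i) x) \<le> integral {- r $ i .. r $ i} (\<lambda>c. G (upd i c x))"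
  shows "srf i F \<le> vol G"
proof -
  have "vol (\<lambda>x. F (upd i (r $ i) x) + F (upd i (- r $ i) x)) \<le> vol (\<lambda>x. 2 * r $ i * avg i G x)"
    using le by (intro vol_mono continuous_on_mult_left continuous_on_avg G continuous_on_faces F)
      (auto simp: avg_def)
  also have "\<dots> = 2 * r $ i * vol G"
    by (simp only: vol_cmult vol_avg[OF G])
  finally show ?thesis
    by (simp add: srf_def divide_le_eq ac_simps)
qed

lemma srf_eq_of_lines:
  assumes G: "continuous_on UNIV G"
    and eq: "\<And>x. F (upd i (r $ i) x) + F (upd i (- r $ i) x) = integral {- r $ i .. r $ i} (\<lambda>c. G (upd i c x))"
  shows "srf i F = vol G"
proof -
  have "vol (\<lambda>x. F (upd i (r $ i) x) + F (upd i (- r $ i) x)) = vol (\<lambda>x. 2 * r $ i * avg i G x)"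
    by (simp add: avg_def eq)
  also have "\<dots> = 2 * r $ i * vol G"
    by (simp only: vol_cmult vol_avg[OF G])
  finally show ?thesis
    by (simp add: srf_def)
qed

lemma surf_add:
  assumes F: "continuous_on UNIV F" and G: "continuous_on UNIV G"
  shows "surf (\<lambda>x. F x + G x) = surf F + surf G"
proof -
  have "srf i (\<lambda>x. F x + G x) = srf i F + srf i G" for i
    using vol_add[OF continuous_on_faces[OF F, of i] continuous_on_faces[OF G, of i]]
    by (simp add: srf_def algebra_simps add_divide_distrib)
  then show ?thesis
    by (simp add: surf_def sum.distrib)
qed

lemma surf_cmult: "surf (\<lambda>x. k * F x) = k * surf F"
proof -
  have "srf i (\<lambda>x. k * F x) = k * srf i F" for i
    using vol_cmult[of k "\<lambda>x. F (upd i (r $ i) x) + F (upd i (- r $ i) x)"]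
    by (simp add: srf_def algebra_simps)
  then show ?thesis
    by (simp add: surf_def sum_distrib_left)
qed

lemma surf_1_pos: "0 < surf (\<lambda>x. 1)"
  using vol_1_pos vol_cmult[of 2 "\<lambda>x. 1"] by (auto simp: surf_def srf_def intro!: sum_pos)

lemma surf_mirror:
  assumes F: "continuous_on UNIV F"
  shows "surf (\<lambda>x. F (mirror i x)) = surf F"
proof -
  have "srf j (\<lambda>x. F (mirror i x)) = srf j F" for j
  proof (cases "i = j")
    case True
    then show ?thesis
      by (simp add: srf_def mirror_upd_same add.commute)
  next
    case False
    then show ?thesis
      using vol_mirror[OF continuous_on_faces[OF F, of j], of i]
      by (simp add: srf_def mirror_upd)
  qed
  then show ?thesis
    by (simp add: surf_def)
qed

end

section \<open>Reflection parity, bounds along lines and a Poincare inequality\<close>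

text \<open>The partial derivatives \<open>D\<close> are kept explicit, and only differentiability along lines is
  demanded. Each one-dimensional inequality applies to lines directly.\<close>

definition C1 :: "(real^'n::finite \<Rightarrow> real) \<Rightarrow> ('n \<Rightarrow> real^'n \<Rightarrow> real) \<Rightarrow> bool" where
  "C1 w D \<longleftrightarrow> continuous_on UNIV w \<and> (\<forall>i. continuous_on UNIV (D i)) \<and>
     (\<forall>i x. ((\<lambda>c. w (upd i c x)) has_real_derivative D i x) (at (x $ i)))"

lemma C1_D:
  assumes "C1 w D"
  shows "continuous_on UNIV w" "continuous_on UNIV (D i)"
    "((\<lambda>c. w (upd i c x)) has_real_derivative D i (upd i c x)) (at c)"
proof -
  have "((\<lambda>d. w (upd i d (upd i c x))) has_real_derivative D i (upd i c x)) (at (upd i c x $ i))"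
    using assms by (simp only: C1_def)
  then show "((\<lambda>c. w (upd i c x)) has_real_derivative D i (upd i c x)) (at c)"
    by simp
qed (use assms in \<open>auto simp: C1_def\<close>)

text \<open>The even (\<open>\<sigma> = 1\<close>) and odd (\<open>\<sigma> = - 1\<close>) part of \<open>F\<close> with respect to the \<open>i\<close>-th coordinate.\<close>

definition parity :: "real \<Rightarrow> 'n::finite \<Rightarrow> (real^'n \<Rightarrow> real) \<Rightarrow> real^'n \<Rightarrow> real" where
  "parity \<sigma> i F x = (F x + \<sigma> * F (mirror i x)) / 2"

lemma continuous_on_parity:
  fixes F :: "real^'n \<Rightarrow> real"
  assumes "continuous_on UNIV F"
  shows "continuous_on UNIV (parity \<sigma> i F)"
  unfolding parity_def[abs_def] by (intro continuous_intros assms continuous_on_UNIV_compose[OF assms]) simp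

text \<open>Differentiation in the \<open>i\<close>-th coordinate exchanges even and odd parts.\<close>

lemma C1_parity:
  assumes w: "C1 w D"
  shows "C1 (parity \<sigma> i w) (\<lambda>j. parity (if j = i then - \<sigma> else \<sigma>) i (D j))"
  unfolding C1_def
proof (intro conjI allI)
  fix j x
  have 1: "((\<lambda>c. w (upd j c x)) has_real_derivative D j x) (at (x $ j))"
    using w by (simp add: C1_def)
  have 2: "((\<lambda>c. w (mirror i (upd j c x))) has_real_derivative (if j = i then - 1 else 1) * D j (mirror i x)) (at (x $ j))"
  proof (cases "j = i")
    case True
    have "((\<lambda>c. w (upd i (- c) x)) has_real_derivative D i (upd i (- (x $ i)) x) * - 1) (at (x $ i))"
      by (rule DERIV_chain2[OF C1_D(3)[OF w]]) (auto intro!: derivative_eq_intros)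
    then show ?thesis
      using True by (simp add: mirror_upd_same mirror_def)
  next
    case False
    have "((\<lambda>c. w (upd j c (mirror i x))) has_real_derivative D j (mirror i x)) (at (mirror i x $ j))"
      using w by (simp only: C1_def)
    then show ?thesis
      using False by (simp add: mirror_upd)
  qed
  show "((\<lambda>c. parity \<sigma> i w (upd j c x)) has_real_derivative parity (if j = i then - \<sigma> else \<sigma>) i (D j) x) (at (x $ j))"
    unfolding parity_def by (rule derivative_eq_intros 1 2 refl | simp)+
qed (use w in \<open>auto simp: C1_def intro: continuous_on_parity\<close>)

lemma parity_mirror_same: "\<sigma> * \<sigma> = 1 \<Longrightarrow> parity \<sigma> i F (mirror i x) = \<sigma> * parity \<sigma> i F x"
  by (simp add: parity_def algebra_simps flip: mult.assoc)

lemma parity_mirror: "(\<And>x. F (mirror k x) = \<tau> * F x) \<Longrightarrow> parity \<sigma> i F (mirror k x) = \<tau> * parity \<sigma> i F x"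
  by (simp add: parity_def mirror_commute[of i k] algebra_simps)

context cuboid
begin

definition energy :: "(3 \<Rightarrow> real^3 \<Rightarrow> real) \<Rightarrow> real" where
  "energy D = (\<Sum>i\<in>UNIV. vol (\<lambda>x. (D i x)\<^sup>2))"

lemma parity_squares:
  "(parity 1 i F x)\<^sup>2 + (parity (- 1) i F x)\<^sup>2 = (1 / 2) * ((F x)\<^sup>2 + (F (mirror i x))\<^sup>2)"
  by (simp add: parity_def power2_eq_square field_simps)

lemma vol_parity:
  assumes F: "continuous_on UNIV F"
  shows "vol (\<lambda>x. (parity 1 i F x)\<^sup>2) + vol (\<lambda>x. (parity (- 1) i F x)\<^sup>2) = vol (\<lambda>x. (F x)\<^sup>2)"
proof -
  have F2: "continuous_on UNIV (\<lambda>x. (F x)\<^sup>2)" "continuous_on UNIV (\<lambda>x. (F (mirror i x))\<^sup>2)"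
    by (intro continuous_intros F continuous_on_UNIV_compose[OF F])+
  have "vol (\<lambda>x. (parity 1 i F x)\<^sup>2) + vol (\<lambda>x. (parity (- 1) i F x)\<^sup>2) =
      vol (\<lambda>x. (parity 1 i F x)\<^sup>2 + (parity (- 1) i F x)\<^sup>2)"
    by (intro vol_add[symmetric] continuous_intros continuous_on_parity F)
  also have "\<dots> = (1 / 2) * (vol (\<lambda>x. (F x)\<^sup>2) + vol (\<lambda>x. (F (mirror i x))\<^sup>2))"
    unfolding parity_squares vol_cmult vol_add[OF F2] ..
  finally show ?thesis
    using vol_mirror[OF F2(1), of i] by simp
qed

lemma surf_parity:
  assumes F: "continuous_on UNIV F"
  shows "surf (\<lambda>x. (parity 1 i F x)\<^sup>2) + surf (\<lambda>x. (parity (- 1) i F x)\<^sup>2) = surf (\<lambda>x. (F x)\<^sup>2)"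
proof -
  have F2: "continuous_on UNIV (\<lambda>x. (F x)\<^sup>2)" "continuous_on UNIV (\<lambda>x. (F (mirror i x))\<^sup>2)"
    by (intro continuous_intros F continuous_on_UNIV_compose[OF F])+
  have "surf (\<lambda>x. (parity 1 i F x)\<^sup>2) + surf (\<lambda>x. (parity (- 1) i F x)\<^sup>2) =
      surf (\<lambda>x. (parity 1 i F x)\<^sup>2 + (parity (- 1) i F x)\<^sup>2)"
    by (intro surf_add[symmetric] continuous_intros continuous_on_parity F)
  also have "\<dots> = (1 / 2) * (surf (\<lambda>x. (F x)\<^sup>2) + surf (\<lambda>x. (F (mirror i x))\<^sup>2))"
    unfolding parity_squares surf_cmult surf_add[OF F2] ..
  finally show ?thesis
    using surf_mirror[OF F2(1), of i] by simp
qed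

lemma surf_even:
  assumes F: "continuous_on UNIV F"
  shows "surf (parity 1 i F) = surf F"
proof -
  have F2: "continuous_on UNIV (\<lambda>x. F (mirror i x))"
    by (intro continuous_intros continuous_on_UNIV_compose[OF F])
  have "surf (parity 1 i F) = surf (\<lambda>x. (1 / 2) * (F x + F (mirror i x)))"
    by (simp add: parity_def[abs_def])
  also have "\<dots> = surf F"
    unfolding surf_cmult surf_add[OF F F2] surf_mirror[OF F] by simp
  finally show ?thesis .
qed

text \<open>The parallelogram identity, combined with the invariance of the integral under reflections,
  replaces the orthogonality of the two parts.\<close>

lemma energy_parity:
  assumes "\<And>j. continuous_on UNIV (D j)"
  shows "energy (\<lambda>j. parity (if j = i then - 1 else 1) i (D j)) +
    energy (\<lambda>j. parity (if j = i then - (- 1) else (- 1)) i (D j)) = energy D"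
proof -
  have "vol (\<lambda>x. (parity (if j = i then - 1 else 1) i (D j) x)\<^sup>2) +
      vol (\<lambda>x. (parity (if j = i then - (- 1) else (- 1)) i (D j) x)\<^sup>2) = vol (\<lambda>x. (D j x)\<^sup>2)" for j
    using vol_parity[OF assms[of j], of i] by (cases "j = i") simp_all
  then show ?thesis
    by (simp add: energy_def flip: sum.distrib)
qed

lemma srf_cmult: "srf i (\<lambda>x. k * F x) = k * srf i F"
  using vol_cmult[of k "\<lambda>x. F (upd i (r $ i) x) + F (upd i (- r $ i) x)"]
  by (simp add: srf_def algebra_simps)

lemma face_bound:
  assumes w: "C1 w D"
    and line: "\<And>x. \<mu> * ((w (upd i (r $ i) x))\<^sup>2 + (w (upd i (- r $ i) x))\<^sup>2) \<le>
      \<theta> * integral {- r $ i .. r $ i} (\<lambda>c. (D i (upd i c x))\<^sup>2) +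
      B * integral {- r $ i .. r $ i} (\<lambda>c. (w (upd i c x))\<^sup>2)"
  shows "\<mu> * srf i (\<lambda>x. (w x)\<^sup>2) \<le> \<theta> * vol (\<lambda>x. (D i x)\<^sup>2) + B * vol (\<lambda>x. (w x)\<^sup>2)"
proof -
  note cw = C1_D(1)[OF w] and cD = C1_D(2)[OF w, of i]
  have c2: "continuous_on UNIV (\<lambda>x. \<theta> * (D i x)\<^sup>2)" "continuous_on UNIV (\<lambda>x. B * (w x)\<^sup>2)"
    by (intro continuous_intros cw cD)+
  have "\<mu> * srf i (\<lambda>x. (w x)\<^sup>2) = srf i (\<lambda>x. \<mu> * (w x)\<^sup>2)"
    by (simp only: srf_cmult)
  also have "\<dots> \<le> vol (\<lambda>x. \<theta> * (D i x)\<^sup>2 + B * (w x)\<^sup>2)"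
  proof (rule srf_le_of_lines)
    fix x
    have "integral {- r $ i .. r $ i} (\<lambda>c. \<theta> * (D i (upd i c x))\<^sup>2 + B * (w (upd i c x))\<^sup>2) =
      integral {- r $ i .. r $ i} (\<lambda>c. \<theta> * (D i (upd i c x))\<^sup>2) + integral {- r $ i .. r $ i} (\<lambda>c. B * (w (upd i c x))\<^sup>2)"
      by (intro Henstock_Kurzweil_Integration.integral_add integrable_continuous_interval
          continuous_intros continuous_line cw cD)
    then show "\<mu> * (w (upd i (r $ i) x))\<^sup>2 + \<mu> * (w (upd i (- r $ i) x))\<^sup>2 \<le>
      integral {- r $ i .. r $ i} (\<lambda>c. \<theta> * (D i (upd i c x))\<^sup>2 + B * (w (upd i c x))\<^sup>2)"
      using line[of x] by (simp add: distrib_left)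
  qed (intro continuous_intros cw cD)+
  also have "\<dots> = \<theta> * vol (\<lambda>x. (D i x)\<^sup>2) + B * vol (\<lambda>x. (w x)\<^sup>2)"
    unfolding vol_add[OF c2] vol_cmult ..
  finally show ?thesis .
qed

lemma face_bound_tanh:
  assumes w: "C1 w D" and "0 < \<theta>" "\<theta> \<le> 1" and \<mu>: "\<mu> \<le> \<alpha> * tanh (\<alpha> * r $ i)"
  shows "\<mu> * srf i (\<lambda>x. (w x)\<^sup>2) \<le> \<theta> * vol (\<lambda>x. (D i x)\<^sup>2) +
    (\<alpha>\<^sup>2 + (1 / \<theta> - 1) * (\<alpha> * tanh (\<alpha> * r $ i))\<^sup>2) * vol (\<lambda>x. (w x)\<^sup>2)"
proof (rule face_bound[OF w])
  fix x
  show "\<mu> * ((w (upd i (r $ i) x))\<^sup>2 + (w (upd i (- r $ i) x))\<^sup>2) \<le>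
      \<theta> * integral {- r $ i .. r $ i} (\<lambda>c. (D i (upd i c x))\<^sup>2) +
      (\<alpha>\<^sup>2 + (1 / \<theta> - 1) * (\<alpha> * tanh (\<alpha> * r $ i))\<^sup>2) * integral {- r $ i .. r $ i} (\<lambda>c. (w (upd i c x))\<^sup>2)"
    by (rule order_trans[OF mult_right_mono[OF \<mu>] tanh_boundary_bound])
      (use assms in \<open>auto intro!: C1_D(3) continuous_line C1_D(2)\<close>)
qed

lemma face_bound_linear:
  assumes w: "C1 w D" and "0 < \<theta>"
  shows "\<mu> * srf i (\<lambda>x. (w x)\<^sup>2) \<le> \<theta> * vol (\<lambda>x. (D i x)\<^sup>2) +
    (\<mu> / r $ i + \<mu>\<^sup>2 / \<theta>) * vol (\<lambda>x. (w x)\<^sup>2)"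
  by (rule face_bound[OF w], rule linear_boundary_bound)
    (use assms in \<open>auto intro!: C1_D(3) continuous_line C1_D(2)\<close>)

lemma face_bound_cot:
  assumes w: "C1 w D" and "0 < \<gamma>" "\<gamma> * r $ i < pi" and \<mu>: "\<mu> \<le> \<gamma> * cot (\<gamma> * r $ i)"
    and odd: "\<And>x. w (mirror i x) = - w x"
  shows "\<mu> * srf i (\<lambda>x. (w x)\<^sup>2) \<le> 1 * vol (\<lambda>x. (D i x)\<^sup>2) + (- \<gamma>\<^sup>2) * vol (\<lambda>x. (w x)\<^sup>2)"
proof (rule face_bound[OF w])
  fix x
  have zero: "w (upd i 0 x) = 0"
    using odd[of "upd i 0 x"] by (simp add: mirror_upd_same)
  have "\<gamma> * cot (\<gamma> * r $ i) * ((w (upd i (r $ i) x))\<^sup>2 + (w (upd i (- r $ i) x))\<^sup>2) \<le>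
      integral {- r $ i .. r $ i} (\<lambda>c. (D i (upd i c x))\<^sup>2) -
      \<gamma>\<^sup>2 * integral {- r $ i .. r $ i} (\<lambda>c. (w (upd i c x))\<^sup>2)"
    by (rule cot_boundary_bound) (use assms zero in \<open>auto intro!: C1_D(3) continuous_line C1_D(2)\<close>)
  moreover have "\<mu> * ((w (upd i (r $ i) x))\<^sup>2 + (w (upd i (- r $ i) x))\<^sup>2) \<le>
      \<gamma> * cot (\<gamma> * r $ i) * ((w (upd i (r $ i) x))\<^sup>2 + (w (upd i (- r $ i) x))\<^sup>2)"
    by (rule mult_right_mono[OF \<mu>]) simp
  ultimately show "\<mu> * ((w (upd i (r $ i) x))\<^sup>2 + (w (upd i (- r $ i) x))\<^sup>2) \<le>
      1 * integral {- r $ i .. r $ i} (\<lambda>c. (D i (upd i c x))\<^sup>2) +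
      (- \<gamma>\<^sup>2) * integral {- r $ i .. r $ i} (\<lambda>c. (w (upd i c x))\<^sup>2)"
    by simp
qed

text \<open>An odd function vanishes on the plane \<open>x\<^sub>k = 0\<close>, so the cotangent is admissible in direction
  \<open>k\<close>. The term \<open>- \<gamma>\<^sup>2 \<integral> w\<^sup>2\<close> that it gains outweighs the terms \<open>\<kappa>\<^sub>i\<^sup>2 \<integral> w\<^sup>2\<close> lost in the other
  directions.\<close>

lemma odd_bound:
  assumes w: "C1 w D" and odd: "\<And>x. w (mirror k x) = - w x"
    and "0 < \<gamma>" "\<gamma> * r $ k < pi" "\<mu> \<le> \<gamma> * cot (\<gamma> * r $ k)"
    and \<kappa>: "\<And>i. i \<noteq> k \<Longrightarrow> \<mu> \<le> \<kappa> i * tanh (\<kappa> i * r $ i)"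
    and \<gamma>: "(\<Sum>i\<in>UNIV - {k}. (\<kappa> i)\<^sup>2) \<le> \<gamma>\<^sup>2"
  shows "\<mu> * surf (\<lambda>x. (w x)\<^sup>2) \<le> energy D"
proof -
  define c where "c i = (if i = k then - \<gamma>\<^sup>2 else (\<kappa> i)\<^sup>2)" for i
  have "\<mu> * srf i (\<lambda>x. (w x)\<^sup>2) \<le> vol (\<lambda>x. (D i x)\<^sup>2) + c i * vol (\<lambda>x. (w x)\<^sup>2)" for i
    using face_bound_cot[OF w assms(3-5) odd] face_bound_tanh[OF w _ _ \<kappa>, where \<theta> = 1 and i = i]
    by (auto simp: c_def)
  then have "\<mu> * surf (\<lambda>x. (w x)\<^sup>2) \<le> (\<Sum>i\<in>UNIV. vol (\<lambda>x. (D i x)\<^sup>2) + c i * vol (\<lambda>x. (w x)\<^sup>2))"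
    unfolding surf_def sum_distrib_left by (intro sum_mono)
  also have "\<dots> = energy D + sum c UNIV * vol (\<lambda>x. (w x)\<^sup>2)"
    by (simp add: sum.distrib energy_def sum_distrib_right)
  also have "\<dots> \<le> energy D"
  proof -
    have "sum c UNIV = c k + sum c (UNIV - {k})"
      by (rule sum.remove) auto
    also have "sum c (UNIV - {k}) = (\<Sum>i\<in>UNIV - {k}. (\<kappa> i)\<^sup>2)"
      by (rule sum.cong) (auto simp: c_def)
    finally have "sum c UNIV \<le> 0"
      using \<gamma> by (simp add: c_def)
    moreover have "0 \<le> vol (\<lambda>x. (w x)\<^sup>2)"
      by (rule vol_nonneg) simp
    ultimately show ?thesis
      by (simp add: mult_nonpos_nonneg)
  qed
  finally show ?thesis .
qed

text \<open>Averaging along lines is an orthogonal projection in \<open>L\<^sup>2\<close>.\<close>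

lemma avg_square:
  assumes F: "continuous_on UNIV F"
  shows "vol (\<lambda>x. (F x)\<^sup>2) = vol (\<lambda>x. (F x - avg i F x)\<^sup>2) + vol (\<lambda>x. (avg i F x)\<^sup>2)"
proof -
  note cA = continuous_on_avg[OF F, of i]
  have "avg i (\<lambda>x. F x * avg i F x) = (\<lambda>x. avg i F x * avg i F x)"
  proof
    fix x
    have "avg i (\<lambda>x. F x * avg i F x) x = integral {- r $ i .. r $ i} (\<lambda>c. F (upd i c x)) * avg i F x / (2 * r $ i)"
      unfolding avg_def[of i "\<lambda>x. F x * avg i F x"] by simp
    then show "avg i (\<lambda>x. F x * avg i F x) x = avg i F x * avg i F x"
      by (simp add: avg_def)
  qed
  then have cross: "vol (\<lambda>x. F x * avg i F x) = vol (\<lambda>x. (avg i F x)\<^sup>2)"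
    using vol_avg[of "\<lambda>x. F x * avg i F x" i] by (simp add: continuous_on_mult F cA power2_eq_square)
  have "vol (\<lambda>x. (F x - avg i F x)\<^sup>2) = vol (\<lambda>x. (F x)\<^sup>2 + (avg i F x)\<^sup>2 - 2 * (F x * avg i F x))"
    by (simp add: power2_diff mult.assoc)
  also have "\<dots> = vol (\<lambda>x. (F x)\<^sup>2) + vol (\<lambda>x. (avg i F x)\<^sup>2) - 2 * vol (\<lambda>x. F x * avg i F x)"
    by (subst vol_diff vol_add; (intro continuous_intros F cA)?)+ (simp add: vol_cmult)
  finally show ?thesis
    using cross by simp
qed

lemma avg_diff:
  assumes "continuous_on UNIV F" "continuous_on UNIV G"
  shows "avg i (\<lambda>x. F x - G x) x = avg i F x - avg i G x"
proof -
  have "integral {- r $ i .. r $ i} (\<lambda>c. F (upd i c x) - G (upd i c x)) =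
      integral {- r $ i .. r $ i} (\<lambda>c. F (upd i c x)) - integral {- r $ i .. r $ i} (\<lambda>c. G (upd i c x))"
    by (intro Henstock_Kurzweil_Integration.integral_diff integrable_continuous_interval continuous_line assms)
  then show ?thesis
    by (simp add: avg_def diff_divide_distrib)
qed

lemma vol_square_avg_le:
  assumes "continuous_on UNIV F"
  shows "vol (\<lambda>x. (avg i F x)\<^sup>2) \<le> vol (\<lambda>x. (F x)\<^sup>2)"
  using avg_square[OF assms, of i] vol_nonneg[of "\<lambda>x. (F x - avg i F x)\<^sup>2"] by simp

lemma avg_upd_other:
  assumes "\<And>c x. F (upd j c x) = F x"
  shows "avg i F (upd j c x) = avg i F x"
proof (cases "i = j")
  case False
  then show ?thesis
    by (simp add: avg_def upd_commute[OF False] assms)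
qed simp

text \<open>The variance of a function on a product space is at most the sum of its variances in each
  coordinate. The three commuting projections are applied one after the other; at each step the part
  removed is a projection of \<open>F - avg i F\<close>, and in the end only a constant is left.\<close>

lemma vol_square_le_sum:
  assumes F: "continuous_on UNIV F" and zero: "vol F = 0"
  shows "vol (\<lambda>x. (F x)\<^sup>2) \<le> (\<Sum>i\<in>UNIV. vol (\<lambda>x. (F x - avg i F x)\<^sup>2))"
proof -
  let ?N = "\<lambda>F. vol (\<lambda>x. (F x)\<^sup>2)"
  note cA = continuous_on_avg
  define F1 where "F1 = avg 1 F"
  define F2 where "F2 = avg 2 F1"
  define F3 where "F3 = avg 3 F2"
  have c: "continuous_on UNIV F1" "continuous_on UNIV F2" "continuous_on UNIV F3"
    by (auto simp: F1_def F2_def F3_def intro!: cA F)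
  have "F1 (upd 1 c x) = F1 x" for c x by (simp add: F1_def)
  moreover have "F2 (upd 1 c x) = F2 x" "F2 (upd 2 c x) = F2 x" for c x
    unfolding F2_def by (rule avg_upd_other[OF calculation], simp)
  ultimately have inv: "F3 (upd i c x) = F3 x" for i c x
    unfolding F3_def using avg_upd_other[of F2 1 3] avg_upd_other[of F2 2 3]
    by (cases i rule: index_cases) auto
  have "F3 x = F3 0" for x
  proof -
    have "x = upd 1 (x$1) (upd 2 (x$2) (upd 3 (x$3) 0))"
      by (simp add: vec_eq_iff forall_3)
    then show ?thesis by (metis inv)
  qed
  then have "vol F3 = F3 0 * vol (\<lambda>x. 1)"
    using vol_cmult[of "F3 0" "\<lambda>x. 1"] by (metis (no_types) ext mult.right_neutral)
  moreover have "vol F3 = 0"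
    using zero by (simp add: F3_def F2_def F1_def vol_avg cA F)
  ultimately have "F3 0 = 0"
    using vol_1_pos by simp
  then have N3: "?N F3 = 0"
    using \<open>\<And>x. F3 x = F3 0\<close> by (simp add: vol_def)
  have cd: "continuous_on UNIV (\<lambda>x. F x - avg i F x)" for i
    by (intro continuous_intros F cA)
  have "?N F = ?N (\<lambda>x. F x - avg 1 F x) + ?N (\<lambda>x. F1 x - avg 2 F1 x) + ?N (\<lambda>x. F2 x - avg 3 F2 x)"
    using avg_square[OF F, of 1] avg_square[OF c(1), of 2] avg_square[OF c(2), of 3] N3
    by (simp add: F1_def F2_def F3_def)
  moreover have "?N (\<lambda>x. F1 x - avg 2 F1 x) \<le> ?N (\<lambda>x. F x - avg 2 F x)"
  proof -
    have "F1 x - avg 2 F1 x = avg 1 (\<lambda>x. F x - avg 2 F x) x" for x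
      by (simp add: avg_diff F cA F1_def avg_commute[of F 2 1])
    then show ?thesis
      using vol_square_avg_le[OF cd[of 2], of 1] by simp
  qed
  moreover have "?N (\<lambda>x. F2 x - avg 3 F2 x) \<le> ?N (\<lambda>x. F x - avg 3 F x)"
  proof -
    have "F2 x - avg 3 F2 x = avg 2 (avg 1 (\<lambda>x. F x - avg 3 F x)) x" for x
    proof -
      have "avg 1 (\<lambda>x. F x - avg 3 F x) = (\<lambda>x. F1 x - avg 3 F1 x)"
        by (rule ext) (simp add: avg_diff F cA F1_def avg_commute[of F 3 1])
      then show ?thesis
        by (simp add: avg_diff c cA F2_def avg_commute[of F1 3 2])
    qed
    then show ?thesis
      using vol_square_avg_le[OF cd[of 3], of 1] vol_square_avg_le[OF cA[OF cd[of 3]], of 2 1] by simp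
  qed
  ultimately show ?thesis
    unfolding sum_3 by linarith
qed

text \<open>On each line \<open>w - avg i w\<close> is an even function of mean value zero.\<close>

lemma poincare_even:
  assumes w: "C1 w D" and even: "\<And>k x. w (mirror k x) = w x" and zero: "vol w = 0"
    and R: "\<And>i. r $ i \<le> R"
  shows "vol (\<lambda>x. (w x)\<^sup>2) \<le> (R / pi)\<^sup>2 * energy D"
proof -
  note cw = C1_D(1)[OF w] and cD = C1_D(2)[OF w]
  have "vol (\<lambda>x. (w x - avg i w x)\<^sup>2) \<le> (R / pi)\<^sup>2 * vol (\<lambda>x. (D i x)\<^sup>2)" for i
  proof -
    have "vol (\<lambda>x. (w x - avg i w x)\<^sup>2) \<le> vol (\<lambda>x. (R / pi)\<^sup>2 * (D i x)\<^sup>2)"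
    proof (rule vol_le_of_lines[where i=i])
      fix x
      have "integral {- r $ i .. r $ i} (\<lambda>c. (w (upd i c x) - avg i w x)\<^sup>2) \<le>
        (r $ i / pi)\<^sup>2 * integral {- r $ i .. r $ i} (\<lambda>c. (D i (upd i c x))\<^sup>2)"
      proof (rule wirtinger_even)
        show "((\<lambda>c. w (upd i c x) - avg i w x) has_real_derivative D i (upd i c x)) (at c)" for c
          by (auto intro!: derivative_eq_intros C1_D(3)[OF w])
        show "w (upd i (- c) x) - avg i w x = w (upd i c x) - avg i w x" for c
          using even[of i "upd i c x"] by (simp add: mirror_upd_same)
        have "integral {- r $ i .. r $ i} (\<lambda>c. w (upd i c x) - avg i w x) =
            integral {- r $ i .. r $ i} (\<lambda>c. w (upd i c x)) - integral {- r $ i .. r $ i} (\<lambda>c. avg i w x)"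
          by (intro Henstock_Kurzweil_Integration.integral_diff integrable_continuous_interval continuous_line cw
              continuous_intros)
        then show "integral {- r $ i .. r $ i} (\<lambda>c. w (upd i c x) - avg i w x) = 0"
          by (simp add: avg_def)
      qed (auto intro: continuous_line cD)
      also have "\<dots> \<le> (R / pi)\<^sup>2 * integral {- r $ i .. r $ i} (\<lambda>c. (D i (upd i c x))\<^sup>2)"
        using R[of i] by (intro mult_right_mono power_mono divide_right_mono
            Henstock_Kurzweil_Integration.integral_nonneg integrable_continuous_interval
            continuous_intros continuous_line cD) auto
      finally show "integral {- r $ i .. r $ i} (\<lambda>c. (w (upd i c x) - avg i w (upd i c x))\<^sup>2) \<le>
          integral {- r $ i .. r $ i} (\<lambda>c. (R / pi)\<^sup>2 * (D i (upd i c x))\<^sup>2)"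
        by simp
    qed (intro continuous_intros cw cD continuous_on_avg)+
    then show ?thesis
      by (simp only: vol_cmult)
  qed
  then have "(\<Sum>i\<in>UNIV. vol (\<lambda>x. (w x - avg i w x)\<^sup>2)) \<le> (R / pi)\<^sup>2 * energy D"
    unfolding energy_def sum_distrib_left by (intro sum_mono)
  then show ?thesis
    using vol_square_le_sum[OF cw zero] by linarith
qed

end

section \<open>The trace inequality for continuously differentiable functions\<close>

text \<open>The constants belong to the harmonic function
  \<open>cosh (\<alpha> x\<^sub>1) cosh (\<beta> x\<^sub>2) sin (\<gamma> x\<^sub>3)\<close>: the condition on \<open>\<gamma>\<^sup>2\<close> makes it harmonic, and the three
  equations for \<open>\<mu>\<close> say that it solves the Steklov condition
  \<open>\<partial>w/\<partial>n = \<mu> w\<close> on the faces orthogonal to the respective axis.\<close>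

locale steklov = cuboid +
  fixes \<alpha> \<beta> \<gamma> \<mu> :: real
  assumes \<alpha>_pos: "\<alpha> > 0" and \<beta>_pos: "\<beta> > 0" and \<gamma>_pos: "\<gamma> > 0"
    and longest: "r $ 1 \<le> r $ 3" "r $ 2 \<le> r $ 3"
    and \<alpha>: "\<alpha> * tanh (\<alpha> * r $ 1) = \<mu>"
    and \<beta>: "\<beta> * tanh (\<beta> * r $ 2) = \<mu>"
    and \<gamma>: "\<gamma> * cot (\<gamma> * r $ 3) = \<mu>"
    and \<gamma>_square: "\<gamma>\<^sup>2 = \<alpha>\<^sup>2 + \<beta>\<^sup>2"
    and \<gamma>_less: "\<gamma> * r $ 3 < pi / 2"
begin

lemma \<mu>_pos: "\<mu> > 0"
  using \<alpha>_pos by (simp flip: \<alpha>)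

lemma r_le: "r $ i \<le> r $ 3"
  using longest by (cases i rule: index_cases) simp_all

text \<open>With \<open>L = \<mu> r\<^sub>3\<close> and \<open>x = \<gamma> r\<^sub>3\<close>, the bound \<open>tanh z \<le> z\<close> in the first two directions gives
  \<open>2 L \<le> x\<^sup>2\<close>, and the bound for the cotangent in the third gives \<open>L \<le> 1 - x\<^sup>2 / 3\<close>. Eliminating \<open>x\<close>
  leaves \<open>L \<le> 1 - 2 L / 3\<close>.\<close>

lemma \<mu>_bound: "\<mu> * r $ 3 \<le> 3 / 5"
proof -
  have le: "\<mu> * r $ 3 \<le> (\<kappa> * r $ 3)\<^sup>2" if "\<kappa> > 0" "\<kappa> * tanh (\<kappa> * r $ i) = \<mu>" for \<kappa> i
  proof -
    have "\<mu> \<le> \<kappa> * (\<kappa> * r $ i)"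
      unfolding that(2)[symmetric] using that(1) by (intro mult_left_mono tanh_le_self) auto
    also have "\<dots> \<le> \<kappa> * (\<kappa> * r $ 3)"
      using that(1) by (intro mult_left_mono r_le) auto
    finally have "\<mu> * r $ 3 \<le> \<kappa> * (\<kappa> * r $ 3) * r $ 3"
      by (rule mult_right_mono) simp
    then show ?thesis
      by (simp add: power2_eq_square ac_simps)
  qed
  have "2 * (\<mu> * r $ 3) \<le> (\<alpha> * r $ 3)\<^sup>2 + (\<beta> * r $ 3)\<^sup>2"
    using le[OF \<alpha>_pos \<alpha>] le[OF \<beta>_pos \<beta>] by simp
  also have "\<dots> = (\<gamma> * r $ 3)\<^sup>2"
    by (simp add: power_mult_distrib \<gamma>_square distrib_right)
  finally have "2 * (\<mu> * r $ 3) \<le> (\<gamma> * r $ 3)\<^sup>2" .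
  moreover have "\<mu> * r $ 3 \<le> 1 - (\<gamma> * r $ 3)\<^sup>2 / 3"
    using mult_cot_le[of "\<gamma> * r $ 3"] \<gamma>_pos \<gamma>_less pi_gt_zero
    by (simp flip: \<gamma> add: ac_simps)
  ultimately show ?thesis by simp
qed

text \<open>Since \<open>x cot x\<close> is decreasing, replacing \<open>r\<^sub>3\<close> by a shorter \<open>r\<^sub>i\<close> cannot decrease
  \<open>\<gamma> cot (\<gamma> r\<^sub>i)\<close>.\<close>

lemma \<mu>_le_cot: "\<mu> \<le> \<gamma> * cot (\<gamma> * r $ i)" and \<gamma>_less_pi: "\<gamma> * r $ i < pi"
proof -
  have le: "\<gamma> * r $ i \<le> \<gamma> * r $ 3"
    using \<gamma>_pos r_le by simp
  then show "\<gamma> * r $ i < pi"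
    using \<gamma>_less pi_gt_zero by linarith
  have "\<mu> * r $ i \<le> \<mu> * r $ 3"
    using \<mu>_pos r_le by simp
  also have "\<dots> = \<gamma> * r $ 3 * cot (\<gamma> * r $ 3)"
    by (simp flip: \<gamma>)
  also have "\<dots> \<le> \<gamma> * r $ i * cot (\<gamma> * r $ i)"
    using mult_cot_strict_decreasing[of "\<gamma> * r $ i" "\<gamma> * r $ 3"] le \<gamma>_pos \<gamma>_less pi_gt_zero
    by (cases "r $ i = r $ 3") auto
  finally have "\<mu> * r $ i \<le> \<gamma> * cot (\<gamma> * r $ i) * r $ i"
    by (simp add: ac_simps)
  then show "\<mu> \<le> \<gamma> * cot (\<gamma> * r $ i)"
    by (simp add: mult_le_cancel_right)
qed

lemma \<mu>_le_tanh:
  "\<mu> \<le> \<alpha> * tanh (\<alpha> * r $ 1)" "\<mu> \<le> \<alpha> * tanh (\<alpha> * r $ 3)"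
  "\<mu> \<le> \<beta> * tanh (\<beta> * r $ 2)" "\<mu> \<le> \<beta> * tanh (\<beta> * r $ 3)"
proof -
  show "\<mu> \<le> \<alpha> * tanh (\<alpha> * r $ 3)"
    unfolding \<alpha>[symmetric] using \<alpha>_pos longest by simp
  show "\<mu> \<le> \<beta> * tanh (\<beta> * r $ 3)"
    unfolding \<beta>[symmetric] using \<beta>_pos longest by simp
qed (simp_all add: \<alpha> \<beta>)

text \<open>If \<open>k\<close> is not the third coordinate, then the third one takes over the hyperbolic tangent of
  the \<open>k\<close>-th, which only increases on the longer side.\<close>

lemma odd_boundary_bound:
  assumes w: "C1 w D" and odd: "\<And>x. w (mirror k x) = - w x"
  shows "\<mu> * surf (\<lambda>x. (w x)\<^sup>2) \<le> energy D"
proof -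
  define \<kappa> :: "3 \<Rightarrow> real" where
    "\<kappa> i = (if k = 1 then (if i = 2 then \<beta> else \<alpha>) else if k = 2 then (if i = 1 then \<alpha> else \<beta>)
      else (if i = 1 then \<alpha> else \<beta>))" for i
  show ?thesis
  proof (rule odd_bound[OF w odd \<gamma>_pos \<gamma>_less_pi \<mu>_le_cot])
    show "\<mu> \<le> \<kappa> i * tanh (\<kappa> i * r $ i)" if "i \<noteq> k" for i
      using that \<mu>_le_tanh
      by (cases i rule: index_cases; cases k rule: index_cases; simp add: \<kappa>_def)
    have "(\<Sum>i\<in>UNIV - {k}. (\<kappa> i)\<^sup>2) = (\<kappa> 1)\<^sup>2 + (\<kappa> 2)\<^sup>2 + (\<kappa> 3)\<^sup>2 - (\<kappa> k)\<^sup>2"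
      by (simp add: sum_diff1 sum_3)
    then show "(\<Sum>i\<in>UNIV - {k}. (\<kappa> i)\<^sup>2) \<le> \<gamma>\<^sup>2"
      by (cases k rule: index_cases) (simp_all add: \<kappa>_def \<gamma>_square)
  qed
qed

text \<open>Half of the Dirichlet integral pays for the boundary term up to \<open>B \<integral> w\<^sup>2\<close>, the other half for
  that remainder. In units with \<open>r\<^sub>3 = 1\<close> the constant is
  \<open>B = \<gamma>\<^sup>2 + 4 \<mu>\<^sup>2 + \<mu> \<le> \<pi>\<^sup>2/4 + 4 (3/5)\<^sup>2 + 3/5\<close>, which is below \<open>\<pi>\<^sup>2/2\<close>.\<close>

lemma even_boundary_bound_zero:
  assumes w: "C1 w D" and even: "\<And>k x. w (mirror k x) = w x" and zero: "vol w = 0"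
  shows "\<mu> * surf (\<lambda>x. (w x)\<^sup>2) \<le> energy D"
proof -
  let ?W = "vol (\<lambda>x. (w x)\<^sup>2)" and ?D = "\<lambda>i. vol (\<lambda>x. (D i x)\<^sup>2)"
  define B where "B = \<gamma>\<^sup>2 + 4 * \<mu>\<^sup>2 + \<mu> / r $ 3"
  have 1: "\<mu> * srf 1 (\<lambda>x. (w x)\<^sup>2) \<le> 1 / 2 * ?D 1 + (\<alpha>\<^sup>2 + \<mu>\<^sup>2) * ?W"
    using face_bound_tanh[OF w _ _ \<mu>_le_tanh(1), of "1 / 2"] by (simp add: \<alpha>)
  have 2: "\<mu> * srf 2 (\<lambda>x. (w x)\<^sup>2) \<le> 1 / 2 * ?D 2 + (\<beta>\<^sup>2 + \<mu>\<^sup>2) * ?W"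
    using face_bound_tanh[OF w _ _ \<mu>_le_tanh(3), of "1 / 2"] by (simp add: \<beta>)
  have 3: "\<mu> * srf 3 (\<lambda>x. (w x)\<^sup>2) \<le> 1 / 2 * ?D 3 + (\<mu> / r $ 3 + 2 * \<mu>\<^sup>2) * ?W"
    using face_bound_linear[OF w, of "1 / 2" \<mu> 3] by (simp add: mult.commute)
  have "\<mu> * surf (\<lambda>x. (w x)\<^sup>2) \<le> 1 / 2 * energy D + B * ?W"
    using 1 2 3 by (simp add: surf_def energy_def sum_3 B_def \<gamma>_square algebra_simps)
  also have "B * ?W \<le> 1 / 2 * energy D"
  proof -
    have pi: "9 \<le> pi\<^sup>2"
      using pi_gt3 power_mono[of 3 pi 2] by simp
    have "(\<gamma> * r $ 3)\<^sup>2 \<le> (pi / 2)\<^sup>2"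
      using \<gamma>_pos \<gamma>_less by (intro power_mono) auto
    moreover have "(\<mu> * r $ 3)\<^sup>2 \<le> (3 / 5)\<^sup>2"
      using \<mu>_pos \<mu>_bound by (intro power_mono) auto
    moreover have "B * (r $ 3)\<^sup>2 = (\<gamma> * r $ 3)\<^sup>2 + 4 * (\<mu> * r $ 3)\<^sup>2 + \<mu> * r $ 3"
      by (simp add: B_def power2_eq_square field_simps)
    ultimately have "B * (r $ 3)\<^sup>2 \<le> pi\<^sup>2 / 2"
      using \<mu>_bound pi by (simp add: power_divide)
    then have B: "B * (r $ 3 / pi)\<^sup>2 \<le> 1 / 2"
      by (simp add: power_divide divide_le_eq)
    have "B * ?W \<le> B * ((r $ 3 / pi)\<^sup>2 * energy D)"
    proof (rule mult_left_mono)
      show "?W \<le> (r $ 3 / pi)\<^sup>2 * energy D"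
        by (rule poincare_even[OF w even zero r_le])
      show "0 \<le> B"
        using \<mu>_pos by (simp add: B_def)
    qed
    also have "\<dots> \<le> 1 / 2 * energy D"
      unfolding mult.assoc[symmetric]
      by (rule mult_right_mono[OF B]) (auto simp: energy_def intro!: sum_nonneg vol_nonneg)
    finally show ?thesis .
  qed
  finally show ?thesis by simp
qed

text \<open>Let \<open>m\<close> be the mean value of \<open>w\<close> over the cuboid. Among all constants, the mean value of \<open>w\<close>
  over the surface is the best approximation in \<open>L\<^sup>2\<close> of the surface; thus the left-hand side is at
  most \<open>\<mu>\<close> times the integral of \<open>(w - m)\<^sup>2\<close>.\<close>

lemma even_boundary_bound:
  assumes w: "C1 w D" and even: "\<And>k x. w (mirror k x) = w x"
  shows "\<mu> * (surf (\<lambda>x. (w x)\<^sup>2) - (surf w)\<^sup>2 / surf (\<lambda>x. 1)) \<le> energy D"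
proof -
  note cw = C1_D(1)[OF w]
  define m where "m = vol w / vol (\<lambda>x. 1)"
  have c: "continuous_on UNIV (\<lambda>x. m)" "continuous_on UNIV (\<lambda>x. (w x)\<^sup>2)" "continuous_on UNIV (\<lambda>x. m\<^sup>2)"
    "continuous_on UNIV (\<lambda>x. (- 2 * m) * w x)" "continuous_on UNIV (\<lambda>x. (w x)\<^sup>2 + m\<^sup>2)"
    by (intro continuous_intros cw)+
  have "C1 (\<lambda>x. w x - m) D"
    using w by (auto simp: C1_def intro!: continuous_intros derivative_eq_intros)
  moreover have "vol (\<lambda>x. w x - m) = 0"
    using vol_1_pos vol_cmult[of m "\<lambda>x. 1"] unfolding vol_diff[OF cw c(1)] by (simp add: m_def)
  ultimately have "\<mu> * surf (\<lambda>x. (w x - m)\<^sup>2) \<le> energy D"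
    by (intro even_boundary_bound_zero) (auto simp: even)
  moreover have "surf (\<lambda>x. (w x)\<^sup>2) - (surf w)\<^sup>2 / surf (\<lambda>x. 1) \<le> surf (\<lambda>x. (w x - m)\<^sup>2)"
  proof -
    have "(\<lambda>x. (w x - m)\<^sup>2) = (\<lambda>x. ((w x)\<^sup>2 + m\<^sup>2) + (- 2 * m) * w x)"
      by (simp add: fun_eq_iff power2_diff)
    then have "surf (\<lambda>x. (w x - m)\<^sup>2) = surf (\<lambda>x. (w x)\<^sup>2) + surf (\<lambda>x. m\<^sup>2) + (- 2 * m) * surf w"
      by (simp only: surf_add[OF c(5,4)] surf_add[OF c(2,3)] surf_cmult)
    moreover have "surf (\<lambda>x. m\<^sup>2) = m\<^sup>2 * surf (\<lambda>x. 1)"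
      using surf_cmult[of "m\<^sup>2" "\<lambda>x. 1"] by simp
    moreover have "0 \<le> (m * surf (\<lambda>x. 1) - surf w)\<^sup>2 / surf (\<lambda>x. 1)"
      using surf_1_pos by simp
    moreover have "(m * surf (\<lambda>x. 1) - surf w)\<^sup>2 / surf (\<lambda>x. 1) =
        m\<^sup>2 * surf (\<lambda>x. 1) - 2 * m * surf w + (surf w)\<^sup>2 / surf (\<lambda>x. 1)"
      using surf_1_pos by (simp add: power2_eq_square field_simps)
    ultimately show ?thesis by linarith
  qed
  then have "\<mu> * (surf (\<lambda>x. (w x)\<^sup>2) - (surf w)\<^sup>2 / surf (\<lambda>x. 1)) \<le> \<mu> * surf (\<lambda>x. (w x - m)\<^sup>2)"
    using \<mu>_pos by (intro mult_left_mono) auto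
  ultimately show ?thesis by linarith
qed

text \<open>The odd part satisfies the inequality without the term \<open>(surf w)\<^sup>2\<close>, to which only the even
  part contributes.\<close>

lemma parity_step:
  assumes w: "C1 w D"
    and even: "\<And>D'. C1 (parity 1 k w) D' \<Longrightarrow>
      \<mu> * (surf (\<lambda>x. (parity 1 k w x)\<^sup>2) - (surf (parity 1 k w))\<^sup>2 / surf (\<lambda>x. 1)) \<le> energy D'"
  shows "\<mu> * (surf (\<lambda>x. (w x)\<^sup>2) - (surf w)\<^sup>2 / surf (\<lambda>x. 1)) \<le> energy D"
proof -
  have "\<mu> * surf (\<lambda>x. (parity (- 1) k w x)\<^sup>2) \<le>
      energy (\<lambda>j. parity (if j = k then - (- 1) else (- 1)) k (D j))"
    using parity_mirror_same[of "- 1" k w] by (intro odd_boundary_bound[OF C1_parity[OF w]]) simp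
  moreover note even[OF C1_parity[OF w]] surf_parity[OF C1_D(1)[OF w], of k]
    surf_even[OF C1_D(1)[OF w], of k] energy_parity[of D, OF C1_D(2)[OF w], of k]
  moreover have "\<mu> * (surf (\<lambda>x. (w x)\<^sup>2) - (surf w)\<^sup>2 / surf (\<lambda>x. 1)) =
    \<mu> * (surf (\<lambda>x. (parity 1 k w x)\<^sup>2) - (surf (parity 1 k w))\<^sup>2 / surf (\<lambda>x. 1)) +
    \<mu> * surf (\<lambda>x. (parity (- 1) k w x)\<^sup>2)"
    unfolding surf_parity[OF C1_D(1)[OF w], of k, symmetric] surf_even[OF C1_D(1)[OF w], of k]
    by (simp add: algebra_simps)
  ultimately show ?thesis by linarith
qed

theorem boundary_bound:
  assumes w: "C1 w D"
  shows "\<mu> * (surf (\<lambda>x. (w x)\<^sup>2) - (surf w)\<^sup>2 / surf (\<lambda>x. 1)) \<le> energy D"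
proof (rule parity_step[OF w, of 1], rule parity_step[where k=2], assumption, rule parity_step[where k=3], assumption)
  fix D' :: "3 \<Rightarrow> real^3 \<Rightarrow> real"
  let ?w = "parity 1 3 (parity 1 2 (parity 1 1 w))"
  assume "C1 ?w D'"
  then show "\<mu> * (surf (\<lambda>x. (?w x)\<^sup>2) - (surf ?w)\<^sup>2 / surf (\<lambda>x. 1)) \<le> energy D'"
  proof (rule even_boundary_bound)
    fix k :: 3 and x
    have same: "parity 1 i F (mirror i x) = parity 1 i F x" for i :: 3 and F x
      by (simp add: parity_mirror_same)
    have other: "parity 1 i F (mirror k x) = parity 1 i F x"
      if "\<And>x. F (mirror k x) = F x" for i k :: 3 and F x
      using parity_mirror[of F k 1] that by simp
    show "?w (mirror k x) = ?w x"
    proof (cases k rule: index_cases)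
      case 1
      show ?thesis unfolding 1 by (rule other, rule other, rule same)
    next
      case 2
      show ?thesis unfolding 2 by (rule other, rule same)
    next
      case 3
      show ?thesis unfolding 3 by (rule same)
    qed
  qed
qed

end

section \<open>The surface measure as a sum over the faces\<close>

text \<open>The surface measure is specified by its values on sets, as a sum of six areas. These two lemmas
  turn such a specification into a formula for integrals.\<close>

lemma nn_integral_sum_measure:
  assumes J: "finite J" and sets: "\<And>j. j \<in> J \<Longrightarrow> sets (N j) = sets M"
    and M: "\<And>A. A \<in> sets M \<Longrightarrow> emeasure M A = (\<Sum>j\<in>J. emeasure (N j) A)"
    and f: "f \<in> borel_measurable M"
  shows "(\<integral>\<^sup>+x. f x \<partial>M) = (\<Sum>j\<in>J. \<integral>\<^sup>+x. f x \<partial>N j)"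
proof -
  have meas: "g \<in> borel_measurable (N j)" if "g \<in> borel_measurable M" "j \<in> J" for j and g :: "'b \<Rightarrow> ennreal"
    using that measurable_cong_sets[OF sets[OF that(2)] refl] by blast
  have space: "space (N j) = space M" if "j \<in> J" for j
    by (rule sets_eq_imp_space_eq[OF sets[OF that]])
  show ?thesis
    using f
  proof (induction rule: borel_measurable_induct)
    case (cong f g)
    have "(\<integral>\<^sup>+x. g x \<partial>M) = (\<integral>\<^sup>+x. f x \<partial>M)"
      using cong by (intro nn_integral_cong) simp
    moreover have "(\<integral>\<^sup>+x. g x \<partial>N j) = (\<integral>\<^sup>+x. f x \<partial>N j)" if "j \<in> J" for j
      using cong space[OF that] by (intro nn_integral_cong) simp
    ultimately show ?case
      using cong by simp
  next
    case (set A)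
    then show ?case
      using M sets by simp
  next
    case (mult u c)
    then show ?case
      by (simp add: nn_integral_cmult meas sum_distrib_left)
  next
    case (add u v)
    then show ?case
      by (simp add: nn_integral_add meas sum.distrib)
  next
    case (seq U)
    have "(\<integral>\<^sup>+x. (SUP i. U i) x \<partial>M) = (SUP i. \<integral>\<^sup>+x. U i x \<partial>M)"
      unfolding SUP_apply by (rule nn_integral_monotone_convergence_SUP[OF seq(3) seq(1)])
    also have "\<dots> = (SUP i. \<Sum>j\<in>J. \<integral>\<^sup>+x. U i x \<partial>N j)"
      using seq by simp
    also have "\<dots> = (\<Sum>j\<in>J. SUP i. \<integral>\<^sup>+x. U i x \<partial>N j)"
      using seq(3) by (intro ennreal_SUP_sum) (auto simp: incseq_def le_fun_def intro!: nn_integral_mono)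
    also have "\<dots> = (\<Sum>j\<in>J. \<integral>\<^sup>+x. (SUP i. U i) x \<partial>N j)"
    proof (rule sum.cong[OF refl])
      fix j assume j: "j \<in> J"
      have "U i \<in> borel_measurable (N j)" for i
        using seq(1) j by (rule meas)
      then show "(SUP i. \<integral>\<^sup>+x. U i x \<partial>N j) = (\<integral>\<^sup>+x. (SUP i. U i) x \<partial>N j)"
        unfolding SUP_apply by (intro nn_integral_monotone_convergence_SUP[OF seq(3), symmetric])
    qed
    finally show ?case .
  qed
qed

lemma integral_sum_measure:
  fixes f :: "'a \<Rightarrow> real"
  assumes J: "finite J" and sets: "\<And>j. j \<in> J \<Longrightarrow> sets (N j) = sets M"
    and M: "\<And>A. A \<in> sets M \<Longrightarrow> emeasure M A = (\<Sum>j\<in>J. emeasure (N j) A)"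
    and f: "f \<in> borel_measurable M" and int: "\<And>j. j \<in> J \<Longrightarrow> integrable (N j) f"
  shows "integrable M f" "integral\<^sup>L M f = (\<Sum>j\<in>J. integral\<^sup>L (N j) f)"
proof -
  note nn = nn_integral_sum_measure[OF J sets M]
  have fin: "(\<integral>\<^sup>+x. ennreal (f x) \<partial>N j) < \<infinity>" "(\<integral>\<^sup>+x. ennreal (- f x) \<partial>N j) < \<infinity>" if "j \<in> J" for j
    using int[OF that] by (auto simp: real_integrable_def less_top)
  have "(\<integral>\<^sup>+x. ennreal (f x) \<partial>M) < \<infinity>" "(\<integral>\<^sup>+x. ennreal (- f x) \<partial>M) < \<infinity>"
    using f fin by (auto simp: nn J)
  then show "integrable M f"
    using f by (auto simp: real_integrable_def less_top)
  have "integral\<^sup>L M f = enn2real (\<Sum>j\<in>J. \<integral>\<^sup>+x. ennreal (f x) \<partial>N j) - enn2real (\<Sum>j\<in>J. \<integral>\<^sup>+x. ennreal (- f x) \<partial>N j)"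
    using f by (subst real_lebesgue_integral_def[OF \<open>integrable M f\<close>]) (simp add: nn)
  also have "\<dots> = (\<Sum>j\<in>J. enn2real (\<integral>\<^sup>+x. ennreal (f x) \<partial>N j) - enn2real (\<integral>\<^sup>+x. ennreal (- f x) \<partial>N j))"
    using fin J by (simp add: enn2real_sum sum_subtractf o_def)
  also have "\<dots> = (\<Sum>j\<in>J. integral\<^sup>L (N j) f)"
    by (intro sum.cong refl real_lebesgue_integral_def[symmetric] int)
  finally show "integral\<^sup>L M f = (\<Sum>j\<in>J. integral\<^sup>L (N j) f)" .
qed

context cuboid
begin

abbreviation interior_measure :: "(real^3) measure" where
  "interior_measure \<equiv> lebesgue_on (box (- r) r)"

abbreviation surface_measure :: "(real^3) measure" where
  "surface_measure \<equiv> restrict_space (cuboid_surface (- r) r) (frontier (box (- r) r))"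

lemma integrable_interior:
  fixes F :: "real^3 \<Rightarrow> 'b::euclidean_space"
  assumes F: "continuous_on UNIV F"
  shows "integrable interior_measure F"
proof -
  have "F absolutely_integrable_on cbox (- r) r"
    by (rule absolutely_integrable_continuous) (rule continuous_on_subset[OF F], simp)
  then have "F absolutely_integrable_on box (- r) r"
    by (rule set_integrable_subset) (auto simp: box_subset_cbox)
  then show ?thesis
    by (simp add: integrable_restrict_space set_integrable_def)
qed

lemma integral_interior:
  fixes F :: "real^3 \<Rightarrow> real"
  assumes F: "continuous_on UNIV F"
  shows "integrable interior_measure F" "(LINT x|interior_measure. F x) = vol F"
proof -
  show int: "integrable interior_measure F"
    by (rule integrable_interior[OF F])
  show "(LINT x|interior_measure. F x) = vol F"
    unfolding vol_def lebesgue_integral_eq_integral[OF int lmeasurable_box[THEN fmeasurableD]]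
    by (rule integral_open_interval)
qed

text \<open>The area measure on one face, as a measure on all of \<open>real^3\<close>.\<close>

definition face :: "3 \<Rightarrow> real \<Rightarrow> (real^3) measure" where
  "face i c = distr (restrict_space lborel (side i)) borel (\<lambda>y. slot i (c, y))"

lemma side_sets [measurable]: "side i \<in> sets borel"
  by (simp add: side_def Let_def)

lemma slot_measurable [measurable]: "(\<lambda>y. slot i (c, y)) \<in> borel_measurable borel"
  by (intro borel_measurable_continuous_onI continuous_intros)

lemma sets_face [simp]: "sets (face i c) = sets borel"
  by (simp add: face_def)

lemma emeasure_cuboid_surface_faces:
  assumes A: "A \<in> sets borel"
  shows "emeasure (cuboid_surface (- r) r) A =
    (\<Sum>(i, c)\<in>Sigma UNIV (\<lambda>i. {- r $ i, r $ i}). emeasure (face i c) A)"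
proof -
  have face: "face_area (cbox (- r) r) (\<lambda>y. slot i (c, y)) A = emeasure (face i c) A"
    if "c \<in> {- r $ i, r $ i}" for i c
  proof -
    have "emeasure (face i c) A = emeasure lborel (side i \<inter> (\<lambda>y. slot i (c, y)) -` A)"
      unfolding face_def using A
      by (subst emeasure_distr)
        (auto simp: measurable_restrict_space1 space_restrict_space emeasure_restrict_space Int_commute)
    also have "side i \<inter> (\<lambda>y. slot i (c, y)) -` A = {y. slot i (c, y) \<in> A \<inter> cbox (- r) r}"
      using that by (auto simp: slot_mem_cbox)
    finally show ?thesis
      by (simp add: face_area_def)
  qed
  have slots: "(\<lambda>(s, t). vector [c, s, t]) = (\<lambda>y. slot 1 (c, y))" "(\<lambda>(s, t). vector [s, c, t]) = (\<lambda>y. slot 2 (c, y))"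
    "(\<lambda>(s, t). vector [s, t, c]) = (\<lambda>y. slot 3 (c, y))" for c
    by (auto simp: slot_def)
  have "emeasure (cuboid_surface (- r) r) A =
      (\<Sum>i\<in>UNIV. \<Sum>c\<in>{- r $ i, r $ i}. face_area (cbox (- r) r) (\<lambda>y. slot i (c, y)) A)"
    unfolding emeasure_cuboid_surface[OF A] cuboid_area_def slots sum_3 by simp
  also have "\<dots> = (\<Sum>i\<in>UNIV. \<Sum>c\<in>{- r $ i, r $ i}. emeasure (face i c) A)"
    by (intro sum.cong refl face)
  also have "\<dots> = (\<Sum>(i, c)\<in>Sigma UNIV (\<lambda>i. {- r $ i, r $ i}). emeasure (face i c) A)"
    by (rule sum.Sigma) auto
  finally show ?thesis .
qed

lemma slot_frontier:
  assumes "c \<in> {- r $ i, r $ i}" "y \<in> side i"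
  shows "slot i (c, y) \<in> frontier (box (- r) r)"
proof -
  have "0 \<in> box (- r) r"
    by (simp add: mem_box_cart)
  then have "frontier (box (- r) r) = cbox (- r) r - box (- r) r"
    by (auto simp: frontier_box)
  moreover have "slot i (c, y) \<in> cbox (- r) r"
    using assms by (auto simp: slot_mem_cbox)
  moreover have "slot i (c, y) $ i = c"
    using upd_nth[of i c "slot i (c, y)" i] by (simp del: upd_nth)
  then have "slot i (c, y) \<notin> box (- r) r"
    using assms by (auto simp: mem_box_cart intro!: exI[of _ i])
  ultimately show ?thesis by blast
qed

lemma srf_faces:
  assumes F: "continuous_on UNIV F"
  shows "srf i F = (\<Sum>c\<in>{- r $ i, r $ i}. integral (side i) (\<lambda>y. F (slot i (c, y))))"
proof -
  obtain q where q: "side i = cbox (- q) q"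
    by (simp add: side_def Let_def)
  have "srf i F = integral (side i) (\<lambda>y. F (slot i (r $ i, y)) + F (slot i (- r $ i, y)))"
    unfolding srf_def by (subst vol_const_line[where i=i]) (auto intro: continuous_on_faces[OF F])
  also have "\<dots> = integral (side i) (\<lambda>y. F (slot i (r $ i, y))) + integral (side i) (\<lambda>y. F (slot i (- r $ i, y)))"
    unfolding q by (intro Henstock_Kurzweil_Integration.integral_add integrable_continuous
        continuous_on_UNIV_compose[OF F] continuous_intros)
  finally show ?thesis
    by (simp add: add.commute)
qed

lemma integral_surface:
  fixes F :: "real^3 \<Rightarrow> real"
  assumes F: "continuous_on UNIV F"
  shows "integrable surface_measure F" "(LINT x|surface_measure. F x) = surf F"
proof -
  let ?\<Gamma> = "frontier (box (- r) r)"
  let ?J = "Sigma UNIV (\<lambda>i. {- r $ i, r $ i})"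
  let ?F = "\<lambda>x. indicator ?\<Gamma> x * F x"
  have [measurable]: "F \<in> borel_measurable borel" "?\<Gamma> \<in> sets borel"
    using F by (auto intro: borel_measurable_continuous_onI)
  have face: "integrable (face i c) ?F \<and> integral\<^sup>L (face i c) ?F = integral (side i) (\<lambda>y. F (slot i (c, y)))"
    if c: "c \<in> {- r $ i, r $ i}" for i c
  proof -
    obtain q where q: "side i = cbox (- q) q"
      by (simp add: side_def Let_def)
    have cont: "continuous_on UNIV (\<lambda>y. F (slot i (c, y)))"
      by (intro continuous_on_UNIV_compose[OF F] continuous_intros)
    have m: "(\<lambda>y. slot i (c, y)) \<in> borel_measurable (restrict_space lborel (side i))"
      by (simp add: measurable_restrict_space1)
    have eq: "?F (slot i (c, y)) = F (slot i (c, y))" if "y \<in> space (restrict_space lborel (side i))" for y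
      using slot_frontier[OF c, of y] that by (simp add: space_restrict_space)
    have "integrable (restrict_space lborel (side i)) (\<lambda>y. F (slot i (c, y)))"
      using borel_integrable_compact[OF compact_cbox continuous_on_subset[OF cont], of "- q" q]
      by (subst integrable_restrict_space) (auto simp: q)
    then have "integrable (restrict_space lborel (side i)) (\<lambda>y. ?F (slot i (c, y)))"
      by (subst Bochner_Integration.integrable_cong[OF HOL.refl eq])
    then have "integrable (face i c) ?F"
      unfolding face_def by (subst integrable_distr_eq[OF m]) auto
    moreover have "integral\<^sup>L (face i c) ?F = (LINT y|restrict_space lborel (side i). ?F (slot i (c, y)))"
      unfolding face_def by (subst integral_distr[OF m]) auto
    moreover have "\<dots> = (LINT y|restrict_space lborel (side i). F (slot i (c, y)))"
      by (rule Bochner_Integration.integral_cong[OF HOL.refl eq])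
    moreover have "\<dots> = integral (side i) (\<lambda>y. F (slot i (c, y)))"
      unfolding q integral_cbox_lborel[OF cont] by (subst integral_restrict_space) auto
    ultimately show ?thesis by simp
  qed
  have sum: "integrable (cuboid_surface (- r) r) ?F"
    "integral\<^sup>L (cuboid_surface (- r) r) ?F = (\<Sum>(i, c)\<in>?J. integral\<^sup>L (face i c) ?F)"
  proof -
    have *: "finite ?J" "\<And>j. j \<in> ?J \<Longrightarrow> sets (case_prod face j) = sets (cuboid_surface (- r) r)"
      "\<And>A. A \<in> sets (cuboid_surface (- r) r) \<Longrightarrow> emeasure (cuboid_surface (- r) r) A = (\<Sum>j\<in>?J. emeasure (case_prod face j) A)"
      "?F \<in> borel_measurable (cuboid_surface (- r) r)" "\<And>j. j \<in> ?J \<Longrightarrow> integrable (case_prod face j) ?F"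
      using face by (auto simp: emeasure_cuboid_surface_faces case_prod_beta)
    show "integrable (cuboid_surface (- r) r) ?F"
      by (rule integral_sum_measure(1)[OF *])
    show "integral\<^sup>L (cuboid_surface (- r) r) ?F = (\<Sum>(i, c)\<in>?J. integral\<^sup>L (face i c) ?F)"
      using integral_sum_measure(2)[OF *] by (simp add: case_prod_beta)
  qed
  show "integrable surface_measure F"
    using sum(1) by (subst integrable_restrict_space) auto
  have "(LINT x|surface_measure. F x) = integral\<^sup>L (cuboid_surface (- r) r) ?F"
    by (subst integral_restrict_space) auto
  also have "\<dots> = (\<Sum>(i, c)\<in>?J. integral (side i) (\<lambda>y. F (slot i (c, y))))"
    unfolding sum(2) using face by (intro sum.cong) auto
  also have "\<dots> = (\<Sum>i\<in>UNIV. \<Sum>c\<in>{- r $ i, r $ i}. integral (side i) (\<lambda>y. F (slot i (c, y))))"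
    by (rule sum.Sigma[symmetric]) auto
  finally show "(LINT x|surface_measure. F x) = surf F"
    by (simp only: surf_def srf_faces[OF F])
qed

end

section \<open>From smooth functions to traces\<close>

text \<open>Young's inequality with weight \<open>e\<close>: the first term can be made small by the choice
  of \<open>e\<close>, the second one tends to \<open>0\<close> when \<open>a\<close> approaches \<open>b\<close> with \<open>e\<close> fixed.\<close>

lemma norm_square_diff_le:
  fixes a b :: "'a::real_normed_vector"
  assumes "e > 0"
  shows "\<bar>(norm a)\<^sup>2 - (norm b)\<^sup>2\<bar> \<le> e * (norm b)\<^sup>2 + (1 + 1 / e) * (norm (a - b))\<^sup>2"
proof -
  let ?d = "norm (a - b)"
  have d: "\<bar>norm a - norm b\<bar> \<le> ?d"
    by (rule norm_triangle_ineq3)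
  have "\<bar>(norm a)\<^sup>2 - (norm b)\<^sup>2\<bar> = \<bar>norm a - norm b\<bar> * (norm a + norm b)"
    by (simp add: power2_eq_square square_diff_square_factored abs_mult mult.commute)
  also have "\<dots> \<le> ?d * (2 * norm b + ?d)"
    using d by (intro mult_mono) auto
  also have "\<dots> \<le> e * (norm b)\<^sup>2 + (1 + 1 / e) * ?d\<^sup>2"
  proof -
    have "0 \<le> (e * norm b - ?d)\<^sup>2 / e"
      using assms by simp
    also have "\<dots> = e * (norm b)\<^sup>2 - 2 * (norm b * ?d) + ?d\<^sup>2 / e"
      using assms by (simp add: power2_eq_square field_simps)
    finally show ?thesis
      by (simp add: algebra_simps power2_eq_square)
  qed
  finally show ?thesis .
qed

lemma norm_diff_square_le:
  fixes a b :: "'a::real_normed_vector"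
  shows "(norm (a - b))\<^sup>2 \<le> 2 * (norm a)\<^sup>2 + 2 * (norm b)\<^sup>2"
proof -
  have "(norm (a - b))\<^sup>2 \<le> (norm a + norm b)\<^sup>2"
    by (intro power_mono norm_triangle_ineq4) simp
  also have "\<dots> \<le> 2 * (norm a)\<^sup>2 + 2 * (norm b)\<^sup>2"
    using sum_squares_bound[of "norm a" "norm b"] by (simp add: power2_sum)
  finally show ?thesis .
qed

lemma abs_le_add_square:
  fixes t e :: real
  assumes "e > 0"
  shows "\<bar>t\<bar> \<le> e + (1 / e) * t\<^sup>2"
proof -
  have "0 \<le> (e - \<bar>t\<bar>)\<^sup>2 / e"
    using assms by simp
  also have "\<dots> = e - 2 * \<bar>t\<bar> + (1 / e) * t\<^sup>2"
    using assms by (simp add: power2_eq_square field_simps)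
  finally show ?thesis by simp
qed

lemma tendsto_of_scaled_bound:
  fixes u :: "nat \<Rightarrow> real"
  assumes e: "e \<longlonglongrightarrow> 0" and K: "0 \<le> K"
    and bound: "\<And>\<epsilon> n. \<epsilon> > 0 \<Longrightarrow> \<bar>u n - l\<bar> \<le> \<epsilon> * K + (1 + 1 / \<epsilon>) * e n"
  shows "u \<longlonglongrightarrow> l"
proof (rule LIMSEQ_I)
  fix \<eta> :: real
  assume "0 < \<eta>"
  define \<epsilon> where "\<epsilon> = \<eta> / (2 * (K + 1))"
  have \<epsilon>: "\<epsilon> > 0"
    using \<open>0 < \<eta>\<close> K by (simp add: \<epsilon>_def)
  have "(\<lambda>n. (1 + 1 / \<epsilon>) * e n) \<longlonglongrightarrow> (1 + 1 / \<epsilon>) * 0"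
    by (intro tendsto_intros e)
  then obtain N where N: "\<And>n. n \<ge> N \<Longrightarrow> norm ((1 + 1 / \<epsilon>) * e n - (1 + 1 / \<epsilon>) * 0) < \<eta> / 2"
    using LIMSEQ_D[of "\<lambda>n. (1 + 1 / \<epsilon>) * e n" "(1 + 1 / \<epsilon>) * 0" "\<eta> / 2"] \<open>0 < \<eta>\<close> by auto
  have "\<epsilon> * K \<le> \<eta> / 2"
    using K \<open>0 < \<eta>\<close> by (simp add: \<epsilon>_def field_simps)
  then have "norm (u n - l) < \<eta>" if "n \<ge> N" for n
    using bound[OF \<epsilon>, of n] N[OF that] unfolding real_norm_def mult_zero_right diff_zero by linarith
  then show "\<exists>N. \<forall>n\<ge>N. norm (u n - l) < \<eta>"
    by blast
qed

lemma tendsto_L2_integral: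
  fixes f :: "nat \<Rightarrow> 'a \<Rightarrow> 'b::euclidean_space"
  assumes f: "\<And>n. in_L2 M (f n)" and g: "in_L2 M g" and lim: "tendsto_L2 M f g"
  shows "integrable M (\<lambda>x. (norm (f n x - g x))\<^sup>2)"
    and "(\<lambda>n. LINT x|M. (norm (f n x - g x))\<^sup>2) \<longlonglongrightarrow> 0"
proof -
  have meas [measurable]: "f n \<in> borel_measurable M" "g \<in> borel_measurable M" for n
    using f g by (auto simp: in_L2_def)
  show int: "integrable M (\<lambda>x. (norm (f n x - g x))\<^sup>2)" for n
  proof (rule Bochner_Integration.integrable_bound)
    show "integrable M (\<lambda>x. 2 * (norm (f n x))\<^sup>2 + 2 * (norm (g x))\<^sup>2)"
      using f[of n] g by (simp add: in_L2_def)
    show "AE x in M. norm ((norm (f n x - g x))\<^sup>2) \<le> norm (2 * (norm (f n x))\<^sup>2 + 2 * (norm (g x))\<^sup>2)"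
      using norm_diff_square_le by (intro AE_I2) auto
  qed simp
  have "(\<integral>\<^sup>+x. ennreal ((norm (f n x - g x))\<^sup>2) \<partial>M) = ennreal (LINT x|M. (norm (f n x - g x))\<^sup>2)" for n
    by (rule nn_integral_eq_integral[OF int]) simp
  then have "(\<lambda>n. ennreal (LINT x|M. (norm (f n x - g x))\<^sup>2)) \<longlonglongrightarrow> ennreal 0"
    using lim by (simp add: tendsto_L2_def)
  then show "(\<lambda>n. LINT x|M. (norm (f n x - g x))\<^sup>2) \<longlonglongrightarrow> 0"
    by (subst (asm) tendsto_ennreal_iff) auto
qed

lemma tendsto_L2_square:
  fixes f :: "nat \<Rightarrow> 'a \<Rightarrow> 'b::euclidean_space"
  assumes f: "\<And>n. in_L2 M (f n)" and g: "in_L2 M g" and lim: "tendsto_L2 M f g"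
  shows "(\<lambda>n. LINT x|M. (norm (f n x))\<^sup>2) \<longlonglongrightarrow> (LINT x|M. (norm (g x))\<^sup>2)"
proof (rule tendsto_of_scaled_bound[OF tendsto_L2_integral(2)[OF assms]])
  show "0 \<le> (LINT x|M. (norm (g x))\<^sup>2)" by simp
  fix \<epsilon> :: real and n
  assume "\<epsilon> > 0"
  note int = tendsto_L2_integral(1)[OF assms, of n]
  have intf: "integrable M (\<lambda>x. (norm (f n x))\<^sup>2)" and intg: "integrable M (\<lambda>x. (norm (g x))\<^sup>2)"
    using f[of n] g by (auto simp: in_L2_def)
  have "\<bar>(LINT x|M. (norm (f n x))\<^sup>2) - (LINT x|M. (norm (g x))\<^sup>2)\<bar> = \<bar>LINT x|M. (norm (f n x))\<^sup>2 - (norm (g x))\<^sup>2\<bar>"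
    using intf intg by simp
  also have "\<dots> \<le> (LINT x|M. \<bar>(norm (f n x))\<^sup>2 - (norm (g x))\<^sup>2\<bar>)"
    by (rule integral_abs_bound)
  also have "\<dots> \<le> (LINT x|M. \<epsilon> * (norm (g x))\<^sup>2 + (1 + 1 / \<epsilon>) * (norm (f n x - g x))\<^sup>2)"
    using intf intg int norm_square_diff_le[OF \<open>\<epsilon> > 0\<close>]
    by (intro integral_mono integrable_abs Bochner_Integration.integrable_diff
        Bochner_Integration.integrable_add integrable_mult_right)
  also have "\<dots> = \<epsilon> * (LINT x|M. (norm (g x))\<^sup>2) + (1 + 1 / \<epsilon>) * (LINT x|M. (norm (f n x - g x))\<^sup>2)"
    using intg int by (subst Bochner_Integration.integral_add) auto
  finally show "\<bar>(LINT x|M. (norm (f n x))\<^sup>2) - (LINT x|M. (norm (g x))\<^sup>2)\<bar> \<le>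
      \<epsilon> * (LINT x|M. (norm (g x))\<^sup>2) + (1 + 1 / \<epsilon>) * (LINT x|M. (norm (f n x - g x))\<^sup>2)" .
qed

lemma (in finite_measure) integrable_of_in_L2:
  fixes f :: "'a \<Rightarrow> real"
  assumes "in_L2 M f"
  shows "integrable M f"
proof (rule Bochner_Integration.integrable_bound)
  show "integrable M (\<lambda>x. 1 + (1 / 1) * (f x)\<^sup>2)"
    using assms by (simp add: in_L2_def)
  show "AE x in M. norm (f x) \<le> norm (1 + (1 / 1) * (f x)\<^sup>2)"
    using abs_le_add_square[of 1] by (intro AE_I2) auto
qed (use assms in \<open>simp add: in_L2_def\<close>)

lemma (in finite_measure) tendsto_L2_mean:
  fixes f :: "nat \<Rightarrow> 'a \<Rightarrow> real"
  assumes f: "\<And>n. in_L2 M (f n)" and g: "in_L2 M g" and lim: "tendsto_L2 M f g"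
  shows "(\<lambda>n. LINT x|M. f n x) \<longlonglongrightarrow> (LINT x|M. g x)"
proof (rule tendsto_of_scaled_bound[OF tendsto_L2_integral(2)[OF assms]])
  show "0 \<le> measure M (space M)" by simp
  fix \<epsilon> :: real and n
  assume "\<epsilon> > 0"
  have int: "integrable M (\<lambda>x. (f n x - g x)\<^sup>2)"
    using tendsto_L2_integral(1)[OF assms, of n] by simp
  have intf: "integrable M (f n)" and intg: "integrable M g"
    using f[of n] g by (auto intro: integrable_of_in_L2)
  have "\<bar>(LINT x|M. f n x) - (LINT x|M. g x)\<bar> = \<bar>LINT x|M. f n x - g x\<bar>"
    using intf intg by simp
  also have "\<dots> \<le> (LINT x|M. \<bar>f n x - g x\<bar>)"
    by (rule integral_abs_bound)
  also have "\<dots> \<le> (LINT x|M. \<epsilon> + (1 / \<epsilon>) * (f n x - g x)\<^sup>2)"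
    using intf intg int abs_le_add_square[OF \<open>\<epsilon> > 0\<close>]
    by (intro integral_mono integrable_abs Bochner_Integration.integrable_diff
        Bochner_Integration.integrable_add integrable_mult_right integrable_const)
  also have "\<dots> = \<epsilon> * measure M (space M) + (1 / \<epsilon>) * (LINT x|M. (f n x - g x)\<^sup>2)"
    using int by (subst Bochner_Integration.integral_add) auto
  also have "\<dots> \<le> \<epsilon> * measure M (space M) + (1 + 1 / \<epsilon>) * (LINT x|M. (f n x - g x)\<^sup>2)"
    by (simp add: distrib_right)
  finally show "\<bar>(LINT x|M. f n x) - (LINT x|M. g x)\<bar> \<le>
      \<epsilon> * measure M (space M) + (1 + 1 / \<epsilon>) * (LINT x|M. (norm (f n x - g x))\<^sup>2)"
    by simp
qed

lemma smoothD:
  assumes "smooth f"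
  shows "f differentiable (at x)" "smooth (\<lambda>x. frechet_derivative f (at x) v)"
  using assms by (auto elim: smooth.cases)

lemma smooth_continuous: "smooth f \<Longrightarrow> continuous_on S f"
  by (meson smoothD(1) differentiable_imp_continuous_within continuous_at_imp_continuous_on)

abbreviation partial :: "(real^'n::finite \<Rightarrow> real) \<Rightarrow> 'n \<Rightarrow> real^'n \<Rightarrow> real" where
  "partial f i x \<equiv> frechet_derivative f (at x) (axis i 1)"

lemma grad_nth: "grad f x $ i = partial f i x" for f :: "real^'n::finite \<Rightarrow> real"
proof -
  have "grad f x \<bullet> axis i 1 = partial f i x"
    by (simp add: grad_def axis_in_Basis_iff inner_sum_left_Basis)
  then show ?thesis
    by (simp add: inner_axis)
qed

lemma norm_grad_square: "(norm (grad f x))\<^sup>2 = (\<Sum>i\<in>UNIV. (partial f i x)\<^sup>2)"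
  for f :: "real^'n::finite \<Rightarrow> real"
  unfolding power2_norm_eq_inner inner_vec_def by (simp add: grad_nth power2_eq_square)

lemma smooth_continuous_grad:
  fixes f :: "real^'n::finite \<Rightarrow> real"
  assumes "smooth f"
  shows "continuous_on S (grad f)"
proof -
  have "grad f = (\<lambda>x. \<chi> i. partial f i x)"
    by (simp add: fun_eq_iff vec_eq_iff grad_nth)
  then show ?thesis
    using smooth_continuous[OF smoothD(2)[OF assms]]
    by (auto intro!: continuous_on_vec_lambda)
qed

lemma smooth_C1:
  fixes f :: "real^'n::finite \<Rightarrow> real"
  assumes f: "smooth f"
  shows "C1 f (partial f)"
  unfolding C1_def
proof (intro conjI allI)
  fix i and x :: "real^'n"
  have f': "(f has_derivative frechet_derivative f (at x)) (at x)"
    using smoothD(1)[OF f] by (simp add: frechet_derivative_works)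
  have "((\<lambda>c. upd i c x) has_derivative (\<lambda>h. h *\<^sub>R axis i 1)) (at (x $ i))"
    unfolding upd_def by (auto intro!: derivative_eq_intros)
  moreover have "upd i (x $ i) x = x"
    by (simp add: vec_eq_iff)
  ultimately have "((\<lambda>c. f (upd i c x)) has_derivative (\<lambda>h. frechet_derivative f (at x) (h *\<^sub>R axis i 1))) (at (x $ i))"
    using has_derivative_compose[of "\<lambda>c. upd i c x" _ "x $ i" UNIV f] f' by simp
  moreover have "frechet_derivative f (at x) (h *\<^sub>R axis i 1) = partial f i x * h" for h
    using linear_cmul[OF has_derivative_linear[OF f']] by (simp add: mult.commute)
  ultimately show "((\<lambda>c. f (upd i c x)) has_real_derivative partial f i x) (at (x $ i))"
    by (simp add: has_field_derivative_def)
qed (intro smooth_continuous smoothD f)+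

context cuboid
begin

lemma in_L2_interior:
  fixes F :: "real^3 \<Rightarrow> 'b::euclidean_space"
  assumes F: "continuous_on UNIV F"
  shows "in_L2 interior_measure F"
  unfolding in_L2_def
proof
  show "F \<in> borel_measurable interior_measure"
    by (rule continuous_imp_measurable_on_sets_lebesgue) (auto intro: continuous_on_subset[OF F])
  show "integrable interior_measure (\<lambda>x. (norm (F x))\<^sup>2)"
    by (intro integral_interior continuous_intros F)
qed

lemma in_L2_surface:
  fixes F :: "real^3 \<Rightarrow> real"
  assumes F: "continuous_on UNIV F"
  shows "in_L2 surface_measure F"
  unfolding in_L2_def
proof
  show "F \<in> borel_measurable surface_measure"
    by (rule borel_measurable_integrable[OF integral_surface(1)[OF F]])
  show "integrable surface_measure (\<lambda>x. (norm (F x))\<^sup>2)"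
    by (intro integral_surface continuous_intros F)
qed

lemma energy_grad:
  assumes f: "smooth f"
  shows "(LINT x|interior_measure. (norm (grad f x))\<^sup>2) = energy (partial f)"
proof -
  have c: "continuous_on UNIV (\<lambda>x. (partial f i x)\<^sup>2)" for i
    by (intro continuous_intros smooth_continuous smoothD(2) f)
  have "(LINT x|interior_measure. (norm (grad f x))\<^sup>2) = (\<Sum>i\<in>UNIV. LINT x|interior_measure. (partial f i x)\<^sup>2)"
    unfolding norm_grad_square by (rule Bochner_Integration.integral_sum) (rule integral_interior(1)[OF c])
  then show ?thesis
    by (simp add: energy_def integral_interior(2)[OF c])
qed

lemma finite_surface_measure: "finite_measure surface_measure"
proof
  have "integrable surface_measure (\<lambda>x. 1 :: real)"
    by (rule integral_surface) simp
  then show "emeasure surface_measure (space surface_measure) \<noteq> \<infinity>"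
    unfolding integrable_iff_bounded by (simp add: less_top)
qed

end

context steklov
begin

text \<open>All three terms of the inequality for smooth functions are continuous under the convergence
  that defines traces, and the second one tends to zero because the trace has mean value zero.\<close>

lemma trace_bound:
  assumes "H1_mean_zero (box (- r) r) surface_measure w G g"
  shows "\<mu> * (LINT x|surface_measure. (g x)\<^sup>2) \<le> (LINT x|interior_measure. (norm (G x))\<^sup>2)"
proof -
  interpret S: finite_measure surface_measure
    by (rule finite_surface_measure)
  have G: "in_L2 interior_measure G" and g: "in_L2 surface_measure g"
    and mean: "mean_value surface_measure g = 0"
    using assms by (auto simp: H1_mean_zero_def H1_def has_trace_def)
  obtain \<phi> where \<phi>: "\<And>n. smooth (\<phi> n)"
    and limG: "tendsto_L2 interior_measure (\<lambda>n. grad (\<phi> n)) G"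
    and limg: "tendsto_L2 surface_measure \<phi> g"
    using assms by (auto simp: H1_mean_zero_def has_trace_def)
  have c: "continuous_on UNIV (\<phi> n)" "continuous_on UNIV (\<lambda>x. (\<phi> n x)\<^sup>2)" "continuous_on UNIV (grad (\<phi> n))" for n
    by (intro continuous_intros smooth_continuous smooth_continuous_grad \<phi>)+
  have area: "surf (\<lambda>x. 1) = measure surface_measure (space surface_measure)"
    using integral_surface(2)[of "\<lambda>x. 1"] by simp
  have "(LINT x|surface_measure. g x) = 0"
    using mean surf_1_pos by (simp add: mean_value_def area)
  then have lim1: "(\<lambda>n. surf (\<phi> n)) \<longlonglongrightarrow> 0"
    using S.tendsto_L2_mean[OF in_L2_surface[OF c(1)] g limg] by (simp add: integral_surface(2)[OF c(1)])
  have lim2: "(\<lambda>n. surf (\<lambda>x. (\<phi> n x)\<^sup>2)) \<longlonglongrightarrow> (LINT x|surface_measure. (g x)\<^sup>2)"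
    using tendsto_L2_square[OF in_L2_surface[OF c(1)] g limg] by (simp add: integral_surface(2)[OF c(2)])
  have lim3: "(\<lambda>n. energy (partial (\<phi> n))) \<longlonglongrightarrow> (LINT x|interior_measure. (norm (G x))\<^sup>2)"
    using tendsto_L2_square[OF in_L2_interior[OF c(3)] G limG] by (simp add: energy_grad \<phi>)
  have "(\<lambda>n. \<mu> * (surf (\<lambda>x. (\<phi> n x)\<^sup>2) - (surf (\<phi> n))\<^sup>2 / surf (\<lambda>x. 1))) \<longlonglongrightarrow>
      \<mu> * ((LINT x|surface_measure. (g x)\<^sup>2) - 0\<^sup>2 / surf (\<lambda>x. 1))"
    by (intro tendsto_intros lim1 lim2) (use surf_1_pos in simp)
  then have "\<mu> * ((LINT x|surface_measure. (g x)\<^sup>2) - 0\<^sup>2 / surf (\<lambda>x. 1)) \<le> (LINT x|interior_measure. (norm (G x))\<^sup>2)"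
    by (rule LIMSEQ_le[OF _ lim3]) (use boundary_bound[OF smooth_C1[OF \<phi>]] in blast)
  then show ?thesis by simp
qed

lemma trace_inequality_steklov:
  "trace_inequality (box (- r) r) surface_measure (\<mu> powr (- 1 / 2))"
  unfolding trace_inequality_def
proof (intro allI impI)
  fix w G g
  assume *: "H1_mean_zero (box (- r) r) surface_measure w G g"
  have "(LINT x|surface_measure. (g x)\<^sup>2) \<le> (LINT x|interior_measure. (norm (G x))\<^sup>2) / \<mu>"
    using trace_bound[OF *] \<mu>_pos by (simp add: field_simps)
  then have "L2_norm surface_measure g \<le> sqrt ((LINT x|interior_measure. (norm (G x))\<^sup>2) / \<mu>)"
    by (simp add: L2_norm_def)
  also have "\<dots> = \<mu> powr (- 1 / 2) * L2_norm interior_measure G"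
    using \<mu>_pos by (simp add: L2_norm_def real_sqrt_divide powr_minus_divide powr_half_sqrt)
  finally show "L2_norm surface_measure g \<le> \<mu> powr (- 1 / 2) * L2_norm interior_measure G" .
qed

end

section \<open>The extremal function\<close>

text \<open>Sequences \<open>A\<close>, \<open>B\<close>, \<open>C\<close> list the successive derivatives of three functions of one variable.
  The span of the products of their members is closed under directional derivatives, which makes it
  an invariant for the coinductive definition of smoothness.\<close>

inductive separable :: "(nat \<Rightarrow> real \<Rightarrow> real) \<Rightarrow> (nat \<Rightarrow> real \<Rightarrow> real) \<Rightarrow> (nat \<Rightarrow> real \<Rightarrow> real) \<Rightarrow>
    (real^3 \<Rightarrow> real) \<Rightarrow> bool" for A B C where
  product: "separable A B C (\<lambda>x. k * (A l (x $ 1) * B m (x $ 2) * C n (x $ 3)))"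
| add: "separable A B C f \<Longrightarrow> separable A B C g \<Longrightarrow> separable A B C (\<lambda>x. f x + g x)"

lemma separable_derivative:
  assumes A: "\<And>n t. (A n has_real_derivative A (Suc n) t) (at t)"
    and B: "\<And>n t. (B n has_real_derivative B (Suc n) t) (at t)"
    and C: "\<And>n t. (C n has_real_derivative C (Suc n) t) (at t)"
    and f: "separable A B C f"
  shows "\<exists>f'. (\<forall>x. (f has_derivative f' x) (at x)) \<and> (\<forall>v. separable A B C (\<lambda>x. f' x v))"
  using f
proof induction
  case (product k l m n)
  let ?f' = "\<lambda>(x :: real^3) (v :: real^3). (k * v $ 1) * (A (Suc l) (x $ 1) * B m (x $ 2) * C n (x $ 3)) +
    (k * v $ 2) * (A l (x $ 1) * B (Suc m) (x $ 2) * C n (x $ 3)) +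
    (k * v $ 3) * (A l (x $ 1) * B m (x $ 2) * C (Suc n) (x $ 3))"
  have coord: "((\<lambda>x. h (x $ i)) has_derivative (\<lambda>v. h' (x $ i) * v $ i)) (at x)"
    if "\<And>t. (h has_real_derivative h' t) (at t)" for h h' and i :: 3 and x :: "real^3"
    using has_derivative_compose[OF bounded_linear_imp_has_derivative[OF bounded_linear_vec_nth[of i]]
        that[unfolded has_field_derivative_def, of "x $ i"]] by simp
  have "((\<lambda>x. k * (A l (x $ 1) * B m (x $ 2) * C n (x $ 3))) has_derivative ?f' x) (at x)" for x :: "real^3"
    by (rule has_derivative_eq_rhs[OF has_derivative_mult_right[OF has_derivative_mult[OF
          has_derivative_mult[OF coord[OF A] coord[OF B]] coord[OF C]]]])
      (simp add: fun_eq_iff algebra_simps)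
  moreover have "separable A B C (\<lambda>x. ?f' x v)" for v
    by (intro separable.intros)
  ultimately show ?case
    by (intro exI[of _ ?f'] conjI allI)
next
  case (add f g)
  then obtain f' g' where *: "\<And>x. (f has_derivative f' x) (at x)" "\<And>v. separable A B C (\<lambda>x. f' x v)"
    "\<And>x. (g has_derivative g' x) (at x)" "\<And>v. separable A B C (\<lambda>x. g' x v)"
    by blast
  have "((\<lambda>x. f x + g x) has_derivative (\<lambda>v. f' x v + g' x v)) (at x)" for x
    by (intro has_derivative_add *)
  moreover have "separable A B C (\<lambda>x. f' x v + g' x v)" for v
    by (intro separable.add *)
  ultimately show ?case
    by (intro exI[of _ "\<lambda>x v. f' x v + g' x v"]) blast
qed

lemma separable_smooth:
  assumes "\<And>n t. (A n has_real_derivative A (Suc n) t) (at t)"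
    and "\<And>n t. (B n has_real_derivative B (Suc n) t) (at t)"
    and "\<And>n t. (C n has_real_derivative C (Suc n) t) (at t)"
    and "separable A B C f"
  shows "smooth f"
  using assms(4)
proof (coinduction arbitrary: f rule: smooth.coinduct)
  case smooth
  obtain f' where f': "\<And>x. (f has_derivative f' x) (at x)" "\<And>v. separable A B C (\<lambda>x. f' x v)"
    using separable_derivative[OF assms(1-3) smooth] by blast
  have "frechet_derivative f (at x) = f' x" for x
    using frechet_derivative_at[OF f'(1)] by simp
  then show ?case
    using f' by (auto simp: differentiable_def)
qed

lemma C1_unique:
  assumes "C1 w D" "C1 w E"
  shows "D = E"
proof (intro ext)
  fix i x
  show "D i x = E i x"
    using assms unfolding C1_def by (blast intro: DERIV_unique)
qed

context steklov
begin

definition eigenfunction :: "real^3 \<Rightarrow> real" where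
  "eigenfunction x = cosh (\<alpha> * x $ 1) * cosh (\<beta> * x $ 2) * sin (\<gamma> * x $ 3)"

definition eigenfunction_grad :: "3 \<Rightarrow> real^3 \<Rightarrow> real" where
  "eigenfunction_grad i x = (if i = 1 then \<alpha> * sinh (\<alpha> * x $ 1) * cosh (\<beta> * x $ 2) * sin (\<gamma> * x $ 3)
    else if i = 2 then cosh (\<alpha> * x $ 1) * (\<beta> * sinh (\<beta> * x $ 2)) * sin (\<gamma> * x $ 3)
    else cosh (\<alpha> * x $ 1) * cosh (\<beta> * x $ 2) * (\<gamma> * cos (\<gamma> * x $ 3)))"

lemma smooth_eigenfunction: "smooth eigenfunction"
proof -
  let ?H = "\<lambda>\<kappa> n t. \<kappa> ^ n * (if even n then cosh (\<kappa> * t) else sinh (\<kappa> * t))"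
  let ?S = "\<lambda>n t. \<gamma> ^ n * sin (\<gamma> * t + real n * (pi / 2))"
  have H: "(?H \<kappa> n has_real_derivative ?H \<kappa> (Suc n) t) (at t)" for \<kappa> :: real and n t
    by (cases "even n") (auto intro!: derivative_eq_intros)
  have S: "(?S n has_real_derivative ?S (Suc n) t) (at t)" for n t
  proof -
    have "cos (\<gamma> * t + real n * (pi / 2)) = sin (\<gamma> * t + real (Suc n) * (pi / 2))"
      using sin_add[of "\<gamma> * t + real n * (pi / 2)" "pi / 2"] by (simp add: algebra_simps add_divide_distrib)
    then show ?thesis
      by (auto intro!: derivative_eq_intros)
  qed
  have "separable (?H \<alpha>) (?H \<beta>) ?S eigenfunction"
    using separable.product[of "?H \<alpha>" "?H \<beta>" ?S 1 0 0 0] by (simp add: eigenfunction_def[abs_def])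
  then show ?thesis
    by (rule separable_smooth[rotated 3]) (rule H S)+
qed

lemma C1_eigenfunction: "C1 eigenfunction eigenfunction_grad"
  unfolding C1_def
proof (intro conjI allI)
  show "continuous_on UNIV eigenfunction"
    unfolding eigenfunction_def[abs_def] by (intro continuous_intros)
  show "continuous_on UNIV (eigenfunction_grad i)" for i
    unfolding eigenfunction_grad_def[abs_def] by (cases i rule: index_cases; simp; intro continuous_intros)
  show "((\<lambda>c. eigenfunction (upd i c x)) has_real_derivative eigenfunction_grad i x) (at (x $ i))" for i x
    by (cases i rule: index_cases) (auto simp: eigenfunction_def eigenfunction_grad_def intro!: derivative_eq_intros)
qed

lemma partial_eigenfunction: "partial eigenfunction = eigenfunction_grad"
  by (rule C1_unique[OF smooth_C1[OF smooth_eigenfunction] C1_eigenfunction])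

lemma eigenfunction_boundary:
  "eigenfunction_grad i (upd i (r $ i) x) = \<mu> * eigenfunction (upd i (r $ i) x)"
  "eigenfunction_grad i (upd i (- r $ i) x) = - \<mu> * eigenfunction (upd i (- r $ i) x)"
proof -
  have "sinh (\<alpha> * r $ 1) * \<alpha> = \<mu> * cosh (\<alpha> * r $ 1)"
    by (simp flip: \<alpha> add: tanh_def)
  moreover have "sinh (\<beta> * r $ 2) * \<beta> = \<mu> * cosh (\<beta> * r $ 2)"
    by (simp flip: \<beta> add: tanh_def)
  moreover have "sin (\<gamma> * r $ 3) \<noteq> 0"
    using sin_gt_zero[of "\<gamma> * r $ 3"] \<gamma>_pos \<gamma>_less_pi[of 3] by simp
  then have "cos (\<gamma> * r $ 3) * \<gamma> = \<mu> * sin (\<gamma> * r $ 3)"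
    by (simp flip: \<gamma> add: cot_def)
  ultimately show "eigenfunction_grad i (upd i (r $ i) x) = \<mu> * eigenfunction (upd i (r $ i) x)"
    "eigenfunction_grad i (upd i (- r $ i) x) = - \<mu> * eigenfunction (upd i (- r $ i) x)"
    by (cases i rule: index_cases; simp add: eigenfunction_def eigenfunction_grad_def ac_simps)+
qed

text \<open>Along each line \<open>f f'\<close> is an antiderivative of \<open>f'\<^sup>2 + f f''\<close>, where \<open>f'' = k f\<close>, and its
  boundary values are \<open>\<plusminus> \<mu> f\<^sup>2\<close>. The three constants \<open>k\<close> add up to zero.\<close>

lemma eigenfunction_energy: "energy eigenfunction_grad = \<mu> * surf (\<lambda>x. (eigenfunction x)\<^sup>2)"
proof -
  define k where "k i = (if i = 1 then \<alpha>\<^sup>2 else if i = 2 then \<beta>\<^sup>2 else - \<gamma>\<^sup>2)" for i :: 3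
  note cu = C1_D(1)[OF C1_eigenfunction] and cD = C1_D(2)[OF C1_eigenfunction]
  have "srf i (\<lambda>x. \<mu> * (eigenfunction x)\<^sup>2) = vol (\<lambda>x. (eigenfunction_grad i x)\<^sup>2 + k i * (eigenfunction x)\<^sup>2)" for i
  proof (rule srf_eq_of_lines)
    fix x
    have second: "((\<lambda>c. eigenfunction_grad i (upd i c x)) has_real_derivative k i * eigenfunction (upd i c x)) (at c)" for c
      by (cases i rule: index_cases)
        (auto simp: eigenfunction_def eigenfunction_grad_def k_def power2_eq_square intro!: derivative_eq_intros)
    have "((\<lambda>c. (eigenfunction_grad i (upd i c x))\<^sup>2 + k i * (eigenfunction (upd i c x))\<^sup>2) has_integral
      (eigenfunction (upd i (r $ i) x) * eigenfunction_grad i (upd i (r $ i) x) - eigenfunction (upd i (- r $ i) x) * eigenfunction_grad i (upd i (- r $ i) x)))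
      {- r $ i .. r $ i}"
    proof (rule fundamental_theorem_of_calculus)
      show "- r $ i \<le> r $ i" by simp
      show "((\<lambda>c. eigenfunction (upd i c x) * eigenfunction_grad i (upd i c x)) has_vector_derivative
          (eigenfunction_grad i (upd i c x))\<^sup>2 + k i * (eigenfunction (upd i c x))\<^sup>2) (at c within {- r $ i .. r $ i})" for c
        unfolding has_real_derivative_iff_has_vector_derivative[symmetric]
        by (rule has_field_derivative_at_within)
          (auto intro!: derivative_eq_intros C1_D(3)[OF C1_eigenfunction] second simp: power2_eq_square)
    qed
    then show "\<mu> * (eigenfunction (upd i (r $ i) x))\<^sup>2 + \<mu> * (eigenfunction (upd i (- r $ i) x))\<^sup>2 =
        integral {- r $ i .. r $ i} (\<lambda>c. (eigenfunction_grad i (upd i c x))\<^sup>2 + k i * (eigenfunction (upd i c x))\<^sup>2)"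
      by (simp add: integral_unique eigenfunction_boundary power2_eq_square ac_simps)
  qed (intro continuous_intros cu cD)
  then have "\<mu> * srf i (\<lambda>x. (eigenfunction x)\<^sup>2) = vol (\<lambda>x. (eigenfunction_grad i x)\<^sup>2) + k i * vol (\<lambda>x. (eigenfunction x)\<^sup>2)" for i
    using vol_add[of "\<lambda>x. (eigenfunction_grad i x)\<^sup>2" "\<lambda>x. k i * (eigenfunction x)\<^sup>2"]
    by (simp add: vol_cmult srf_cmult continuous_intros cu cD)
  then have "\<mu> * surf (\<lambda>x. (eigenfunction x)\<^sup>2) = energy eigenfunction_grad + (\<Sum>i\<in>UNIV. k i) * vol (\<lambda>x. (eigenfunction x)\<^sup>2)"
    by (simp add: surf_def energy_def sum_distrib_left sum_distrib_right sum.distrib)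
  moreover have "(\<Sum>i\<in>UNIV. k i) = 0"
    by (simp add: sum_3 k_def \<gamma>_square)
  ultimately show ?thesis by simp
qed

lemma eigenfunction_surf_zero: "surf eigenfunction = 0"
proof -
  have "eigenfunction (mirror 3 x) = - 1 * eigenfunction x" for x
    by (simp add: eigenfunction_def)
  then have "surf eigenfunction = - 1 * surf eigenfunction"
    using surf_mirror[OF C1_D(1)[OF C1_eigenfunction], of 3] surf_cmult[of "- 1" eigenfunction] by simp
  then show ?thesis by simp
qed

lemma eigenfunction_surf_pos: "0 < surf (\<lambda>x. (eigenfunction x)\<^sup>2)"
proof -
  let ?s = "(sin (\<gamma> * r $ 3))\<^sup>2"
  have s: "0 < ?s"
    using sin_gt_zero[of "\<gamma> * r $ 3"] \<gamma>_pos \<gamma>_less_pi[of 3] by simp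
  have cu: "continuous_on UNIV (\<lambda>x. (eigenfunction x)\<^sup>2)"
    by (intro continuous_intros C1_D(1)[OF C1_eigenfunction])
  have "?s * 1 \<le> (eigenfunction (upd 3 (r $ 3) x))\<^sup>2 + (eigenfunction (upd 3 (- r $ 3) x))\<^sup>2" for x
  proof -
    have "?s * 1 \<le> ?s * ((cosh (\<alpha> * x $ 1))\<^sup>2 * (cosh (\<beta> * x $ 2))\<^sup>2)"
      by (intro mult_left_mono) (auto simp: cosh_real_ge_1 intro!: mult_ge1_I one_le_power)
    also have "\<dots> = (eigenfunction (upd 3 (r $ 3) x))\<^sup>2"
      by (simp add: eigenfunction_def power_mult_distrib)
    finally show ?thesis
      by (rule order_trans) simp
  qed
  then have "?s * vol (\<lambda>x. 1) \<le> vol (\<lambda>x. (eigenfunction (upd 3 (r $ 3) x))\<^sup>2 + (eigenfunction (upd 3 (- r $ 3) x))\<^sup>2)"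
    unfolding vol_cmult[symmetric] by (intro vol_mono continuous_on_faces cu) auto
  moreover have "0 < ?s * vol (\<lambda>x. 1)"
    using s vol_1_pos by (rule mult_pos_pos)
  ultimately have "0 < srf 3 (\<lambda>x. (eigenfunction x)\<^sup>2)"
    unfolding srf_def by (intro divide_pos_pos) auto
  moreover have "0 \<le> srf i (\<lambda>x. (eigenfunction x)\<^sup>2)" for i
    unfolding srf_def by (intro divide_nonneg_pos vol_nonneg) auto
  ultimately show ?thesis
    by (simp add: surf_def sum_3 add_nonneg_pos)
qed

end

context cuboid
begin

text \<open>The derivative of \<open>w v\<close> in direction \<open>i\<close> integrates to zero along every line, because \<open>v\<close>
  vanishes at both ends.\<close>

lemma vol_by_parts:
  assumes w: "C1 w D" and v: "C1 v E"
    and zero: "\<And>x. x \<notin> box (- r) r \<Longrightarrow> v x = 0"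
  shows "vol (\<lambda>x. w x * E i x) = - vol (\<lambda>x. v x * D i x)"
proof -
  note c = C1_D(1,2)[OF w] C1_D(1,2)[OF v]
  have cont: "continuous_on UNIV (\<lambda>x. w x * E i x)" "continuous_on UNIV (\<lambda>x. v x * D i x)"
    by (intro continuous_intros c)+
  have "integral {- r $ i .. r $ i} (\<lambda>c. w (upd i c x) * E i (upd i c x) + v (upd i c x) * D i (upd i c x)) = 0" for x
  proof -
    have "((\<lambda>c. w (upd i c x) * E i (upd i c x) + v (upd i c x) * D i (upd i c x)) has_integral
      (w (upd i (r $ i) x) * v (upd i (r $ i) x) - w (upd i (- r $ i) x) * v (upd i (- r $ i) x))) {- r $ i .. r $ i}"
    proof (rule fundamental_theorem_of_calculus)
      show "- r $ i \<le> r $ i" by simp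
      show "((\<lambda>c. w (upd i c x) * v (upd i c x)) has_vector_derivative
          w (upd i c x) * E i (upd i c x) + v (upd i c x) * D i (upd i c x)) (at c within {- r $ i .. r $ i})" for c
        unfolding has_real_derivative_iff_has_vector_derivative[symmetric]
        by (rule has_field_derivative_at_within)
          (auto intro!: derivative_eq_intros C1_D(3)[OF w] C1_D(3)[OF v])
    qed
    moreover have "v (upd i (r $ i) x) = 0" "v (upd i (- r $ i) x) = 0"
      by (rule zero, auto simp: mem_box_cart intro!: exI[of _ i])+
    ultimately show ?thesis
      by (simp add: integral_unique)
  qed
  then have "avg i (\<lambda>x. w x * E i x + v x * D i x) = (\<lambda>x. 0)"
    by (simp add: avg_def[abs_def])
  then have "vol (\<lambda>x. w x * E i x + v x * D i x) = 0"
    using vol_avg[OF continuous_on_add[OF cont], of i] by (simp add: vol_def)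
  then show ?thesis
    unfolding vol_add[OF cont] by simp
qed

lemma weak_gradient_grad:
  assumes w: "smooth w"
  shows "weak_gradient (box (- r) r) w (grad w)"
  unfolding weak_gradient_def
proof (intro allI impI)
  fix \<phi> :: "real^3 \<Rightarrow> real"
  assume "test_function (box (- r) r) \<phi>"
  then have \<phi>: "smooth \<phi>" and zero: "\<And>x. x \<notin> box (- r) r \<Longrightarrow> \<phi> x = 0"
    using closure_subset[of "{x. \<phi> x \<noteq> 0}"] by (auto simp: test_function_def)
  have cont: "continuous_on UNIV (\<lambda>x. w x *\<^sub>R grad \<phi> x)" "continuous_on UNIV (\<lambda>x. \<phi> x *\<^sub>R grad w x)"
    "continuous_on UNIV (\<lambda>x. w x * partial \<phi> i x)" "continuous_on UNIV (\<lambda>x. \<phi> x * partial w i x)" for i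
    by (intro continuous_intros smooth_continuous smooth_continuous_grad smoothD w \<phi>)+
  have nth: "(LINT x|interior_measure. F x) $ i = (LINT x|interior_measure. F x $ i)"
    if "continuous_on UNIV F" for F :: "real^3 \<Rightarrow> real^3" and i
    using integral_inner_left[of "axis i 1" interior_measure F] integrable_interior[OF that]
    by (simp add: inner_axis)
  show "(LINT x|interior_measure. w x *\<^sub>R grad \<phi> x) = - (LINT x|interior_measure. \<phi> x *\<^sub>R grad w x)"
    unfolding vec_eq_iff
  proof
    fix i
    show "(LINT x|interior_measure. w x *\<^sub>R grad \<phi> x) $ i = (- (LINT x|interior_measure. \<phi> x *\<^sub>R grad w x)) $ i"
      using vol_by_parts[OF smooth_C1[OF w] smooth_C1[OF \<phi>] zero, of i]
      by (simp add: nth[OF cont(1)] nth[OF cont(2)] grad_nth integral_interior(2)[OF cont(3)] integral_interior(2)[OF cont(4)])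
  qed
qed

lemma smooth_H1_mean_zero:
  assumes w: "smooth w" and zero: "surf w = 0"
  shows "H1_mean_zero (box (- r) r) surface_measure w (grad w) w"
proof -
  have c: "continuous_on UNIV w" "continuous_on UNIV (grad w)"
    by (intro smooth_continuous smooth_continuous_grad w)+
  have "has_trace (box (- r) r) surface_measure w (grad w) w"
    unfolding has_trace_def
    by (intro conjI in_L2_surface c exI[of _ "\<lambda>n. w"]) (auto simp: w tendsto_L2_def)
  then show ?thesis
    by (simp add: H1_mean_zero_def H1_def in_L2_interior c weak_gradient_grad w mean_value_def
        integral_surface(2)[OF c(1)] zero)
qed

end

context steklov
begin

theorem is_sharp_constant_steklov:
  "is_sharp_constant (box (- r) r) surface_measure (\<mu> powr (- 1 / 2))"
  unfolding is_sharp_constant_def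
proof (intro conjI allI impI)
  show "trace_inequality (box (- r) r) surface_measure (\<mu> powr (- 1 / 2))"
    by (rule trace_inequality_steklov)
  fix C
  assume "trace_inequality (box (- r) r) surface_measure C"
  then have "L2_norm surface_measure eigenfunction \<le> C * L2_norm interior_measure (grad eigenfunction)"
    using smooth_H1_mean_zero[OF smooth_eigenfunction eigenfunction_surf_zero] by (auto simp: trace_inequality_def)
  moreover have "L2_norm interior_measure (grad eigenfunction) = sqrt (\<mu> * surf (\<lambda>x. (eigenfunction x)\<^sup>2))"
    by (simp add: L2_norm_def energy_grad smooth_eigenfunction partial_eigenfunction eigenfunction_energy)
  moreover have "L2_norm surface_measure eigenfunction = sqrt (surf (\<lambda>x. (eigenfunction x)\<^sup>2))"
    using integral_surface(2)[of "\<lambda>x. (eigenfunction x)\<^sup>2"] C1_D(1)[OF C1_eigenfunction]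
    by (simp add: L2_norm_def continuous_intros)
  ultimately have "1 * sqrt (surf (\<lambda>x. (eigenfunction x)\<^sup>2)) \<le> (C * sqrt \<mu>) * sqrt (surf (\<lambda>x. (eigenfunction x)\<^sup>2))"
    by (simp add: real_sqrt_mult mult.assoc)
  then have "1 \<le> C * sqrt \<mu>"
    by (rule mult_right_le_imp_le) (use eigenfunction_surf_pos in simp)
  then show "\<mu> powr (- 1 / 2) \<le> C"
    using \<mu>_pos by (simp add: powr_minus_divide powr_half_sqrt divide_le_eq)
qed

end

section \<open>The transcendental system\<close>

text \<open>The odd extension of \<open>z tanh z\<close> from \<open>z \<ge> 0\<close> to the whole line. It is a bijection of the reals,
  so its inverse is defined and continuous without restrictions on the domain.\<close>

definition mult_tanh :: "real \<Rightarrow> real" where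
  "mult_tanh z = z * tanh \<bar>z\<bar>"

lemma mult_tanh_strict_mono: "strict_mono mult_tanh"
proof (rule strict_monoI)
  have nonneg: "mult_tanh x < mult_tanh y" if "0 \<le> x" "x < y" for x y
    using that unfolding mult_tanh_def by (intro mult_strict_mono') auto
  fix x y :: real
  assume "x < y"
  consider "0 \<le> x" | "x < 0" "0 \<le> y" | "y < 0" by linarith
  then show "mult_tanh x < mult_tanh y"
  proof cases
    case 1
    then show ?thesis using \<open>x < y\<close> by (rule nonneg)
  next
    case 2
    then have "mult_tanh x < 0" "0 \<le> mult_tanh y"
      by (auto simp: mult_tanh_def zero_less_mult_iff)
    then show ?thesis by simp
  next
    case 3
    then show ?thesis
      using nonneg[of "- y" "- x"] \<open>x < y\<close> by (simp add: mult_tanh_def)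
  qed
qed

lemma isCont_mult_tanh: "isCont mult_tanh z"
  unfolding mult_tanh_def[abs_def] by (intro continuous_intros) auto

lemma surj_mult_tanh: "surj mult_tanh"
proof -
  have nonneg: "\<exists>z. mult_tanh z = y" if "0 \<le> y" for y
  proof -
    define z where "z = y / tanh 1 + 1"
    have t: "0 < tanh (1::real)" by simp
    have z: "1 \<le> z"
      using that t by (simp add: z_def)
    have "y \<le> z * tanh 1"
      using t by (simp add: z_def field_simps)
    also have "\<dots> \<le> mult_tanh z"
      using z unfolding mult_tanh_def by (intro mult_left_mono) auto
    finally have "y \<le> mult_tanh z" .
    then show ?thesis
      using IVT[of mult_tanh 0 y z] that z isCont_mult_tanh by (auto simp: mult_tanh_def)
  qed
  have "\<exists>z. y = mult_tanh z" for y
  proof (cases "0 \<le> y")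
    case True
    then show ?thesis using nonneg[of y] by blast
  next
    case False
    then obtain z where "mult_tanh z = - y"
      using nonneg[of "- y"] by auto
    then have "y = mult_tanh (- z)"
      by (simp add: mult_tanh_def)
    then show ?thesis ..
  qed
  then show ?thesis
    by (simp add: surj_def)
qed

definition inv_mult_tanh :: "real \<Rightarrow> real" where
  "inv_mult_tanh = inv mult_tanh"

lemma inv_mult_tanh [simp]:
  "inv_mult_tanh (mult_tanh z) = z" "mult_tanh (inv_mult_tanh y) = y"
  unfolding inv_mult_tanh_def
  using strict_mono_imp_inj_on[OF mult_tanh_strict_mono] surj_mult_tanh
  by (auto simp: inv_f_f surj_f_inv_f)

lemma isCont_inv_mult_tanh: "isCont inv_mult_tanh y"
proof -
  have "isCont inv_mult_tanh (mult_tanh (inv_mult_tanh y))"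
    by (rule isCont_inverse_function[where d = 1]) (auto simp: isCont_mult_tanh)
  then show ?thesis by simp
qed

lemma inv_mult_tanh_strict_mono: "x < y \<Longrightarrow> inv_mult_tanh x < inv_mult_tanh y"
  using strict_mono_less[OF mult_tanh_strict_mono, of "inv_mult_tanh x" "inv_mult_tanh y"] by simp

lemma inv_mult_tanh_0 [simp]: "inv_mult_tanh 0 = 0"
  using inv_mult_tanh(1)[of 0] by (simp add: mult_tanh_def)

lemma inv_mult_tanh_pos: "0 < y \<Longrightarrow> 0 < inv_mult_tanh y"
  using inv_mult_tanh_strict_mono[of 0 y] by simp

text \<open>Here \<open>t\<close> is the common value of the members of the system. The function \<open>Y\<close> increases strictly
  from \<open>0\<close> to beyond \<open>\<pi>/2\<close>. The difference of the two sides of the equation, multiplied by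
  \<open>sin (Y t)\<close> to avoid the pole of the cotangent, changes sign before \<open>Y\<close> reaches \<open>\<pi>/2\<close>; since
  \<open>x cot x\<close> is strictly decreasing, the zero is unique.\<close>

lemma exists_unique_frequency:
  fixes h1 h2 h3 :: real
  assumes h: "h1 > 0" "h2 > 0" "h3 > 0"
  defines "Y \<equiv> \<lambda>t. h3 * sqrt ((inv_mult_tanh (h1 * t) / h1)\<^sup>2 + (inv_mult_tanh (h2 * t) / h2)\<^sup>2)"
  shows "\<exists>!t. t > 0 \<and> Y t < pi / 2 \<and> Y t * cot (Y t) = h3 * t"
proof -
  have cont: "isCont Y t" for t
    unfolding Y_def by (intro continuous_intros isCont_o2[OF _ isCont_inv_mult_tanh]) (use h in auto)
  have mono: "Y s < Y t" if "0 \<le> s" "s < t" for s t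
  proof -
    have sq: "(inv_mult_tanh (k * s) / k)\<^sup>2 < (inv_mult_tanh (k * t) / k)\<^sup>2" if "k > 0" for k
    proof (rule power_strict_mono)
      show "inv_mult_tanh (k * s) / k < inv_mult_tanh (k * t) / k"
        using inv_mult_tanh_strict_mono[of "k * s" "k * t"] that \<open>s < t\<close> by (simp add: divide_strict_right_mono)
      show "0 \<le> inv_mult_tanh (k * s) / k"
        using inv_mult_tanh_pos[of "k * s"] that \<open>0 \<le> s\<close> by (cases "s = 0") auto
    qed simp
    show ?thesis
      using add_strict_mono[OF sq[OF h(1)] sq[OF h(2)]] h by (simp add: Y_def)
  qed
  have Y0: "Y 0 = 0"
    by (simp add: Y_def)
  have "\<exists>T>0. Y T = pi / 2"
  proof -
    define b where "b = h1 * (pi / 2 / h3)"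
    define T where "T = mult_tanh b / h1"
    have b: "0 < b" using h by (simp add: b_def)
    then have "0 < mult_tanh b"
      using strict_mono_less[OF mult_tanh_strict_mono, of 0 b] by (simp add: mult_tanh_def)
    then have T: "0 < T" using h by (simp add: T_def)
    have "pi / 2 = h3 * sqrt ((inv_mult_tanh (h1 * T) / h1)\<^sup>2)"
      using h b by (simp add: T_def) (simp add: b_def)
    also have "\<dots> \<le> Y T"
      unfolding Y_def using h by (intro mult_left_mono real_sqrt_le_mono) auto
    finally have "pi / 2 \<le> Y T" .
    then obtain t where "0 \<le> t" "Y t = pi / 2"
      using IVT[of Y 0 "pi / 2" T] T Y0 cont by auto
    moreover from this have "t \<noteq> 0"
      using Y0 by auto
    ultimately show ?thesis
      by (intro exI[of _ t]) simp
  qed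
  then obtain T where T: "T > 0" "Y T = pi / 2" by blast
  define G where "G t = h3 * t * sin (Y t) - Y t * cos (Y t)" for t
  have contG: "isCont G t" for t
    unfolding G_def by (intro continuous_intros cont isCont_o2[OF cont isCont_sin] isCont_o2[OF cont isCont_cos])
  obtain s where s: "0 < s" "s < T" "G s < 0"
  proof -
    have "isCont (\<lambda>t. cos (Y t) - h3 * t) 0"
      by (intro continuous_intros isCont_o2[OF cont isCont_cos])
    then have "((\<lambda>t. cos (Y t) - h3 * t) \<longlongrightarrow> 1) (at 0)"
      by (simp add: isCont_def Y0)
    then have "\<forall>\<^sub>F t in at_right 0. 0 < cos (Y t) - h3 * t"
      by (intro order_tendstoD) (auto intro: tendsto_mono[OF at_within_le_at])
    moreover have "\<forall>\<^sub>F t in at_right 0. t < T"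
      using T(1) by (auto simp: eventually_at_right)
    moreover have "\<forall>\<^sub>F t in at_right (0::real). 0 < t"
      by (rule eventually_at_right_less)
    ultimately have "\<forall>\<^sub>F t in at_right 0. 0 < t \<and> t < T \<and> 0 < cos (Y t) - h3 * t"
      by eventually_elim auto
    then obtain t where t: "0 < t" "t < T" "0 < cos (Y t) - h3 * t"
      using eventually_happens'[OF trivial_limit_at_right_real] by blast
    have "0 < Y t"
      using mono[of 0 t] t Y0 by simp
    then have "h3 * t * sin (Y t) \<le> h3 * t * Y t"
      using h t by (intro mult_left_mono sin_x_le_x) auto
    moreover have "0 < Y t * (cos (Y t) - h3 * t)"
      using \<open>0 < Y t\<close> t(3) by (rule mult_pos_pos)
    ultimately have "G t < 0"
      by (simp add: G_def algebra_simps)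
    then show ?thesis using that t by blast
  qed
  have GT: "0 < G T"
    using T(1) h unfolding G_def T(2) by simp
  obtain t where t: "s \<le> t" "t \<le> T" "G t = 0"
    using IVT[of G s 0 T] s GT contG by auto
  then have "t < T"
    using GT by (cases "t = T") auto
  then have Yt: "Y t < pi / 2" "0 < Y t"
    using mono[of t T] mono[of 0 t] T s t Y0 by auto
  then have "0 < sin (Y t)"
    using pi_gt_zero by (intro sin_gt_zero) linarith+
  then have "Y t * cot (Y t) = h3 * t"
    using \<open>G t = 0\<close> by (simp add: G_def cot_def field_simps)
  then have sol: "t > 0 \<and> Y t < pi / 2 \<and> Y t * cot (Y t) = h3 * t"
    using s t Yt by auto
  have less: False
    if "t > 0" "Y t' < pi / 2" "Y t * cot (Y t) = h3 * t" "Y t' * cot (Y t') = h3 * t'" "t < t'" for t t'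
  proof -
    have "0 < Y t" "Y t < Y t'"
      using that mono[of 0 t] mono[of t t'] Y0 by auto
    then have "Y t' * cot (Y t') < Y t * cot (Y t)"
      using that pi_gt_zero by (intro mult_cot_strict_decreasing) linarith+
    then show False
      using that h by (simp add: mult_less_cancel_left)
  qed
  show ?thesis
  proof (rule ex1I[of _ t])
    show "t > 0 \<and> Y t < pi / 2 \<and> Y t * cot (Y t) = h3 * t"
      by (rule sol)
    fix t'
    assume "t' > 0 \<and> Y t' < pi / 2 \<and> Y t' * cot (Y t') = h3 * t'"
    then show "t' = t"
      using less[of t t'] less[of t' t] sol by (cases t t' rule: linorder_cases) auto
  qed
qed

theorem theorem2p4:
  fixes h1 h2 h3 :: real and a b :: "real^3" and \<Omega> \<Gamma> :: "(real^3) set"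
    and system :: "real \<Rightarrow> real \<Rightarrow> bool"
  assumes pos: "h1 > 0" "h2 > 0" "h3 > 0"
    and max: "Max {h1, h2, h3} = h3"
    and a: "a = vector [- (h1 / 2), - (h2 / 2), - (h3 / 2)]"
    and b: "b = vector [h1 / 2, h2 / 2, h3 / 2]"
    and \<Omega>: "\<Omega> = box a b"
    and \<Gamma>: "\<Gamma> = frontier \<Omega>"
    and system: "\<And>z1 z2. system z1 z2 \<longleftrightarrow>
        z1 > 0 \<and> z2 > 0 \<and>
        z1 / h1 * tanh z1 = z2 / h2 * tanh z2 \<and>
        z2 / h2 * tanh z2 =
          z1 / h1 * sqrt (1 + (tanh z1)\<^sup>2 / (tanh z2)\<^sup>2) *
            cot (z1 * h3 / h1 * sqrt (1 + (tanh z1)\<^sup>2 / (tanh z2)\<^sup>2)) \<and>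
        0 < z1 * h3 / h1 * sqrt (1 + (tanh z1)\<^sup>2 / (tanh z2)\<^sup>2) \<and>
        z1 * h3 / h1 * sqrt (1 + (tanh z1)\<^sup>2 / (tanh z2)\<^sup>2) < pi / 2"
  shows "(\<exists>!(z1, z2). system z1 z2) \<and>
    (\<forall>z1 z2. system z1 z2 \<longrightarrow>
       is_sharp_constant \<Omega> (restrict_space (cuboid_surface a b) \<Gamma>)
         ((2 * z1 / h1 * tanh z1) powr (- 1 / 2)))"
proof (intro conjI allI impI)
  have norm: "z1 / h1 * sqrt (1 + (tanh z1)\<^sup>2 / (tanh z2)\<^sup>2) = sqrt ((z1 / h1)\<^sup>2 + (z2 / h2)\<^sup>2)"
    if "z1 > 0" "z2 > 0" "z1 / h1 * tanh z1 = z2 / h2 * tanh z2" for z1 z2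
  proof -
    have "z2 / h2 = z1 / h1 * (tanh z1 / tanh z2)"
      using that by (simp add: field_simps)
    then have "(z1 / h1)\<^sup>2 + (z2 / h2)\<^sup>2 = (z1 / h1)\<^sup>2 * (1 + (tanh z1)\<^sup>2 / (tanh z2)\<^sup>2)"
      by (simp add: power_mult_distrib power_divide distrib_left)
    then show ?thesis
      using that pos by (simp add: real_sqrt_mult)
  qed
  define Y where "Y t = h3 * sqrt ((inv_mult_tanh (h1 * t) / h1)\<^sup>2 + (inv_mult_tanh (h2 * t) / h2)\<^sup>2)" for t
  \<comment> \<open>the common value of the first two members determines both unknowns\<close>
  have system_iff: "system z1 z2 \<longleftrightarrow> (\<exists>t. (t > 0 \<and> Y t < pi / 2 \<and> Y t * cot (Y t) = h3 * t) \<and>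
      z1 = inv_mult_tanh (h1 * t) \<and> z2 = inv_mult_tanh (h2 * t))" for z1 z2
  proof -
    have param: "(z1 > 0 \<and> z2 > 0 \<and> z1 / h1 * tanh z1 = z2 / h2 * tanh z2) \<longleftrightarrow>
      (\<exists>t>0. z1 = inv_mult_tanh (h1 * t) \<and> z2 = inv_mult_tanh (h2 * t))"
    proof
      assume *: "z1 > 0 \<and> z2 > 0 \<and> z1 / h1 * tanh z1 = z2 / h2 * tanh z2"
      let ?t = "z1 / h1 * tanh z1"
      have scale: "k * (z / k * tanh z) = mult_tanh z" if "k > 0" "z > 0" for k z
        using that by (simp add: mult_tanh_def)
      have "h1 * ?t = mult_tanh z1" "h2 * (z2 / h2 * tanh z2) = mult_tanh z2"
        using * pos by (blast intro: scale)+
      moreover have "?t > 0"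
        using * pos by (intro mult_pos_pos divide_pos_pos) auto
      moreover have "?t = z2 / h2 * tanh z2"
        using * by simp
      ultimately have "?t > 0" "h1 * ?t = mult_tanh z1" "h2 * ?t = mult_tanh z2"
        by (simp_all only:)
      then show "\<exists>t>0. z1 = inv_mult_tanh (h1 * t) \<and> z2 = inv_mult_tanh (h2 * t)"
        by (intro exI[of _ ?t]) simp
    next
      assume "\<exists>t>0. z1 = inv_mult_tanh (h1 * t) \<and> z2 = inv_mult_tanh (h2 * t)"
      then obtain t where t: "t > 0" "z1 = inv_mult_tanh (h1 * t)" "z2 = inv_mult_tanh (h2 * t)"
        by blast
      then have "z1 > 0" "z2 > 0"
        using pos by (auto intro!: inv_mult_tanh_pos)
      moreover have "mult_tanh z1 = h1 * t" "mult_tanh z2 = h2 * t"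
        by (simp_all add: t)
      ultimately show "z1 > 0 \<and> z2 > 0 \<and> z1 / h1 * tanh z1 = z2 / h2 * tanh z2"
        using pos by (auto simp: mult_tanh_def)
    qed
    have rest: "z2 / h2 * tanh z2 =
          z1 / h1 * sqrt (1 + (tanh z1)\<^sup>2 / (tanh z2)\<^sup>2) *
            cot (z1 * h3 / h1 * sqrt (1 + (tanh z1)\<^sup>2 / (tanh z2)\<^sup>2)) \<and>
        0 < z1 * h3 / h1 * sqrt (1 + (tanh z1)\<^sup>2 / (tanh z2)\<^sup>2) \<and>
        z1 * h3 / h1 * sqrt (1 + (tanh z1)\<^sup>2 / (tanh z2)\<^sup>2) < pi / 2 \<longleftrightarrow>
        Y t < pi / 2 \<and> Y t * cot (Y t) = h3 * t"
      if t: "t > 0" "z1 = inv_mult_tanh (h1 * t)" "z2 = inv_mult_tanh (h2 * t)" for t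
    proof -
      have z: "z1 > 0" "z2 > 0" "z1 / h1 * tanh z1 = z2 / h2 * tanh z2"
        using param t by blast+
      have "mult_tanh z2 = h2 * t"
        by (simp add: t)
      then have "z2 / h2 * tanh z2 = t"
        using z pos by (simp add: mult_tanh_def)
      moreover have "z1 / h1 * sqrt (1 + (tanh z1)\<^sup>2 / (tanh z2)\<^sup>2) = Y t / h3"
        using norm[OF z] pos by (simp add: Y_def t)
      moreover from this have "z1 * h3 / h1 * sqrt (1 + (tanh z1)\<^sup>2 / (tanh z2)\<^sup>2) = Y t"
        using pos by (simp add: field_simps)
      moreover have "0 < Y t"
        unfolding Y_def t(2,3)[symmetric] using z(1,2) pos
        by (intro mult_pos_pos real_sqrt_gt_zero add_pos_pos zero_less_power divide_pos_pos)
      ultimately show ?thesis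
        using pos by (simp only:) (auto simp: field_simps)
    qed
    show ?thesis
      unfolding system using param rest by blast
  qed
  obtain t where t: "t > 0 \<and> Y t < pi / 2 \<and> Y t * cot (Y t) = h3 * t"
    and unique: "\<And>t'. t' > 0 \<and> Y t' < pi / 2 \<and> Y t' * cot (Y t') = h3 * t' \<Longrightarrow> t' = t"
    using exists_unique_frequency[OF pos] unfolding Y_def by blast
  show "\<exists>!(z1, z2). system z1 z2"
  proof (rule ex1I[of _ "(inv_mult_tanh (h1 * t), inv_mult_tanh (h2 * t))"])
    show "case (inv_mult_tanh (h1 * t), inv_mult_tanh (h2 * t)) of (z1, z2) \<Rightarrow> system z1 z2"
      using t by (auto simp: system_iff)
    show "z = (inv_mult_tanh (h1 * t), inv_mult_tanh (h2 * t))" if "case z of (z1, z2) \<Rightarrow> system z1 z2" for z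
      using that unique by (auto simp: system_iff)
  qed
  fix z1 z2
  assume "system z1 z2"
  then have z: "z1 > 0" "z2 > 0" "z1 / h1 * tanh z1 = z2 / h2 * tanh z2"
    and eq: "z2 / h2 * tanh z2 = z1 / h1 * sqrt (1 + (tanh z1)\<^sup>2 / (tanh z2)\<^sup>2) *
            cot (z1 * h3 / h1 * sqrt (1 + (tanh z1)\<^sup>2 / (tanh z2)\<^sup>2))"
    and less: "0 < z1 * h3 / h1 * sqrt (1 + (tanh z1)\<^sup>2 / (tanh z2)\<^sup>2)"
      "z1 * h3 / h1 * sqrt (1 + (tanh z1)\<^sup>2 / (tanh z2)\<^sup>2) < pi / 2"
    by (auto simp: system)
  define q where "q = sqrt (1 + (tanh z1)\<^sup>2 / (tanh z2)\<^sup>2)"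
  have q: "q > 0"
    using z by (simp add: q_def add_pos_nonneg)
  have h: "h1 \<le> h3" "h2 \<le> h3"
    using max by (metis Max_ge finite.intros insertCI)+
  have ab: "a = - b"
    by (simp add: a b vec_eq_iff forall_3)
  interpret steklov b "2 * z1 / h1" "2 * z2 / h2" "2 * z1 / h1 * q" "2 * z1 / h1 * tanh z1"
  proof
    show "b $ i > 0" for i
      using pos by (cases i rule: index_cases) (simp_all add: b)
    show "b $ 1 \<le> b $ 3" "b $ 2 \<le> b $ 3"
      using h by (simp_all add: b)
    show "2 * z1 / h1 > 0" "2 * z2 / h2 > 0" "2 * z1 / h1 * q > 0"
      using z pos q by simp_all
    show "2 * z1 / h1 * tanh (2 * z1 / h1 * b $ 1) = 2 * z1 / h1 * tanh z1"
      using pos by (simp add: b)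
    show "2 * z2 / h2 * tanh (2 * z2 / h2 * b $ 2) = 2 * z1 / h1 * tanh z1"
      using pos z(3) by (simp add: b)
    have r3: "2 * z1 / h1 * q * b $ 3 = z1 * h3 / h1 * q"
      by (simp add: b)
    show "2 * z1 / h1 * q * b $ 3 < pi / 2"
      unfolding r3 using less by (simp add: q_def)
    have "z1 / h1 * tanh z1 = z1 / h1 * q * cot (z1 * h3 / h1 * q)"
      using eq z(3) by (simp only: q_def)
    then show "2 * z1 / h1 * q * cot (2 * z1 / h1 * q * b $ 3) = 2 * z1 / h1 * tanh z1"
      unfolding r3 by (metis times_divide_eq_right mult.assoc)
    have "z1 / h1 * q = sqrt ((z1 / h1)\<^sup>2 + (z2 / h2)\<^sup>2)"
      unfolding q_def by (rule norm[OF z])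
    then have "(z1 / h1 * q)\<^sup>2 = (z1 / h1)\<^sup>2 + (z2 / h2)\<^sup>2"
      by simp
    then show "(2 * z1 / h1 * q)\<^sup>2 = (2 * z1 / h1)\<^sup>2 + (2 * z2 / h2)\<^sup>2"
      by (simp add: power_mult_distrib power_divide)
  qed
  show "is_sharp_constant \<Omega> (restrict_space (cuboid_surface a b) \<Gamma>) ((2 * z1 / h1 * tanh z1) powr (- 1 / 2))"
    unfolding \<Gamma> \<Omega> ab by (rule is_sharp_constant_steklov)
qed

end
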